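(* Let $\mathbb{O}$ be a strictly factorisable operadic category. Then the pita nerve of $\mathbb{O}$, that is, the sequence of categories $P(\mathbb{O})_n$, $n\ge 0$, together with the face operators $d_i$, the degeneracy operators $s_i$ and the natural transformations $\beta_n: d_{n+1}d_{n+1}\Rightarrow d_{n+1}d_{n+2}: P(\mathbb{O})_{n+2}\to P(\mathbb{O})_n$ defined in the context, is a (coherent) toplax simplicial category, i.e. a toplax simplicial object in $\mathrm{Cat}$.
   Context: **The category $\mathbb{F}$.** Objects: $\underline n=\{1,\dots,n\}$, $n\ge 0$; morphisms: all set maps. $\underline 1$ is its unique terminal object. For $f:\underline m\to\underline n$ and $i\in\underline n$, the fibre $f^{-1}(i)$ is the object of $\mathbb{F}$ with the cardinality of $\{j\in \underline m: f(j)=i\}$, and $\epsilon_{f,i}:f^{-1}(i)\to\underline m$ is the unique order-preserving injection with this image. For $g:\underline\ell\to\underline m$ the fibre map $g_i:(fg)^{-1}(i)\to f^{-1}(i)$ is the unique map with $\epsilon_{f,i}\,g_i=g\,\epsilon_{fg,i}$. **Operadic category.** A category $\mathbb{O}$ with: (D1) a chosen terminal object in each connected component (chosen local terminals); $\tau_R:R\to U_R$ denotes the unique map to the chosen terminal object of the component of $R$; (D2) a cardinality functor $|\cdot|:\mathbb{O}\to\mathbb{F}$; (D3) for each $R\in\mathbb{O}$ and $i\in|R|$ a fibre functor $\mathbb{O}/R\to\mathbb{O}$, sending $g:S\to R$ to the fibre $g^{-1}(i)$ and sending $f:T\to S$, viewed as a morphism $gf\to g$ in $\mathbb{O}/R$,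 to the fibre map $f_i:(gf)^{-1}(i)\to g^{-1}(i)$. Axioms: (A1) if $R$ is local terminal then $|R|=\underline 1$; (A2) $(\mathrm{id}_R)^{-1}(i)$ is chosen local terminal; (A3) $|g^{-1}(i)|=|g|^{-1}(i)$ and $|f_i|=|f|_i$; (A4) $\tau_R^{-1}(1)=R$, and for $g:S\to R$ the fibre map with respect to $\tau_R$ is $g_1=g$; (A5) for $f:gf\to g$ in $\mathbb{O}/R$, $i\in|R|$, $j\in|g|^{-1}(i)$, one has $(f_i)^{-1}(j)=f^{-1}(\epsilon j)$ with $\epsilon=\epsilon_{|g|,i}$, and for $h:gfh\to gf$ one has $(h_i)_j=h_{\epsilon j}$. **Quasibijections, order-preserving, fop.** A morphism is a quasibijection if all its fibres are chosen local terminal objects. A morphism $\lambda$ is order-preserving if $|\lambda|$ is order-preserving. In a commutative square $\tau f=g\sigma$ with $f:T\to S$, $g:T'\to S'$, $\sigma:T\to T'$, $\tau:S\to S'$, one says $\sigma$ is fibrewise order-preserving (fop) with respect to $\tau$ if for each $i\in|S'|$ the fibre map $\sigma_i:(\tau f)^{-1}(i)\to g^{-1}(i)$ is order-preserving; the square is then a fop square (a fop triangle if $\tau=\mathrm{id}$). **Strictly factorisable.** $\mathbb{O}$ is strongly factorisable if each $f:T\to R$ has a unique factorisation $f=\eta(f)\,\pi(f)$, $\pi(f):T\to T'$, with $\pi(f)$ a quasibijection, $\eta(f)$ order-preserving, and the triangle fop. It is strictly factorisable if moreover for each $T\xrightarrow{f}S\xrightarrow{g}R$, writing $T'$ and $S'$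 for the middle objects of the factorisations of $gf$ and $g$, there is a unique morphism $\eta(f/g):T'\to S'$ with $\eta(f/g)\,\pi(gf)=\pi(g)\,f$ and $\eta(g)\,\eta(f/g)=\eta(gf)$. **The simplicial category $W(\mathbb{O})$.** Objects of $W(\mathbb{O})_n$: chains $T_n\xrightarrow{f_n}\cdots\xrightarrow{f_1}T_0$. Morphisms to $S_n\xrightarrow{g_n}\cdots\xrightarrow{g_1}S_0$: families of quasibijections $\sigma_k:T_k\to S_k$ commuting with the $f_k,g_k$ such that each $\sigma_k$ is fop with respect to $\sigma_0$ (for the square with vertical sides $f_1\cdots f_k$ and $g_1\cdots g_k$). The $W(\mathbb{O})_n$ form a strict simplicial category: the face $\delta_0$ omits $T_n$, $\delta_i$ ($0<i<n$) composes at $T_{n-i}$, $\delta_n$ omits $T_0$, and the degeneracy $\gamma_i$ inserts an identity at $T_{n-i}$. **The categories $P(\mathbb{O})_n$ and reflections.** $P(\mathbb{O})_n\subset W(\mathbb{O})_n$ is the full subcategory of locally order-preserving chains, those for which all composites $f_1\cdots f_k:T_k\to T_0$ are order-preserving. The inclusion has a left adjoint $r_n$: it sends a chain to $T'_n\to\cdots\to T'_1\to T_0$ where $T'_k$ is the middle object of the factorisation of $f_1\cdots f_k$, with maps $\eta(f_k/f_1\cdots f_{k-1})$ for $k\ge2$ and $\eta(f_1)$ for $k=1$; on a morphism $(\sigma_k)$ it has components $\sigma_0$ and $\pi(\sigma_0\,\eta(f_1\cdots f_k))$ for $k\geq 1$. The unit $\pi_n$ has components $\pi(f_1\cdots f_k)$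 for $k\ge1$ and $\mathrm{id}_{T_0}$. **Pita nerve.** On $P(\mathbb{O})_n$: $d_i$ is the restriction of $\delta_i$ for $0\le i<n$; $s_i$ is the restriction of $\gamma_i$ for $0\le i\le n$; the top face is $d_n=r_{n-1}\delta_n:P(\mathbb{O})_n\to P(\mathbb{O})_{n-1}$. The transformation $\beta_n$ is the composite $$d_{n+1}d_{n+1}=r_n\delta_{n+1}\delta_{n+1}=r_n\delta_{n+1}\delta_{n+2}\Rightarrow r_n\delta_{n+1}r_{n+1}\delta_{n+2}=d_{n+1}d_{n+2}$$ induced by the unit $\pi_{n+1}$ applied at $\delta_{n+2}$ (inclusions suppressed). **Toplax simplicial object** in a $2$-category: objects $X_n$, $n\ge0$; face and degeneracy operators $d_i,s_i$ as in a simplicial object; $2$-cells $\beta_n:d_{n+1}d_{n+1}\Rightarrow d_{n+1}d_{n+2}:X_{n+2}\to X_n$ for $n\geq 0$. Axioms: all simplicial identities hold strictly except $d_{n+1}d_{n+1}=d_{n+1}d_{n+2}:X_{n+2}\to X_n$ (the ones involving two consecutive top face operators), and for all $n\ge0$: (i) $(d_{n+1}\beta_{n+1})\circ(\beta_n d_{n+2})=(\beta_n d_{n+3})\circ(\beta_n d_{n+1})$ as $2$-cells $d_{n+1}d_{n+1}d_{n+1}\Rightarrow d_{n+1}d_{n+2}d_{n+3}$ (using the strict identities $d_{n+1}d_{n+1}=d_{n+1}d_{n+2}$ and $d_{n+2}d_{n+1}=d_{n+1}d_{n+3}$ on $X_{n+3}$); (ii) $\beta_n s_{n+1}=\mathrm{id}$;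 (iii) $d_i\beta_{n+1}=\beta_n d_i$ for $0\le i\le n$; (iv) $\beta_{n+1}s_i=s_i\beta_n$ for $0\le i\le n$. *)

theory Defs
  imports "HOL-Library.FuncSet"
begin

section \<open>Categories, functors, natural transformations\<close>

record ('o, 'a) cat =
  Obj :: "'o set"
  Arr :: "'a set"
  Dom :: "'a \<Rightarrow> 'o"
  Cod :: "'a \<Rightarrow> 'o"
  Idn :: "'o \<Rightarrow> 'a"
  Comp :: "'a \<Rightarrow> 'a \<Rightarrow> 'a"  (infixl "\<cdot>\<index>" 70)

definition Hom :: "('o, 'a, 'm) cat_scheme \<Rightarrow> 'o \<Rightarrow> 'o \<Rightarrow> 'a set" where
  "Hom C x y = {f \<in> Arr C. Dom C f = x \<and> Cod C f = y}"

locale category =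
  fixes C :: "('o, 'a, 'm) cat_scheme" (structure)
  assumes Dom_Obj: "f \<in> Arr C \<Longrightarrow> Dom C f \<in> Obj C"
    and Cod_Obj: "f \<in> Arr C \<Longrightarrow> Cod C f \<in> Obj C"
    and Idn_Hom: "x \<in> Obj C \<Longrightarrow> Idn C x \<in> Hom C x x"
    and Comp_Hom: "\<lbrakk>f \<in> Hom C x y; g \<in> Hom C y z\<rbrakk> \<Longrightarrow> g \<cdot> f \<in> Hom C x z"
    and Comp_Idn_left: "f \<in> Hom C x y \<Longrightarrow> Idn C y \<cdot> f = f"
    and Comp_Idn_right: "f \<in> Hom C x y \<Longrightarrow> f \<cdot> Idn C x = f"
    and Comp_assoc: "\<lbrakk>f \<in> Hom C w x; g \<in> Hom C x y; h \<in> Hom C y z\<rbrakk>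
          \<Longrightarrow> h \<cdot> (g \<cdot> f) = (h \<cdot> g) \<cdot> f"

definition full_subcat :: "('o, 'a, 'm) cat_scheme \<Rightarrow> 'o set \<Rightarrow> ('o, 'a) cat" where
  "full_subcat C A =
     \<lparr>Obj = Obj C \<inter> A, Arr = {f \<in> Arr C. Dom C f \<in> A \<and> Cod C f \<in> A},
      Dom = Dom C, Cod = Cod C, Idn = Idn C, Comp = Comp C\<rparr>"

text \<open>The arrow \<open>(g, f)\<close> of the slice is \<open>f\<close> viewed as an arrow from \<open>g f\<close> to \<open>g\<close>.\<close>

definition slice :: "('o, 'a, 'm) cat_scheme \<Rightarrow> 'o \<Rightarrow> ('a, 'a \<times> 'a) cat" where
  "slice C R =
     \<lparr>Obj = {g \<in> Arr C. Cod C g = R},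
      Arr = {(g, f). g \<in> Arr C \<and> f \<in> Arr C \<and> Cod C g = R \<and> Cod C f = Dom C g},
      Dom = (\<lambda>(g, f). g \<cdot>\<^bsub>C\<^esub> f),
      Cod = (\<lambda>(g, f). g),
      Idn = (\<lambda>g. (g, Idn C (Dom C g))),
      Comp = (\<lambda>(g, f) (g', f'). (g, f \<cdot>\<^bsub>C\<^esub> f'))\<rparr>"

record ('o, 'a, 'p, 'b) ftr =
  ob_map :: "'o \<Rightarrow> 'p"
  arr_map :: "'a \<Rightarrow> 'b"

locale cat_functor = C: category C + D: category D
  for C :: "('o, 'a, 'm) cat_scheme" and D :: "('p, 'b, 'n) cat_scheme"
    and F :: "('o, 'a, 'p, 'b) ftr" +
  assumes ob_map_Obj: "x \<in> Obj C \<Longrightarrow> ob_map F x \<in> Obj D"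
    and arr_map_Hom: "f \<in> Hom C x y \<Longrightarrow> arr_map F f \<in> Hom D (ob_map F x) (ob_map F y)"
    and arr_map_Idn: "x \<in> Obj C \<Longrightarrow> arr_map F (Idn C x) = Idn D (ob_map F x)"
    and arr_map_Comp: "\<lbrakk>f \<in> Hom C x y; g \<in> Hom C y z\<rbrakk>
          \<Longrightarrow> arr_map F (g \<cdot>\<^bsub>C\<^esub> f) = arr_map F g \<cdot>\<^bsub>D\<^esub> arr_map F f"

definition ftr_id :: "('o, 'a, 'o, 'a) ftr" where
  "ftr_id = \<lparr>ob_map = (\<lambda>x. x), arr_map = (\<lambda>f. f)\<rparr>"

definition ftr_comp ::
    "('p, 'b, 'q, 'c) ftr \<Rightarrow> ('o, 'a, 'p, 'b) ftr \<Rightarrow> ('o, 'a, 'q, 'c) ftr"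
    (infixr "\<circ>\<^sub>F" 75) where
  "G \<circ>\<^sub>F F = \<lparr>ob_map = ob_map G \<circ> ob_map F, arr_map = arr_map G \<circ> arr_map F\<rparr>"

text \<open>Functors with source \<open>C\<close> are equal if they agree on the carriers of \<open>C\<close>; their values
  outside are irrelevant.\<close>

definition ftr_eq ::
    "('o, 'a, 'm) cat_scheme \<Rightarrow> ('o, 'a, 'p, 'b) ftr \<Rightarrow> ('o, 'a, 'p, 'b) ftr \<Rightarrow> bool" where
  "ftr_eq C F G \<longleftrightarrow> (\<forall>x\<in>Obj C. ob_map F x = ob_map G x) \<and> (\<forall>f\<in>Arr C. arr_map F f = arr_map G f)"

locale nat_trans = F: cat_functor C D F + G: cat_functor C D G
  for C :: "('o, 'a, 'm) cat_scheme" and D :: "('p, 'b, 'n) cat_scheme"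
    and F :: "('o, 'a, 'p, 'b) ftr" and G :: "('o, 'a, 'p, 'b) ftr"
    and t :: "'o \<Rightarrow> 'b" +
  assumes component_Hom: "x \<in> Obj C \<Longrightarrow> t x \<in> Hom D (ob_map F x) (ob_map G x)"
    and naturality: "f \<in> Hom C x y \<Longrightarrow> t y \<cdot>\<^bsub>D\<^esub> arr_map F f = arr_map G f \<cdot>\<^bsub>D\<^esub> t x"

definition nat_eq :: "('o, 'a, 'm) cat_scheme \<Rightarrow> ('o \<Rightarrow> 'b) \<Rightarrow> ('o \<Rightarrow> 'b) \<Rightarrow> bool" where
  "nat_eq C t u \<longleftrightarrow> (\<forall>x\<in>Obj C. t x = u x)"

definition nat_id :: "('p, 'b, 'n) cat_scheme \<Rightarrow> ('o, 'a, 'p, 'b) ftr \<Rightarrow> 'o \<Rightarrow> 'b" where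
  "nat_id D F = (\<lambda>x. Idn D (ob_map F x))"

definition vcomp :: "('p, 'b, 'n) cat_scheme \<Rightarrow> ('o \<Rightarrow> 'b) \<Rightarrow> ('o \<Rightarrow> 'b) \<Rightarrow> 'o \<Rightarrow> 'b" where
  "vcomp D u t = (\<lambda>x. u x \<cdot>\<^bsub>D\<^esub> t x)"

definition post_whisker :: "('p, 'b, 'q, 'c) ftr \<Rightarrow> ('o \<Rightarrow> 'b) \<Rightarrow> 'o \<Rightarrow> 'c" (infixr "\<lhd>\<^sub>F" 74) where
  "H \<lhd>\<^sub>F t = (\<lambda>x. arr_map H (t x))"

definition pre_whisker :: "('o \<Rightarrow> 'b) \<Rightarrow> ('n, 'd, 'o, 'a) ftr \<Rightarrow> 'n \<Rightarrow> 'b" (infixl "\<rhd>\<^sub>F" 75) where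
  "t \<rhd>\<^sub>F K = (\<lambda>x. t (ob_map K x))"


section \<open>Toplax simplicial objects in Cat\<close>

text \<open>\<open>d m i\<close> is the face operator \<open>d\<^sub>i : X\<^sub>m \<rightarrow> X\<^bsub>m-1\<^esub>\<close> (for \<open>m > 0\<close>, \<open>i \<le> m\<close>) and
  \<open>s m i\<close> the degeneracy operator \<open>s\<^sub>i : X\<^sub>m \<rightarrow> X\<^bsub>m+1\<^esub>\<close> (for \<open>i \<le> m\<close>). The condition
  \<open>i \<noteq> m + 1 \<or> j \<noteq> m + 2\<close> in \<open>face_face\<close> excludes precisely the identity between
  two consecutive top faces.\<close>

locale toplax_simplicial_category =
  fixes X :: "nat \<Rightarrow> ('o, 'a, 'm) cat_scheme"
    and d :: "nat \<Rightarrow> nat \<Rightarrow> ('o, 'a, 'o, 'a) ftr"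
    and s :: "nat \<Rightarrow> nat \<Rightarrow> ('o, 'a, 'o, 'a) ftr"
    and \<beta> :: "nat \<Rightarrow> 'o \<Rightarrow> 'a"
  assumes X_category: "category (X n)"
    and face_functor: "i \<le> n + 1 \<Longrightarrow> cat_functor (X (n + 1)) (X n) (d (n + 1) i)"
    and degeneracy_functor: "i \<le> n \<Longrightarrow> cat_functor (X n) (X (n + 1)) (s n i)"
    and beta_nat_trans:
      "nat_trans (X (n + 2)) (X n)
         (d (n + 1) (n + 1) \<circ>\<^sub>F d (n + 2) (n + 1))
         (d (n + 1) (n + 1) \<circ>\<^sub>F d (n + 2) (n + 2)) (\<beta> n)"
    and face_face:
      "\<lbrakk>i < j; j \<le> m + 2; i \<noteq> m + 1 \<or> j \<noteq> m + 2\<rbrakk> \<Longrightarrow>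
         ftr_eq (X (m + 2)) (d (m + 1) i \<circ>\<^sub>F d (m + 2) j) (d (m + 1) (j - 1) \<circ>\<^sub>F d (m + 2) i)"
    and face_degeneracy_less:
      "\<lbrakk>i < j; j \<le> m + 1\<rbrakk> \<Longrightarrow>
         ftr_eq (X (m + 1)) (d (m + 2) i \<circ>\<^sub>F s (m + 1) j) (s m (j - 1) \<circ>\<^sub>F d (m + 1) i)"
    and face_degeneracy_same:
      "\<lbrakk>j \<le> m; i = j \<or> i = j + 1\<rbrakk> \<Longrightarrow> ftr_eq (X m) (d (m + 1) i \<circ>\<^sub>F s m j) ftr_id"
    and face_degeneracy_greater:
      "\<lbrakk>j + 1 < i; i \<le> m + 2\<rbrakk> \<Longrightarrow>
         ftr_eq (X (m + 1)) (d (m + 2) i \<circ>\<^sub>F s (m + 1) j) (s m j \<circ>\<^sub>F d (m + 1) (i - 1))"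
    and degeneracy_degeneracy:
      "\<lbrakk>i \<le> j; j \<le> m\<rbrakk> \<Longrightarrow>
         ftr_eq (X m) (s (m + 1) i \<circ>\<^sub>F s m j) (s (m + 1) (j + 1) \<circ>\<^sub>F s m i)"
    and beta_coherence:
      "nat_eq (X (n + 3))
         (vcomp (X n) (d (n + 1) (n + 1) \<lhd>\<^sub>F \<beta> (n + 1)) (\<beta> n \<rhd>\<^sub>F d (n + 3) (n + 2)))
         (vcomp (X n) (\<beta> n \<rhd>\<^sub>F d (n + 3) (n + 3)) (\<beta> n \<rhd>\<^sub>F d (n + 3) (n + 1)))"
    and beta_top_degeneracy:
      "nat_eq (X (n + 1)) (\<beta> n \<rhd>\<^sub>F s (n + 1) (n + 1)) (nat_id (X n) (d (n + 1) (n + 1)))"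
    and beta_face:
      "i \<le> n \<Longrightarrow> nat_eq (X (n + 3)) (d (n + 1) i \<lhd>\<^sub>F \<beta> (n + 1)) (\<beta> n \<rhd>\<^sub>F d (n + 3) i)"
    and beta_degeneracy:
      "i \<le> n \<Longrightarrow> nat_eq (X (n + 2)) (\<beta> (n + 1) \<rhd>\<^sub>F s (n + 2) i) (s n i \<lhd>\<^sub>F \<beta> n)"


section \<open>The category of finite ordinals\<close>

text \<open>The object \<open>n\<close> stands for \<open>{1..n}\<close>. Underlying functions of arrows are extensional
  (\<open>undefined\<close> outside \<open>{1..m}\<close>), so that equality of arrows is equality of maps.\<close>

datatype finmap = FinMap (fdom: nat) (fcod: nat) (fapp: "nat \<Rightarrow> nat")

definition FinCat :: "(nat, finmap) cat" where
  "FinCat =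
     \<lparr>Obj = UNIV,
      Arr = {f. fapp f \<in> {1..fdom f} \<rightarrow>\<^sub>E {1..fcod f}},
      Dom = fdom, Cod = fcod,
      Idn = (\<lambda>n. FinMap n n (\<lambda>j\<in>{1..n}. j)),
      Comp = (\<lambda>g f. FinMap (fdom f) (fcod g) (\<lambda>j\<in>{1..fdom f}. fapp g (fapp f j)))\<rparr>"

definition fin_fibre :: "finmap \<Rightarrow> nat \<Rightarrow> nat" where
  "fin_fibre f i = card {j \<in> {1..fdom f}. fapp f j = i}"

definition fin_eps :: "finmap \<Rightarrow> nat \<Rightarrow> finmap" where
  "fin_eps f i = (THE e. e \<in> Hom FinCat (fin_fibre f i) (fdom f)
      \<and> mono_on {1..fdom e} (fapp e) \<and> inj_on (fapp e) {1..fdom e}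
      \<and> fapp e ` {1..fdom e} = {j \<in> {1..fdom f}. fapp f j = i})"

definition fin_fibre_map :: "finmap \<Rightarrow> finmap \<Rightarrow> nat \<Rightarrow> finmap" where
  "fin_fibre_map f g i =
     (THE h. h \<in> Hom FinCat (fin_fibre (f \<cdot>\<^bsub>FinCat\<^esub> g) i) (fin_fibre f i)
        \<and> fin_eps f i \<cdot>\<^bsub>FinCat\<^esub> h = g \<cdot>\<^bsub>FinCat\<^esub> fin_eps (f \<cdot>\<^bsub>FinCat\<^esub> g) i)"


section \<open>Operadic categories\<close>

definition connected_objs :: "('o, 'a, 'm) cat_scheme \<Rightarrow> 'o \<Rightarrow> 'o \<Rightarrow> bool" where
  "connected_objs C x y \<longleftrightarrow>
     (let E = {(Dom C f, Cod C f) | f. f \<in> Arr C} in (x, y) \<in> (E \<union> E\<inverse>)\<^sup>*)"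

definition local_terminal :: "('o, 'a, 'm) cat_scheme \<Rightarrow> 'o \<Rightarrow> bool" where
  "local_terminal C U \<longleftrightarrow>
     U \<in> Obj C \<and> (\<forall>x\<in>Obj C. connected_objs C x U \<longrightarrow> (\<exists>!f. f \<in> Hom C x U))"

text \<open>\<open>LT\<close> is the set of chosen local terminals, \<open>Card\<close> the cardinality functor and
  \<open>Fibre R i\<close> the \<open>i\<close>-th fibre functor on the slice over \<open>R\<close>.\<close>

record ('o, 'a) opcat = "('o, 'a) cat" +
  LT :: "'o set"
  Card :: "('o, 'a, nat, finmap) ftr"
  Fibre :: "'o \<Rightarrow> nat \<Rightarrow> ('a, 'a \<times> 'a, 'o, 'a) ftr"

abbreviation card_ob :: "('o, 'a, 'm) opcat_scheme \<Rightarrow> 'o \<Rightarrow> nat" where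
  "card_ob \<O> R \<equiv> ob_map (Card \<O>) R"

abbreviation card_arr :: "('o, 'a, 'm) opcat_scheme \<Rightarrow> 'a \<Rightarrow> finmap" where
  "card_arr \<O> f \<equiv> arr_map (Card \<O>) f"

abbreviation fibre :: "('o, 'a, 'm) opcat_scheme \<Rightarrow> 'a \<Rightarrow> nat \<Rightarrow> 'o" where
  "fibre \<O> g i \<equiv> ob_map (Fibre \<O> (Cod \<O> g) i) g"

text \<open>The fibre map \<open>f\<^sub>i : (g f)\<^sup>-\<^sup>1(i) \<rightarrow> g\<^sup>-\<^sup>1(i)\<close>, which depends on \<open>g\<close>.\<close>

abbreviation fibre_map :: "('o, 'a, 'm) opcat_scheme \<Rightarrow> 'a \<Rightarrow> 'a \<Rightarrow> nat \<Rightarrow> 'a" where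
  "fibre_map \<O> g f i \<equiv> arr_map (Fibre \<O> (Cod \<O> g) i) (g, f)"

definition chosen_terminal :: "('o, 'a, 'm) opcat_scheme \<Rightarrow> 'o \<Rightarrow> 'o" where
  "chosen_terminal \<O> R = (THE U. U \<in> LT \<O> \<and> connected_objs \<O> R U)"

definition tau :: "('o, 'a, 'm) opcat_scheme \<Rightarrow> 'o \<Rightarrow> 'a" where
  "tau \<O> R = (THE f. f \<in> Hom \<O> R (chosen_terminal \<O> R))"

locale operadic_category = category \<O>
  for \<O> :: "('o, 'a, 'm) opcat_scheme" (structure) +
  assumes LT_local_terminal: "U \<in> LT \<O> \<Longrightarrow> local_terminal \<O> U"
    and LT_unique: "R \<in> Obj \<O> \<Longrightarrow> \<exists>!U. U \<in> LT \<O> \<and> connected_objs \<O> R U"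
    and Card_functor: "cat_functor \<O> FinCat (Card \<O>)"
    and Fibre_functor: "\<lbrakk>R \<in> Obj \<O>; i \<in> {1..card_ob \<O> R}\<rbrakk>
          \<Longrightarrow> cat_functor (slice \<O> R) \<O> (Fibre \<O> R i)"
    and A1: "local_terminal \<O> R \<Longrightarrow> card_ob \<O> R = 1"
    and A2: "\<lbrakk>R \<in> Obj \<O>; i \<in> {1..card_ob \<O> R}\<rbrakk> \<Longrightarrow> fibre \<O> (Idn \<O> R) i \<in> LT \<O>"
    and A3_ob: "\<lbrakk>g \<in> Hom \<O> S R; i \<in> {1..card_ob \<O> R}\<rbrakk>
          \<Longrightarrow> card_ob \<O> (fibre \<O> g i) = fin_fibre (card_arr \<O> g) i"
    and A3_arr: "\<lbrakk>f \<in> Hom \<O> T S; g \<in> Hom \<O> S R; i \<in> {1..card_ob \<O> R}\<rbrakk>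
          \<Longrightarrow> card_arr \<O> (fibre_map \<O> g f i) = fin_fibre_map (card_arr \<O> g) (card_arr \<O> f) i"
    and A4_ob: "R \<in> Obj \<O> \<Longrightarrow> fibre \<O> (tau \<O> R) 1 = R"
    and A4_arr: "g \<in> Hom \<O> S R \<Longrightarrow> fibre_map \<O> (tau \<O> R) g 1 = g"
    and A5_ob: "\<lbrakk>f \<in> Hom \<O> T S; g \<in> Hom \<O> S R; i \<in> {1..card_ob \<O> R};
            j \<in> {1..fin_fibre (card_arr \<O> g) i}\<rbrakk>
          \<Longrightarrow> fibre \<O> (fibre_map \<O> g f i) j = fibre \<O> f (fapp (fin_eps (card_arr \<O> g) i) j)"
    and A5_arr: "\<lbrakk>h \<in> Hom \<O> Q T; f \<in> Hom \<O> T S; g \<in> Hom \<O> S R; i \<in> {1..card_ob \<O> R};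
            j \<in> {1..fin_fibre (card_arr \<O> g) i}\<rbrakk>
          \<Longrightarrow> fibre_map \<O> (fibre_map \<O> g f i) (fibre_map \<O> (g \<cdot> f) h i) j
              = fibre_map \<O> f h (fapp (fin_eps (card_arr \<O> g) i) j)"


section \<open>Strictly factorisable operadic categories\<close>

definition quasibijection :: "('o, 'a, 'm) opcat_scheme \<Rightarrow> 'a \<Rightarrow> bool" where
  "quasibijection \<O> f \<longleftrightarrow>
     f \<in> Arr \<O> \<and> (\<forall>i\<in>{1..card_ob \<O> (Cod \<O> f)}. fibre \<O> f i \<in> LT \<O>)"

definition order_preserving :: "('o, 'a, 'm) opcat_scheme \<Rightarrow> 'a \<Rightarrow> bool" where
  "order_preserving \<O> f \<longleftrightarrow>
     f \<in> Arr \<O> \<and> mono_on {1..card_ob \<O> (Dom \<O> f)} (fapp (card_arr \<O> f))"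

text \<open>\<open>fop \<O> f g \<sigma> \<tau>\<close>: the square \<open>\<tau> f = g \<sigma>\<close> with \<open>f : T \<rightarrow> S\<close>, \<open>g : T' \<rightarrow> S'\<close>,
  \<open>\<sigma> : T \<rightarrow> T'\<close>, \<open>\<tau> : S \<rightarrow> S'\<close> commutes, and \<open>\<sigma>\<close> is fibrewise order-preserving with
  respect to \<open>\<tau>\<close>.\<close>

definition fop :: "('o, 'a, 'm) opcat_scheme \<Rightarrow> 'a \<Rightarrow> 'a \<Rightarrow> 'a \<Rightarrow> 'a \<Rightarrow> bool" where
  "fop \<O> f g \<sigma> \<tau> \<longleftrightarrow>
     f \<in> Arr \<O> \<and> g \<in> Arr \<O> \<and> \<sigma> \<in> Hom \<O> (Dom \<O> f) (Dom \<O> g) \<and> \<tau> \<in> Hom \<O> (Cod \<O> f) (Cod \<O> g)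
     \<and> \<tau> \<cdot>\<^bsub>\<O>\<^esub> f = g \<cdot>\<^bsub>\<O>\<^esub> \<sigma>
     \<and> (\<forall>i\<in>{1..card_ob \<O> (Cod \<O> g)}. order_preserving \<O> (fibre_map \<O> g \<sigma> i))"

text \<open>In \<open>factorisation\<close>, the equation \<open>f = e p\<close> is part of the fop triangle
  (over an identity).\<close>

definition factorisation :: "('o, 'a, 'm) opcat_scheme \<Rightarrow> 'a \<Rightarrow> 'a \<Rightarrow> 'a \<Rightarrow> bool" where
  "factorisation \<O> f p e \<longleftrightarrow>
     quasibijection \<O> p \<and> order_preserving \<O> e \<and> fop \<O> f e p (Idn \<O> (Cod \<O> f))"

definition pi_of :: "('o, 'a, 'm) opcat_scheme \<Rightarrow> 'a \<Rightarrow> 'a" where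
  "pi_of \<O> f = fst (THE q. factorisation \<O> f (fst q) (snd q))"

definition eta_of :: "('o, 'a, 'm) opcat_scheme \<Rightarrow> 'a \<Rightarrow> 'a" where
  "eta_of \<O> f = snd (THE q. factorisation \<O> f (fst q) (snd q))"

text \<open>\<open>is_eta_rel \<O> f g h\<close> and \<open>eta_rel \<O> f g\<close> concern \<open>\<eta>(f/g)\<close> for \<open>f : T \<rightarrow> S\<close>, \<open>g : S \<rightarrow> R\<close>.\<close>

definition is_eta_rel :: "('o, 'a, 'm) opcat_scheme \<Rightarrow> 'a \<Rightarrow> 'a \<Rightarrow> 'a \<Rightarrow> bool" where
  "is_eta_rel \<O> f g h \<longleftrightarrow>
     h \<in> Hom \<O> (Dom \<O> (eta_of \<O> (g \<cdot>\<^bsub>\<O>\<^esub> f))) (Dom \<O> (eta_of \<O> g))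
     \<and> h \<cdot>\<^bsub>\<O>\<^esub> pi_of \<O> (g \<cdot>\<^bsub>\<O>\<^esub> f) = pi_of \<O> g \<cdot>\<^bsub>\<O>\<^esub> f
     \<and> eta_of \<O> g \<cdot>\<^bsub>\<O>\<^esub> h = eta_of \<O> (g \<cdot>\<^bsub>\<O>\<^esub> f)"

definition eta_rel :: "('o, 'a, 'm) opcat_scheme \<Rightarrow> 'a \<Rightarrow> 'a \<Rightarrow> 'a" where
  "eta_rel \<O> f g = (THE h. is_eta_rel \<O> f g h)"

locale strongly_factorisable = operadic_category \<O>
  for \<O> :: "('o, 'a, 'm) opcat_scheme" (structure) +
  assumes unique_factorisation:
    "f \<in> Arr \<O> \<Longrightarrow> \<exists>!q. factorisation \<O> f (fst q) (snd q)"

locale strictly_factorisable = strongly_factorisable \<O>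
  for \<O> :: "('o, 'a, 'm) opcat_scheme" (structure) +
  assumes unique_eta_rel:
    "\<lbrakk>f \<in> Hom \<O> T S; g \<in> Hom \<O> S R\<rbrakk> \<Longrightarrow> \<exists>!h. is_eta_rel \<O> f g h"


section \<open>The strict simplicial category of chains\<close>

text \<open>\<open>Chain T\<^sub>0 [f\<^sub>1, \<dots>, f\<^sub>n]\<close> is the chain \<open>T\<^sub>n \<rightarrow> \<dots> \<rightarrow> T\<^sub>0\<close> with \<open>f\<^sub>k : T\<^sub>k \<rightarrow> T\<^bsub>k-1\<^esub>\<close>; so \<open>f\<^sub>k\<close>
  is \<open>links x ! (k - 1)\<close> and \<open>vertex \<O> x k\<close> is \<open>T\<^sub>k\<close>. The components of
  \<open>ChainMap x y [\<sigma>\<^sub>0, \<dots>, \<sigma>\<^sub>n]\<close> are listed in the order of the vertices.\<close>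

datatype ('o, 'a) chain = Chain (base: 'o) (links: "'a list")

datatype ('o, 'a) chain_map =
  ChainMap (source: "('o, 'a) chain") (target: "('o, 'a) chain") (comps: "'a list")

definition vertex :: "('o, 'a, 'm) cat_scheme \<Rightarrow> ('o, 'a) chain \<Rightarrow> nat \<Rightarrow> 'o" where
  "vertex C x k = (case k of 0 \<Rightarrow> base x | Suc j \<Rightarrow> Dom C (links x ! j))"

definition chains :: "('o, 'a, 'm) cat_scheme \<Rightarrow> nat \<Rightarrow> ('o, 'a) chain set" where
  "chains C n = {x. base x \<in> Obj C \<and> length (links x) = n
     \<and> (\<forall>k<n. links x ! k \<in> Arr C \<and> Cod C (links x ! k) = vertex C x k)}"

text \<open>\<open>total C x k\<close> is the composite \<open>f\<^sub>1 \<cdots> f\<^sub>k : T\<^sub>k \<rightarrow> T\<^sub>0\<close>.\<close>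

primrec total :: "('o, 'a, 'm) cat_scheme \<Rightarrow> ('o, 'a) chain \<Rightarrow> nat \<Rightarrow> 'a" where
  "total C x 0 = Idn C (base x)"
| "total C x (Suc k) = total C x k \<cdot>\<^bsub>C\<^esub> (links x ! k)"

definition chain_maps :: "('o, 'a, 'm) opcat_scheme \<Rightarrow> nat \<Rightarrow> ('o, 'a) chain_map set" where
  "chain_maps \<O> n = {ChainMap x y \<sigma> | x y \<sigma>.
     x \<in> chains \<O> n \<and> y \<in> chains \<O> n \<and> length \<sigma> = n + 1
     \<and> (\<forall>k\<le>n. quasibijection \<O> (\<sigma> ! k) \<and> \<sigma> ! k \<in> Hom \<O> (vertex \<O> x k) (vertex \<O> y k))
     \<and> (\<forall>k<n. \<sigma> ! k \<cdot>\<^bsub>\<O>\<^esub> (links x ! k) = (links y ! k) \<cdot>\<^bsub>\<O>\<^esub> (\<sigma> ! Suc k))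
     \<and> (\<forall>k\<le>n. fop \<O> (total \<O> x k) (total \<O> y k) (\<sigma> ! k) (\<sigma> ! 0))}"

definition W :: "('o, 'a, 'm) opcat_scheme \<Rightarrow> nat \<Rightarrow> (('o, 'a) chain, ('o, 'a) chain_map) cat" where
  "W \<O> n =
     \<lparr>Obj = chains \<O> n, Arr = chain_maps \<O> n, Dom = source, Cod = target,
      Idn = (\<lambda>x. ChainMap x x (map (\<lambda>k. Idn \<O> (vertex \<O> x k)) [0..<n + 1])),
      Comp = (\<lambda>\<tau> \<sigma>. ChainMap (source \<sigma>) (target \<tau>)
                (map (\<lambda>k. (comps \<tau> ! k) \<cdot>\<^bsub>\<O>\<^esub> (comps \<sigma> ! k)) [0..<n + 1]))\<rparr>"

definition chain_face :: "('o, 'a, 'm) cat_scheme \<Rightarrow> nat \<Rightarrow> nat \<Rightarrow> ('o, 'a) chain \<Rightarrow> ('o, 'a) chain" where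
  "chain_face C n i x =
     (if i = 0 then Chain (base x) (butlast (links x))
      else if i = n then Chain (vertex C x 1) (tl (links x))
      else let k = n - i; fs = links x in
        Chain (base x) (take (k - 1) fs @ [(fs ! (k - 1)) \<cdot>\<^bsub>C\<^esub> (fs ! k)] @ drop (k + 1) fs))"

definition chain_degeneracy ::
    "('o, 'a, 'm) cat_scheme \<Rightarrow> nat \<Rightarrow> nat \<Rightarrow> ('o, 'a) chain \<Rightarrow> ('o, 'a) chain" where
  "chain_degeneracy C n i x =
     (let k = n - i; fs = links x in
       Chain (base x) (take k fs @ [Idn C (vertex C x k)] @ drop k fs))"

definition delta ::
    "('o, 'a, 'm) cat_scheme \<Rightarrow> nat \<Rightarrow> nat
     \<Rightarrow> (('o, 'a) chain, ('o, 'a) chain_map, ('o, 'a) chain, ('o, 'a) chain_map) ftr" where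
  "delta C n i =
     \<lparr>ob_map = chain_face C n i,
      arr_map = (\<lambda>\<sigma>. ChainMap (chain_face C n i (source \<sigma>)) (chain_face C n i (target \<sigma>))
                   (take (n - i) (comps \<sigma>) @ drop (n - i + 1) (comps \<sigma>)))\<rparr>"

definition gamma ::
    "('o, 'a, 'm) cat_scheme \<Rightarrow> nat \<Rightarrow> nat
     \<Rightarrow> (('o, 'a) chain, ('o, 'a) chain_map, ('o, 'a) chain, ('o, 'a) chain_map) ftr" where
  "gamma C n i =
     \<lparr>ob_map = chain_degeneracy C n i,
      arr_map = (\<lambda>\<sigma>. ChainMap (chain_degeneracy C n i (source \<sigma>)) (chain_degeneracy C n i (target \<sigma>))
                   (take (n - i) (comps \<sigma>) @ [comps \<sigma> ! (n - i)] @ drop (n - i) (comps \<sigma>)))\<rparr>"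


section \<open>The pita nerve\<close>

definition P :: "('o, 'a, 'm) opcat_scheme \<Rightarrow> nat \<Rightarrow> (('o, 'a) chain, ('o, 'a) chain_map) cat" where
  "P \<O> n = full_subcat (W \<O> n) {x. \<forall>k\<le>n. order_preserving \<O> (total \<O> x k)}"

text \<open>\<open>reflection \<O> n\<close> is the left adjoint \<open>r\<^sub>n : W\<^sub>n \<rightarrow> P\<^sub>n\<close> of the inclusion and
  \<open>reflection_unit \<O> n\<close> the unit, both given by their explicit formulas.
  In \<open>reflect_chain\<close> the list index \<open>k\<close> belongs to the arrow \<open>f\<^bsub>k+1\<^esub>\<close>.\<close>

definition reflect_chain :: "('o, 'a, 'm) opcat_scheme \<Rightarrow> nat \<Rightarrow> ('o, 'a) chain \<Rightarrow> ('o, 'a) chain" where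
  "reflect_chain \<O> n x = Chain (base x)
     (map (\<lambda>k. if k = 0 then eta_of \<O> (links x ! 0)
               else eta_rel \<O> (links x ! k) (total \<O> x k)) [0..<n])"

definition reflection ::
    "('o, 'a, 'm) opcat_scheme \<Rightarrow> nat
     \<Rightarrow> (('o, 'a) chain, ('o, 'a) chain_map, ('o, 'a) chain, ('o, 'a) chain_map) ftr" where
  "reflection \<O> n =
     \<lparr>ob_map = reflect_chain \<O> n,
      arr_map = (\<lambda>\<sigma>. ChainMap (reflect_chain \<O> n (source \<sigma>)) (reflect_chain \<O> n (target \<sigma>))
        ((comps \<sigma> ! 0) # map (\<lambda>k. pi_of \<O> ((comps \<sigma> ! 0) \<cdot>\<^bsub>\<O>\<^esub> eta_of \<O> (total \<O> (source \<sigma>) k)))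
                             [1..<n + 1]))\<rparr>"

definition reflection_unit ::
    "('o, 'a, 'm) opcat_scheme \<Rightarrow> nat \<Rightarrow> ('o, 'a) chain \<Rightarrow> ('o, 'a) chain_map" where
  "reflection_unit \<O> n x = ChainMap x (reflect_chain \<O> n x)
     (Idn \<O> (base x) # map (\<lambda>k. pi_of \<O> (total \<O> x k)) [1..<n + 1])"

definition pita_face ::
    "('o, 'a, 'm) opcat_scheme \<Rightarrow> nat \<Rightarrow> nat
     \<Rightarrow> (('o, 'a) chain, ('o, 'a) chain_map, ('o, 'a) chain, ('o, 'a) chain_map) ftr" where
  "pita_face \<O> n i = (if i < n then delta \<O> n i else reflection \<O> (n - 1) \<circ>\<^sub>F delta \<O> n n)"

definition pita_degeneracy ::
    "('o, 'a, 'm) opcat_scheme \<Rightarrow> nat \<Rightarrow> nat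
     \<Rightarrow> (('o, 'a) chain, ('o, 'a) chain_map, ('o, 'a) chain, ('o, 'a) chain_map) ftr" where
  "pita_degeneracy \<O> n i = gamma \<O> n i"

definition pita_beta ::
    "('o, 'a, 'm) opcat_scheme \<Rightarrow> nat \<Rightarrow> ('o, 'a) chain \<Rightarrow> ('o, 'a) chain_map" where
  "pita_beta \<O> n =
     (reflection \<O> n \<circ>\<^sub>F delta \<O> (n + 1) (n + 1))
       \<lhd>\<^sub>F (reflection_unit \<O> (n + 1) \<rhd>\<^sub>F delta \<O> (n + 2) (n + 2))"

end

theory Submission
  imports Defs
begin

text \<open>
  The chains form a strict simplicial category: a chain of length \<open>n\<close> is a contravariant functor on
  the ordinal \<open>{0..n}\<close>, faces and degeneracies restrict it along monotone maps \<open>\<theta>\<close>, and the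
  simplicial identities are identities between such maps (\<open>reindexes_comp\<close>, \<open>reindexes_eq\<close>). The
  reflection \<open>r\<close> and its unit \<open>\<pi>\<close> keep \<open>T\<^sub>0\<close> and factorise every composite \<open>T\<^sub>k \<rightarrow> T\<^sub>0\<close> separately, so
  they commute with restriction along every \<open>\<theta>\<close> with \<open>\<theta> 0 = 0\<close> (\<open>reflection_reindexes\<close>). Only the
  top face violates \<open>\<theta> 0 = 0\<close>. Hence all identities of the pita nerve other than the one between two
  top faces are inherited from chains, given that \<open>r\<close> and \<open>\<pi>\<close> are trivial on locally order-preserving
  chains. The equations for \<open>\<beta>\<close> against lower faces and degeneracies follow by moving these past
  \<open>r\<close> and \<open>\<pi>\<close>, and the equation between the two composites of \<open>\<beta>\<close>'s is a naturality square of the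
  unit \<open>\<pi>\<close> (\<open>beta_coherence\<close>).

  What remains is that \<open>r\<close> is a functor and \<open>\<pi>\<close> is natural. Fibrewise order-preservation only
  concerns maps of finite ordinals (\<open>fibre_maps_order_preserving_iff\<close>), which shows that a fop
  quasibijection can be absorbed into the quasibijection of a factorisation
  (\<open>pi_Comp_quasibijection\<close>); uniqueness of factorisations then gives the components of \<open>r\<close>, its
  functoriality, and naturality of \<open>\<pi>\<close>. The delicate point is that the components of \<open>r(\<sigma>)\<close>
  commute with the arrows of the reflected chains: after precomposition with the unit this is clear,
  but quasibijections are not assumed to be epic. Existence and uniqueness of the arrows
  \<open>\<eta>(f/g)\<close> supply the cancellation property that is needed (\<open>quasibijection_cancel\<close>).
\<close>

section \<open>Fibres of maps of finite ordinals\<close>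

lemma FinCat_Hom:
  "f \<in> Hom FinCat m n \<longleftrightarrow> fdom f = m \<and> fcod f = n \<and> fapp f \<in> {1..m} \<rightarrow>\<^sub>E {1..n}"
  by (auto simp: Hom_def FinCat_def)

lemma FinCat_Comp:
  "g \<cdot>\<^bsub>FinCat\<^esub> f = FinMap (fdom f) (fcod g) (\<lambda>j\<in>{1..fdom f}. fapp g (fapp f j))"
  by (simp add: FinCat_def)

lemma fapp_Comp: "a \<in> {1..fdom f} \<Longrightarrow> fapp (g \<cdot>\<^bsub>FinCat\<^esub> f) a = fapp g (fapp f a)"
  by (simp add: FinCat_Comp)

lemma FinCat_Comp_eq_iff:
  assumes "fdom f = fdom f'" "fcod g = fcod g'"
  shows "g \<cdot>\<^bsub>FinCat\<^esub> f = g' \<cdot>\<^bsub>FinCat\<^esub> f' \<longleftrightarrow>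
    (\<forall>a\<in>{1..fdom f}. fapp g (fapp f a) = fapp g' (fapp f' a))"
  using assms by (auto simp: FinCat_Comp fun_eq_iff restrict_def)

lemma strict_mono_enumeration_unique:
  fixes e e' :: "nat \<Rightarrow> nat"
  assumes "mono_on {1..n} e" "inj_on e {1..n}" "mono_on {1..n} e'" "inj_on e' {1..n}"
    and "e ` {1..n} = e' ` {1..n}" and "j \<in> {1..n}"
  shows "e j = e' j"
proof -
  have enum: "map h [1..<n + 1] = sorted_list_of_set (h ` {1..n})"
    if "mono_on {1..n} h" "inj_on h {1..n}" for h :: "nat \<Rightarrow> nat"
  proof (rule sorted_distinct_set_unique)
    show "sorted (map h [1..<n + 1])"
      using that(1) by (auto simp: sorted_iff_nth_mono mono_on_def simp del: upt_Suc)
    show "distinct (map h [1..<n + 1])"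
      using that by (simp add: distinct_map atLeastLessThanSuc_atLeastAtMost del: upt_Suc)
    show "set (map h [1..<n + 1]) = set (sorted_list_of_set (h ` {1..n}))"
      by (simp add: atLeastLessThanSuc_atLeastAtMost del: upt_Suc)
  qed auto
  have "map e [1..<n + 1] = map e' [1..<n + 1]"
    using assms by (simp only: enum)
  with \<open>j \<in> {1..n}\<close> show ?thesis
    by (auto simp: map_eq_conv)
qed

text \<open>The increasing enumeration of a fibre meets the definite description of \<open>\<epsilon>\<close>, and it is the only one
  since a list that is sorted and distinct is determined by its set of entries.\<close>

lemma fin_eps_properties:
  assumes "f \<in> Hom FinCat m n"
  shows "fin_eps f i \<in> Hom FinCat (fin_fibre f i) m"
    and "mono_on {1..fin_fibre f i} (fapp (fin_eps f i))"
    and "inj_on (fapp (fin_eps f i)) {1..fin_fibre f i}"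
    and "fapp (fin_eps f i) ` {1..fin_fibre f i} = {j \<in> {1..m}. fapp f j = i}"
proof -
  let ?A = "{j \<in> {1..m}. fapp f j = i}" and ?k = "fin_fibre f i"
  let ?xs = "sorted_list_of_set ?A"
  let ?Q = "\<lambda>e. e \<in> Hom FinCat ?k m \<and> mono_on {1..fdom e} (fapp e)
      \<and> inj_on (fapp e) {1..fdom e} \<and> fapp e ` {1..fdom e} = ?A"
  have m: "fdom f = m"
    using assms by (simp add: FinCat_Hom)
  then have len: "length ?xs = ?k"
    by (simp add: fin_fibre_def)
  define e where "e = FinMap ?k m (\<lambda>j\<in>{1..?k}. ?xs ! (j - 1))"
  have img: "(\<lambda>j. ?xs ! (j - 1)) ` {1..?k} = set ?xs"
  proof -
    have "(\<lambda>j. ?xs ! (j - 1)) ` {1..?k} = (\<lambda>j. ?xs ! j) ` {0..<?k}"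
      using image_image[of "\<lambda>j. ?xs ! (j - 1)" Suc "{0..<?k}"]
      by (simp add: image_Suc_atLeastLessThan atLeastLessThanSuc_atLeastAtMost)
    also have "\<dots> = set ?xs"
      using nth_image[of ?k ?xs] by (simp only: len take_all order_refl)
    finally show ?thesis .
  qed
  then have img': "fapp e ` {1..?k} = ?A"
    by (simp add: e_def)
  have "mono_on {1..?k} (fapp e)"
    by (auto simp: e_def mono_on_def fin_fibre_def m intro!: sorted_nth_mono)
  moreover have "inj_on (fapp e) {1..?k}"
  proof (rule inj_onI)
    fix a b
    assume ab: "a \<in> {1..?k}" "b \<in> {1..?k}" "fapp e a = fapp e b"
    then have "?xs ! (a - 1) = ?xs ! (b - 1)" by (simp add: e_def)
    moreover have "distinct ?xs" by simp
    ultimately have "a - 1 = b - 1"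
      using ab by (subst (asm) nth_eq_iff_index_eq) (auto simp: fin_fibre_def m)
    then show "a = b" using ab by auto
  qed
  moreover have "fapp e a \<in> {1..m}" if "a \<in> {1..?k}" for a
    using img' imageI[OF that, of "fapp e"] by auto
  then have "e \<in> Hom FinCat ?k m"
    by (auto simp: FinCat_Hom PiE_iff e_def)
  ultimately have Q_e: "?Q e"
    using img' by (simp add: e_def)
  have Q_unique: "e' = e''" if "?Q e'" "?Q e''" for e' e''
  proof (rule finmap.expand, intro conjI)
    have dom: "fdom e' = ?k" "fdom e'' = ?k" "fapp e' \<in> {1..?k} \<rightarrow>\<^sub>E {1..m}"
      "fapp e'' \<in> {1..?k} \<rightarrow>\<^sub>E {1..m}"
      using that by (auto simp: FinCat_Hom)
    then show "fdom e' = fdom e''" by simp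
    show "fcod e' = fcod e''" using that by (simp add: FinCat_Hom)
    have mono: "mono_on {1..?k} (fapp e')" "inj_on (fapp e') {1..?k}" "mono_on {1..?k} (fapp e'')"
      "inj_on (fapp e'') {1..?k}" "fapp e' ` {1..?k} = fapp e'' ` {1..?k}"
      using that unfolding dom(1,2) by blast+
    show "fapp e' = fapp e''"
      by (rule PiE_ext[OF dom(3,4)]) (rule strict_mono_enumeration_unique[OF mono])
  qed
  have "?Q (THE e. ?Q e)"
    by (rule theI[of ?Q e, OF Q_e]) (rule Q_unique[OF _ Q_e])
  moreover have "fin_eps f i = (THE e. ?Q e)"
    unfolding fin_eps_def m ..
  ultimately have Q: "?Q (fin_eps f i)" by simp
  then have "fdom (fin_eps f i) = ?k" by (simp add: FinCat_Hom)
  with Q show "fin_eps f i \<in> Hom FinCat (fin_fibre f i) m"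
    "mono_on {1..fin_fibre f i} (fapp (fin_eps f i))"
    "inj_on (fapp (fin_eps f i)) {1..fin_fibre f i}"
    "fapp (fin_eps f i) ` {1..fin_fibre f i} = ?A"
    by auto
qed

lemma fin_fibre_map_properties:
  assumes g: "g \<in> Hom FinCat l m" and f: "f \<in> Hom FinCat m n"
  shows "fin_fibre_map f g i \<in> Hom FinCat (fin_fibre (f \<cdot>\<^bsub>FinCat\<^esub> g) i) (fin_fibre f i)"
    and "a \<in> {1..fin_fibre (f \<cdot>\<^bsub>FinCat\<^esub> g) i} \<Longrightarrow>
      fapp (fin_eps f i) (fapp (fin_fibre_map f g i) a) = fapp g (fapp (fin_eps (f \<cdot>\<^bsub>FinCat\<^esub> g) i) a)"
proof -
  let ?fg = "f \<cdot>\<^bsub>FinCat\<^esub> g"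
  let ?K = "{1..fin_fibre ?fg i}" and ?L = "{1..fin_fibre f i}"
  let ?e = "fapp (fin_eps f i)" and ?e' = "fapp (fin_eps ?fg i)"
  let ?Q = "\<lambda>h. h \<in> Hom FinCat (fin_fibre ?fg i) (fin_fibre f i)
        \<and> fin_eps f i \<cdot>\<^bsub>FinCat\<^esub> h = g \<cdot>\<^bsub>FinCat\<^esub> fin_eps ?fg i"
  have fg: "?fg \<in> Hom FinCat l n"
    using f g by (auto simp: FinCat_Hom FinCat_Comp PiE_iff)
  note ef = fin_eps_properties[OF f, of i] and efg = fin_eps_properties[OF fg, of i]
  have preimage: "\<exists>!b. b \<in> ?L \<and> ?e b = fapp g (?e' a)" if "a \<in> ?K" for a
  proof -
    have "?e' a \<in> {j \<in> {1..l}. fapp ?fg j = i}"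
      using that efg(4) by blast
    then have "fapp g (?e' a) \<in> {j \<in> {1..m}. fapp f j = i}"
      using g by (auto simp: FinCat_Hom PiE_iff fapp_Comp)
    then have "fapp g (?e' a) \<in> ?e ` ?L"
      using ef(4) by simp
    then obtain b where b: "b \<in> ?L" "?e b = fapp g (?e' a)"
      by (metis imageE)
    show ?thesis
    proof (rule ex1I[of _ b])
      fix b'
      assume "b' \<in> ?L \<and> ?e b' = fapp g (?e' a)"
      with b show "b' = b"
        by (intro inj_onD[OF ef(3), of b' b]) auto
    qed (use b in simp)
  qed
  have dom: "fdom (fin_eps ?fg i) = fin_fibre ?fg i" "fcod (fin_eps f i) = m" "fcod g = m"
    using efg(1) ef(1) g by (auto simp: FinCat_Hom)
  have Q_iff: "?Q h \<longleftrightarrow> h \<in> Hom FinCat (fin_fibre ?fg i) (fin_fibre f i)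
      \<and> (\<forall>a\<in>?K. ?e (fapp h a) = fapp g (?e' a))" for h
  proof (cases "h \<in> Hom FinCat (fin_fibre ?fg i) (fin_fibre f i)")
    case True
    then have "fdom h = fin_fibre ?fg i" by (simp add: FinCat_Hom)
    with True show ?thesis
      using FinCat_Comp_eq_iff[of h "fin_eps ?fg i" "fin_eps f i" g] dom by simp
  qed simp
  define h where
    "h = FinMap (fin_fibre ?fg i) (fin_fibre f i) (\<lambda>a\<in>?K. THE b. b \<in> ?L \<and> ?e b = fapp g (?e' a))"
  have h: "fapp h a \<in> ?L \<and> ?e (fapp h a) = fapp g (?e' a)" if "a \<in> ?K" for a
    using theI'[OF preimage[OF that]] that by (simp add: h_def)
  have "fapp h \<in> ?K \<rightarrow>\<^sub>E ?L"
    by (rule PiE_I) (use h in blast, simp only: h_def finmap.sel restrict_apply if_False)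
  moreover have "fdom h = fin_fibre ?fg i" "fcod h = fin_fibre f i"
    by (simp_all add: h_def)
  ultimately have "h \<in> Hom FinCat (fin_fibre ?fg i) (fin_fibre f i)"
    by (simp only: FinCat_Hom simp_thms)
  then have Q_h: "?Q h"
    unfolding Q_iff using h by blast
  have Q_unique: "h' = h''" if "?Q h'" "?Q h''" for h' h''
  proof -
    have ext: "fdom h' = fdom h''" "fcod h' = fcod h''" "fapp h' \<in> ?K \<rightarrow>\<^sub>E ?L" "fapp h'' \<in> ?K \<rightarrow>\<^sub>E ?L"
      using that by (simp_all add: FinCat_Hom)
    have "fapp h' a = fapp h'' a" if a: "a \<in> ?K" for a
    proof -
      have "?e (fapp h' a) = fapp g (?e' a)" "?e (fapp h'' a) = fapp g (?e' a)"
        using \<open>?Q h'\<close> \<open>?Q h''\<close> a unfolding Q_iff by blast+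
      with preimage[OF a] PiE_mem[OF ext(3) a] PiE_mem[OF ext(4) a] show ?thesis
        by blast
    qed
    then have "fapp h' = fapp h''"
      by (rule PiE_ext[OF ext(3,4)])
    with ext show ?thesis
      by (intro finmap.expand) blast
  qed
  have "?Q (THE h. ?Q h)"
    by (rule theI[of ?Q h, OF Q_h]) (rule Q_unique[OF _ Q_h])
  then have Q: "?Q (fin_fibre_map f g i)"
    by (simp only: fin_fibre_map_def)
  from Q show "fin_fibre_map f g i \<in> Hom FinCat (fin_fibre ?fg i) (fin_fibre f i)" by simp
  from Q show "?e (fapp (fin_fibre_map f g i) a) = fapp g (?e' a)" if "a \<in> ?K"
    using that unfolding Q_iff by blast
qed

text \<open>Both embeddings \<open>\<epsilon>\<close> reflect and preserve the order, so monotonicity of the fibre map can be tested on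
  the ambient ordinals.\<close>

lemma mono_fin_fibre_map_iff:
  assumes g: "g \<in> Hom FinCat l m" and f: "f \<in> Hom FinCat m n"
  shows "mono_on {1..fin_fibre (f \<cdot>\<^bsub>FinCat\<^esub> g) i} (fapp (fin_fibre_map f g i)) \<longleftrightarrow>
    mono_on {j \<in> {1..l}. fapp f (fapp g j) = i} (fapp g)"
proof -
  let ?fg = "f \<cdot>\<^bsub>FinCat\<^esub> g"
  let ?K = "{1..fin_fibre ?fg i}" and ?L = "{1..fin_fibre f i}"
  let ?e = "fapp (fin_eps f i)" and ?e' = "fapp (fin_eps ?fg i)" and ?h = "fapp (fin_fibre_map f g i)"
  have fg: "?fg \<in> Hom FinCat l n"
    using f g by (auto simp: FinCat_Hom FinCat_Comp PiE_iff)
  note ef = fin_eps_properties[OF f, of i] and efg = fin_eps_properties[OF fg, of i]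
  note h = fin_fibre_map_properties[OF g f, where i = i]
  have hL: "?h a \<in> ?L" if "a \<in> ?K" for a
    using h(1) that by (auto simp: FinCat_Hom PiE_iff)
  have e: "?e a \<le> ?e b \<longleftrightarrow> a \<le> b" if "a \<in> ?L" "b \<in> ?L" for a b
    using ef(2,3) that unfolding mono_on_def inj_on_def by (metis nle_le)
  have e': "?e' a \<le> ?e' b \<longleftrightarrow> a \<le> b" if "a \<in> ?K" "b \<in> ?K" for a b
    using efg(2,3) that unfolding mono_on_def inj_on_def by (metis nle_le)
  have img: "{j \<in> {1..l}. fapp f (fapp g j) = i} = ?e' ` ?K"
    unfolding efg(4) using g by (auto simp: FinCat_Hom fapp_Comp)
  have "mono_on ?K ?h \<longleftrightarrow> (\<forall>a\<in>?K. \<forall>b\<in>?K. a \<le> b \<longrightarrow> ?e (?h a) \<le> ?e (?h b))"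
    using e hL by (auto simp: mono_on_def)
  also have "\<dots> \<longleftrightarrow> (\<forall>a\<in>?K. \<forall>b\<in>?K. ?e' a \<le> ?e' b \<longrightarrow> fapp g (?e' a) \<le> fapp g (?e' b))"
    by (intro ball_cong refl) (simp only: e' h(2))
  also have "\<dots> \<longleftrightarrow> mono_on (?e' ` ?K) (fapp g)"
    by (auto simp: mono_on_def)
  finally show ?thesis
    by (simp only: img)
qed

section \<open>Cardinality maps and quasibijections\<close>

lemma Hom_Arr: "f \<in> Hom C x y \<Longrightarrow> f \<in> Arr C"
  and Hom_Dom: "f \<in> Hom C x y \<Longrightarrow> Dom C f = x"
  and Hom_Cod: "f \<in> Hom C x y \<Longrightarrow> Cod C f = y"
  by (simp_all add: Hom_def)

lemma mono_on_parts_iff: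
  assumes "\<phi> \<in> A \<rightarrow> I"
  shows "(\<forall>i\<in>I. mono_on {a \<in> A. \<phi> a = i} s) \<longleftrightarrow>
    (\<forall>a\<in>A. \<forall>b\<in>A. a \<le> b \<longrightarrow> \<phi> a = \<phi> b \<longrightarrow> s a \<le> s b)"
  using assms by (auto simp: mono_on_def Pi_iff)

lemma (in category) Hom_Obj:
  assumes "f \<in> Hom C x y"
  shows "x \<in> Obj C" "y \<in> Obj C"
  using assms Dom_Obj Cod_Obj by (auto simp: Hom_def)

context operadic_category
begin

abbreviation cmap :: "'a \<Rightarrow> nat \<Rightarrow> nat" where
  "cmap f \<equiv> fapp (card_arr \<O> f)"

lemma card_arr_Hom: "f \<in> Hom \<O> S R \<Longrightarrow> card_arr \<O> f \<in> Hom FinCat (card_ob \<O> S) (card_ob \<O> R)"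
  by (rule cat_functor.arr_map_Hom[OF Card_functor])

lemma card_arr_Comp:
  "f \<in> Hom \<O> T S \<Longrightarrow> g \<in> Hom \<O> S R \<Longrightarrow> card_arr \<O> (g \<cdot> f) = card_arr \<O> g \<cdot>\<^bsub>FinCat\<^esub> card_arr \<O> f"
  by (rule cat_functor.arr_map_Comp[OF Card_functor])

lemma cmap_in: "f \<in> Hom \<O> S R \<Longrightarrow> a \<in> {1..card_ob \<O> S} \<Longrightarrow> cmap f a \<in> {1..card_ob \<O> R}"
  using card_arr_Hom[of f S R] unfolding FinCat_Hom by (blast intro: PiE_mem)

lemma cmap_Comp:
  assumes f: "f \<in> Hom \<O> T S" and g: "g \<in> Hom \<O> S R" and a: "a \<in> {1..card_ob \<O> T}"
  shows "cmap (g \<cdot> f) a = cmap g (cmap f a)"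
proof -
  have "a \<in> {1..fdom (card_arr \<O> f)}"
    using a card_arr_Hom[OF f] by (simp add: FinCat_Hom)
  then show ?thesis
    unfolding card_arr_Comp[OF f g] by (rule fapp_Comp)
qed

lemma cmap_Idn:
  assumes "x \<in> Obj \<O>" "a \<in> {1..card_ob \<O> x}"
  shows "cmap (Idn \<O> x) a = a"
  unfolding cat_functor.arr_map_Idn[OF Card_functor assms(1)] using assms(2) by (simp add: FinCat_def)

lemma fibre_map_Hom:
  assumes f: "f \<in> Hom \<O> T S" and g: "g \<in> Hom \<O> S R" and i: "i \<in> {1..card_ob \<O> R}"
  shows "fibre_map \<O> g f i \<in> Hom \<O> (fibre \<O> (g \<cdot> f) i) (fibre \<O> g i)"
proof -
  have R: "R \<in> Obj \<O>" using Hom_Obj[OF g] by simp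
  have cod: "Cod \<O> g = R" "Cod \<O> (g \<cdot> f) = R"
    using g Comp_Hom[OF f g] by (auto simp: Hom_def)
  have "(g, f) \<in> Hom (slice \<O> R) (g \<cdot> f) g"
    using f g by (auto simp: Hom_def slice_def)
  from cat_functor.arr_map_Hom[OF Fibre_functor[OF R i] this] show ?thesis
    by (simp add: cod)
qed

lemma order_preserving_iff:
  "f \<in> Hom \<O> S R \<Longrightarrow> order_preserving \<O> f \<longleftrightarrow> mono_on {1..card_ob \<O> S} (cmap f)"
  by (auto simp: order_preserving_def Hom_def)

text \<open>The condition on \<open>\<sigma>\<close> in a fop square depends only on the cardinality maps, and on
  \<open>g\<close> only through the partition that \<open>g \<sigma>\<close> induces on the source of \<open>\<sigma>\<close>. This is the form
  in which fop squares compose and restrict.\<close>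

definition mono_on_fibres :: "'a \<Rightarrow> 'a \<Rightarrow> bool" where
  "mono_on_fibres g \<sigma> \<longleftrightarrow> (\<forall>a\<in>{1..card_ob \<O> (Dom \<O> \<sigma>)}. \<forall>b\<in>{1..card_ob \<O> (Dom \<O> \<sigma>)}.
     a \<le> b \<longrightarrow> cmap g (cmap \<sigma> a) = cmap g (cmap \<sigma> b) \<longrightarrow> cmap \<sigma> a \<le> cmap \<sigma> b)"

lemma fibre_maps_order_preserving_iff:
  assumes \<sigma>: "\<sigma> \<in> Hom \<O> T T'" and g: "g \<in> Hom \<O> T' R"
  shows "(\<forall>i\<in>{1..card_ob \<O> R}. order_preserving \<O> (fibre_map \<O> g \<sigma> i)) \<longleftrightarrow> mono_on_fibres g \<sigma>"
proof -
  have *: "order_preserving \<O> (fibre_map \<O> g \<sigma> i) \<longleftrightarrow>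
      mono_on {j \<in> {1..card_ob \<O> T}. cmap g (cmap \<sigma> j) = i} (cmap \<sigma>)"
    if i: "i \<in> {1..card_ob \<O> R}" for i
  proof -
    have "order_preserving \<O> (fibre_map \<O> g \<sigma> i) \<longleftrightarrow>
        mono_on {1..card_ob \<O> (fibre \<O> (g \<cdot> \<sigma>) i)} (cmap (fibre_map \<O> g \<sigma> i))"
      by (rule order_preserving_iff[OF fibre_map_Hom[OF \<sigma> g i]])
    also have "card_ob \<O> (fibre \<O> (g \<cdot> \<sigma>) i) = fin_fibre (card_arr \<O> g \<cdot>\<^bsub>FinCat\<^esub> card_arr \<O> \<sigma>) i"
      using A3_ob[OF Comp_Hom[OF \<sigma> g] i] card_arr_Comp[OF \<sigma> g] by simp
    also have "card_arr \<O> (fibre_map \<O> g \<sigma> i) = fin_fibre_map (card_arr \<O> g) (card_arr \<O> \<sigma>) i"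
      by (rule A3_arr[OF \<sigma> g i])
    finally show ?thesis
      by (simp only: mono_fin_fibre_map_iff[OF card_arr_Hom[OF \<sigma>] card_arr_Hom[OF g]])
  qed
  have "(\<forall>i\<in>{1..card_ob \<O> R}. order_preserving \<O> (fibre_map \<O> g \<sigma> i)) \<longleftrightarrow>
      (\<forall>i\<in>{1..card_ob \<O> R}. mono_on {j \<in> {1..card_ob \<O> T}. cmap g (cmap \<sigma> j) = i} (cmap \<sigma>))"
    by (rule ball_cong[OF refl *])
  also have "\<dots> \<longleftrightarrow> mono_on_fibres g \<sigma>"
    unfolding mono_on_fibres_def Hom_Dom[OF \<sigma>]
    by (rule mono_on_parts_iff, rule funcsetI, rule cmap_in[OF g], rule cmap_in[OF \<sigma>])
  finally show ?thesis .
qed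

lemma fop_iff:
  assumes \<sigma>: "\<sigma> \<in> Hom \<O> T T'" and \<tau>: "\<tau> \<in> Hom \<O> S S'" and f: "f \<in> Hom \<O> T S" and g: "g \<in> Hom \<O> T' S'"
  shows "fop \<O> f g \<sigma> \<tau> \<longleftrightarrow> \<tau> \<cdot> f = g \<cdot> \<sigma> \<and> mono_on_fibres g \<sigma>"
  using fibre_maps_order_preserving_iff[OF \<sigma> g] assms by (auto simp: fop_def Hom_def)

text \<open>An arrow to a chosen local terminal object is the unique arrow \<open>\<tau>\<close>, so its only fibre is its
  source. This turns fibres of fibre maps over trivial fibres into fibres.\<close>

lemma fibre_over_LT:
  assumes h: "h \<in> Hom \<O> X U" and U: "U \<in> LT \<O>"
  shows "fibre \<O> h 1 = X"
proof -
  have X: "X \<in> Obj \<O>" using Hom_Obj[OF h] by simp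
  have con: "connected_objs \<O> X U"
    using h by (auto simp: connected_objs_def Hom_def Let_def)
  then have "chosen_terminal \<O> X = U"
    unfolding chosen_terminal_def using LT_unique[OF X] U by (intro the1_equality) auto
  moreover have "\<exists>!f. f \<in> Hom \<O> X U"
    using LT_local_terminal[OF U] X con by (simp add: local_terminal_def)
  ultimately have "tau \<O> X = h"
    unfolding tau_def using h by (auto intro: the1_equality)
  with A4_ob[OF X] show ?thesis by simp
qed

lemma card_LT: "U \<in> LT \<O> \<Longrightarrow> card_ob \<O> U = 1"
  by (rule A1[OF LT_local_terminal])

lemma quasibijection_fibre:
  "quasibijection \<O> f \<Longrightarrow> f \<in> Hom \<O> S R \<Longrightarrow> i \<in> {1..card_ob \<O> R} \<Longrightarrow> fibre \<O> f i \<in> LT \<O>"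
  by (auto simp: quasibijection_def Hom_def)

lemma quasibijectionI:
  "f \<in> Hom \<O> S R \<Longrightarrow> (\<And>i. i \<in> {1..card_ob \<O> R} \<Longrightarrow> fibre \<O> f i \<in> LT \<O>) \<Longrightarrow> quasibijection \<O> f"
  by (simp add: quasibijection_def Hom_def)

lemma quasibijection_Idn: "x \<in> Obj \<O> \<Longrightarrow> quasibijection \<O> (Idn \<O> x)"
  by (rule quasibijectionI[OF Idn_Hom]) (auto intro: A2)

lemma order_preserving_Idn: "x \<in> Obj \<O> \<Longrightarrow> order_preserving \<O> (Idn \<O> x)"
  by (simp add: order_preserving_iff[OF Idn_Hom] cmap_Idn mono_on_def)

text \<open>The fibres are chosen local terminals and so have cardinality \<open>1\<close> by axiom A1.\<close>

lemma quasibijection_inj: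
  assumes "quasibijection \<O> f" and f: "f \<in> Hom \<O> S R"
    and a: "a \<in> {1..card_ob \<O> S}" and b: "b \<in> {1..card_ob \<O> S}" and eq: "cmap f a = cmap f b"
  shows "a = b"
proof -
  have i: "cmap f a \<in> {1..card_ob \<O> R}" by (rule cmap_in[OF f a])
  have "fin_fibre (card_arr \<O> f) (cmap f a) = 1"
    using A3_ob[OF f i] card_LT[OF quasibijection_fibre[OF assms(1) f i]] by simp
  then have "card {j \<in> {1..card_ob \<O> S}. cmap f j = cmap f a} = 1"
    using card_arr_Hom[OF f] by (simp add: fin_fibre_def FinCat_Hom)
  then obtain c where c: "{j \<in> {1..card_ob \<O> S}. cmap f j = cmap f a} = {c}"
    by (rule card_1_singletonE)
  from a have "a \<in> {c}" unfolding c[symmetric] by blast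
  moreover from b eq have "b \<in> {c}" unfolding c[symmetric] by simp
  ultimately show ?thesis by simp
qed

text \<open>Over a point \<open>i\<close> the fibre of \<open>g\<close> is a chosen local terminal \<open>U\<close>, so the fibre \<open>(g f)\<^sup>-\<^sup>1(i)\<close> is
  the fibre of \<open>f\<^sub>i : (g f)\<^sup>-\<^sup>1(i) \<rightarrow> U\<close>, which is a fibre of \<open>f\<close> by axiom A5.\<close>

lemma quasibijection_Comp:
  assumes qf: "quasibijection \<O> f" and qg: "quasibijection \<O> g"
    and f: "f \<in> Hom \<O> T S" and g: "g \<in> Hom \<O> S R"
  shows "quasibijection \<O> (g \<cdot> f)"
proof (rule quasibijectionI[OF Comp_Hom[OF f g]])
  fix i
  assume i: "i \<in> {1..card_ob \<O> R}"
  let ?e = "fin_eps (card_arr \<O> g) i"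
  have U: "fibre \<O> g i \<in> LT \<O>" by (rule quasibijection_fibre[OF qg g i])
  have one: "1 \<in> {1..fin_fibre (card_arr \<O> g) i}"
    using A3_ob[OF g i] card_LT[OF U] by simp
  have "fapp ?e 1 \<in> {1..card_ob \<O> S}"
    using one fin_eps_properties(1)[OF card_arr_Hom[OF g], of i] by (auto simp: FinCat_Hom PiE_iff)
  then have "fibre \<O> f (fapp ?e 1) \<in> LT \<O>"
    by (rule quasibijection_fibre[OF qf f])
  moreover have "fibre \<O> (fibre_map \<O> g f i) 1 = fibre \<O> f (fapp ?e 1)"
    by (rule A5_ob[OF f g i one])
  moreover have "fibre \<O> (fibre_map \<O> g f i) 1 = fibre \<O> (g \<cdot> f) i"
    by (rule fibre_over_LT[OF fibre_map_Hom[OF f g i] U])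
  ultimately show "fibre \<O> (g \<cdot> f) i \<in> LT \<O>" by simp
qed

lemma mono_on_fibres_quasibijection:
  assumes "quasibijection \<O> (g \<cdot> \<sigma>)" and \<sigma>: "\<sigma> \<in> Hom \<O> T T'" and g: "g \<in> Hom \<O> T' R"
  shows "mono_on_fibres g \<sigma>"
  unfolding mono_on_fibres_def Hom_Dom[OF \<sigma>]
proof (intro ballI impI)
  fix a b
  assume a: "a \<in> {1..card_ob \<O> T}" and b: "b \<in> {1..card_ob \<O> T}"
    and "cmap g (cmap \<sigma> a) = cmap g (cmap \<sigma> b)"
  then have "cmap (g \<cdot> \<sigma>) a = cmap (g \<cdot> \<sigma>) b"
    by (simp only: cmap_Comp[OF \<sigma> g a] cmap_Comp[OF \<sigma> g b])
  then have "a = b"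
    by (rule quasibijection_inj[OF assms(1) Comp_Hom[OF \<sigma> g] a b])
  then show "cmap \<sigma> a \<le> cmap \<sigma> b" by simp
qed

lemma mono_on_fibres_order_preserving:
  assumes "order_preserving \<O> \<sigma>"
  shows "mono_on_fibres g \<sigma>"
  using assms by (auto simp: order_preserving_def mono_on_fibres_def mono_on_def)

text \<open>The partition induced by \<open>g \<sigma>\<close> is finer than the one induced by \<open>h g \<sigma>\<close>; the two agree if \<open>h\<close> is a
  quasibijection, as \<open>h\<close> is then injective on cardinalities.\<close>

lemma mono_on_fibres_cancel:
  assumes mono: "mono_on_fibres (h \<cdot> g) \<sigma>"
    and \<sigma>: "\<sigma> \<in> Hom \<O> T T'" and g: "g \<in> Hom \<O> T' S" and h: "h \<in> Hom \<O> S R"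
  shows "mono_on_fibres g \<sigma>"
  using mono cmap_Comp[OF g h cmap_in[OF \<sigma>]] unfolding mono_on_fibres_def Hom_Dom[OF \<sigma>] by metis

lemma mono_on_fibres_quasibijection_left:
  assumes mono: "mono_on_fibres g \<sigma>" and qh: "quasibijection \<O> h"
    and \<sigma>: "\<sigma> \<in> Hom \<O> T T'" and g: "g \<in> Hom \<O> T' S" and h: "h \<in> Hom \<O> S R"
  shows "mono_on_fibres (h \<cdot> g) \<sigma>"
proof -
  have "cmap g (cmap \<sigma> a) = cmap g (cmap \<sigma> b)"
    if "cmap (h \<cdot> g) (cmap \<sigma> a) = cmap (h \<cdot> g) (cmap \<sigma> b)" "a \<in> {1..card_ob \<O> T}" "b \<in> {1..card_ob \<O> T}" for a b
    using that quasibijection_inj[OF qh h cmap_in[OF g cmap_in[OF \<sigma> that(2)]] cmap_in[OF g cmap_in[OF \<sigma> that(3)]]]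
    by (simp add: cmap_Comp[OF g h cmap_in[OF \<sigma> that(2)]] cmap_Comp[OF g h cmap_in[OF \<sigma> that(3)]])
  with mono show ?thesis
    unfolding mono_on_fibres_def Hom_Dom[OF \<sigma>] by blast
qed

text \<open>Elements in the same fibre of \<open>g \<tau> \<sigma>\<close> are sent by \<open>\<sigma>\<close> to elements in the same fibre of \<open>g \<tau>\<close>, in the
  same order.\<close>

lemma mono_on_fibres_Comp:
  assumes m1: "mono_on_fibres (g \<cdot> \<tau>) \<sigma>" and m2: "mono_on_fibres g \<tau>"
    and \<sigma>: "\<sigma> \<in> Hom \<O> T T'" and \<tau>: "\<tau> \<in> Hom \<O> T' T''" and g: "g \<in> Hom \<O> T'' R"
  shows "mono_on_fibres g (\<tau> \<cdot> \<sigma>)"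
  unfolding mono_on_fibres_def Hom_Dom[OF Comp_Hom[OF \<sigma> \<tau>]]
proof (intro ballI impI)
  fix a b
  assume a: "a \<in> {1..card_ob \<O> T}" and b: "b \<in> {1..card_ob \<O> T}" and "a \<le> b"
    and eq: "cmap g (cmap (\<tau> \<cdot> \<sigma>) a) = cmap g (cmap (\<tau> \<cdot> \<sigma>) b)"
  note eqs = cmap_Comp[OF \<sigma> \<tau> a] cmap_Comp[OF \<sigma> \<tau> b]
    cmap_Comp[OF \<tau> g cmap_in[OF \<sigma> a]] cmap_Comp[OF \<tau> g cmap_in[OF \<sigma> b]]
  have "cmap \<sigma> a \<le> cmap \<sigma> b"
    using m1 a b \<open>a \<le> b\<close> eq unfolding mono_on_fibres_def Hom_Dom[OF \<sigma>] by (simp only: eqs)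
  with m2 cmap_in[OF \<sigma> a] cmap_in[OF \<sigma> b] eq show "cmap (\<tau> \<cdot> \<sigma>) a \<le> cmap (\<tau> \<cdot> \<sigma>) b"
    unfolding mono_on_fibres_def Hom_Dom[OF \<tau>] by (simp only: eqs)
qed

lemma factorisation_iff:
  assumes f: "f \<in> Hom \<O> T R"
  shows "factorisation \<O> f p e \<longleftrightarrow> quasibijection \<O> p \<and> order_preserving \<O> e
    \<and> p \<in> Hom \<O> T (Dom \<O> e) \<and> Cod \<O> e = R \<and> e \<cdot> p = f \<and> mono_on_fibres e p"
proof (cases "quasibijection \<O> p \<and> order_preserving \<O> e \<and> p \<in> Hom \<O> T (Dom \<O> e) \<and> Cod \<O> e = R")
  case True
  then have p: "p \<in> Hom \<O> T (Dom \<O> e)" and e: "e \<in> Hom \<O> (Dom \<O> e) R"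
    by (auto simp: order_preserving_def Hom_def)
  have R: "R \<in> Obj \<O>" using Hom_Obj[OF f] by simp
  show ?thesis
    using True fop_iff[OF p Idn_Hom[OF R] f e] Comp_Idn_left[OF f] Hom_Cod[OF f]
    by (auto simp: factorisation_def)
next
  case False
  have "R \<in> Obj \<O>" using Hom_Obj[OF f] by simp
  from Hom_Cod[OF Idn_Hom[OF this]] False show ?thesis
    using Hom_Cod[OF f] Hom_Dom[OF f] by (auto simp: factorisation_def fop_def Hom_def)
qed

end

section \<open>Factorisations\<close>

context strongly_factorisable
begin

abbreviation pi (\<open>\<pi>\<close>) where "\<pi> \<equiv> pi_of \<O>"
abbreviation eta (\<open>\<eta>\<close>) where "\<eta> \<equiv> eta_of \<O>"
abbreviation mid :: "'a \<Rightarrow> 'o" where "mid f \<equiv> Dom \<O> (\<eta> f)"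

lemma factorisation_pi_eta: "f \<in> Arr \<O> \<Longrightarrow> factorisation \<O> f (\<pi> f) (\<eta> f)"
  unfolding pi_of_def eta_of_def by (rule theI'[OF unique_factorisation])

lemma factorisation_unique:
  assumes f: "f \<in> Hom \<O> T R" and p: "p \<in> Hom \<O> T T'" and e: "e \<in> Hom \<O> T' R"
    and "quasibijection \<O> p" "order_preserving \<O> e" "e \<cdot> p = f" "mono_on_fibres e p"
  shows "\<pi> f = p" and "\<eta> f = e"
proof -
  have "factorisation \<O> f p e"
    using assms Hom_Dom[OF e] Hom_Cod[OF e] by (simp add: factorisation_iff[OF f])
  moreover have "\<exists>!q. factorisation \<O> f (fst q) (snd q)"
    by (rule unique_factorisation[OF Hom_Arr[OF f]])
  ultimately have "(\<pi> f, \<eta> f) = (p, e)"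
    using factorisation_pi_eta[OF Hom_Arr[OF f]] by (metis fst_conv snd_conv)
  then show "\<pi> f = p" "\<eta> f = e" by simp_all
qed

lemma
  assumes f: "f \<in> Hom \<O> T R"
  shows pi_Hom: "\<pi> f \<in> Hom \<O> T (mid f)"
    and eta_Hom: "\<eta> f \<in> Hom \<O> (mid f) R"
    and quasibijection_pi: "quasibijection \<O> (\<pi> f)"
    and order_preserving_eta: "order_preserving \<O> (\<eta> f)"
    and eta_pi: "\<eta> f \<cdot> \<pi> f = f"
    and mono_pi: "mono_on_fibres (\<eta> f) (\<pi> f)"
  using factorisation_pi_eta[OF Hom_Arr[OF f]]
  by (auto simp: factorisation_iff[OF f] Hom_def order_preserving_def)

lemma
  assumes f: "f \<in> Hom \<O> T R" and "order_preserving \<O> f"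
  shows pi_order_preserving: "\<pi> f = Idn \<O> T" and eta_order_preserving: "\<eta> f = f"
proof -
  have T: "T \<in> Obj \<O>" using Hom_Obj[OF f] by simp
  note id = Idn_Hom[OF T] quasibijection_Idn[OF T] order_preserving_Idn[OF T]
  show "\<pi> f = Idn \<O> T" "\<eta> f = f"
    by (rule factorisation_unique[OF f id(1) f id(2) assms(2) Comp_Idn_right[OF f]
          mono_on_fibres_order_preserving[OF id(3)]])+
qed

lemma
  assumes f: "f \<in> Hom \<O> T R" and qf: "quasibijection \<O> f"
  shows pi_quasibijection: "\<pi> f = f" and eta_quasibijection: "\<eta> f = Idn \<O> R"
proof -
  have R: "R \<in> Obj \<O>" using Hom_Obj[OF f] by simp
  have mono: "mono_on_fibres (Idn \<O> R) f"
    by (rule mono_on_fibres_quasibijection[OF _ f Idn_Hom[OF R]]) (simp add: Comp_Idn_left[OF f] qf)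
  show "\<pi> f = f" "\<eta> f = Idn \<O> R"
    by (rule factorisation_unique[OF f f Idn_Hom[OF R] qf order_preserving_Idn[OF R] Comp_Idn_left[OF f] mono])+
qed

text \<open>The pair of \<open>\<pi>(f) p\<close> and \<open>\<eta>(f)\<close> is a factorisation of \<open>f p\<close>. This absorption of \<open>p\<close>
  underlies the functoriality of the reflection and the naturality of its unit.\<close>

lemma
  assumes p: "p \<in> Hom \<O> T T'" and f: "f \<in> Hom \<O> T' R"
    and qp: "quasibijection \<O> p" and mono: "mono_on_fibres f p"
  shows pi_Comp_quasibijection: "\<pi> (f \<cdot> p) = \<pi> f \<cdot> p"
    and eta_Comp_quasibijection: "\<eta> (f \<cdot> p) = \<eta> f"
proof -
  note pf = pi_Hom[OF f] and ef = eta_Hom[OF f]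
  have q: "quasibijection \<O> (\<pi> f \<cdot> p)"
    by (rule quasibijection_Comp[OF qp quasibijection_pi[OF f] p pf])
  have eq: "\<eta> f \<cdot> (\<pi> f \<cdot> p) = f \<cdot> p"
    by (simp add: Comp_assoc[OF p pf ef] eta_pi[OF f])
  have "mono_on_fibres (\<eta> f) (\<pi> f \<cdot> p)"
    by (rule mono_on_fibres_Comp[OF _ mono_pi[OF f] p pf ef]) (simp add: eta_pi[OF f] mono)
  note * = factorisation_unique[OF Comp_Hom[OF p f] Comp_Hom[OF p pf] ef q order_preserving_eta[OF f] eq this]
  show "\<pi> (f \<cdot> p) = \<pi> f \<cdot> p" "\<eta> (f \<cdot> p) = \<eta> f"
    by (rule *)+
qed

text \<open>A square \<open>\<sigma>\<^sub>0 f = g \<sigma>\<close> as in the definition of morphisms of chains induces a square on middle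
  objects: both \<open>(\<pi>(\<sigma>\<^sub>0 \<eta>(f)) \<pi>(f), \<eta>(\<sigma>\<^sub>0 \<eta>(f)))\<close> and \<open>(\<pi>(g) \<sigma>, \<eta>(g))\<close> factorise its diagonal.\<close>

lemma
  assumes f: "f \<in> Hom \<O> T R" and g: "g \<in> Hom \<O> T' R'"
    and \<sigma>: "\<sigma> \<in> Hom \<O> T T'" "quasibijection \<O> \<sigma>" and \<sigma>0: "\<sigma>0 \<in> Hom \<O> R R'" "quasibijection \<O> \<sigma>0"
    and eq: "\<sigma>0 \<cdot> f = g \<cdot> \<sigma>" and mono: "mono_on_fibres g \<sigma>"
  shows eta_square: "\<eta> (\<sigma>0 \<cdot> \<eta> f) = \<eta> g"
    and pi_square: "\<pi> (\<sigma>0 \<cdot> \<eta> f) \<cdot> \<pi> f = \<pi> g \<cdot> \<sigma>"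
proof -
  note pf = pi_Hom[OF f] and ef = eta_Hom[OF f]
  have eq': "(\<sigma>0 \<cdot> \<eta> f) \<cdot> \<pi> f = g \<cdot> \<sigma>"
    by (simp add: Comp_assoc[OF pf ef \<sigma>0(1), symmetric] eta_pi[OF f] eq)
  have mono': "mono_on_fibres (\<sigma>0 \<cdot> \<eta> f) (\<pi> f)"
    by (rule mono_on_fibres_quasibijection_left[OF mono_pi[OF f] \<sigma>0(2) pf ef \<sigma>0(1)])
  note left = pi_Comp_quasibijection[OF pf Comp_Hom[OF ef \<sigma>0(1)] quasibijection_pi[OF f] mono']
    eta_Comp_quasibijection[OF pf Comp_Hom[OF ef \<sigma>0(1)] quasibijection_pi[OF f] mono']
  note right = pi_Comp_quasibijection[OF \<sigma>(1) g \<sigma>(2) mono] eta_Comp_quasibijection[OF \<sigma>(1) g \<sigma>(2) mono]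
  show "\<eta> (\<sigma>0 \<cdot> \<eta> f) = \<eta> g" "\<pi> (\<sigma>0 \<cdot> \<eta> f) \<cdot> \<pi> f = \<pi> g \<cdot> \<sigma>"
    using left right by (simp_all add: eq')
qed

end

context strictly_factorisable
begin

abbreviation eta_relative (\<open>\<eta>'(_ '/ _')\<close>) where "\<eta>(f / g) \<equiv> eta_rel \<O> f g"

lemma is_eta_rel_eta_rel: "f \<in> Hom \<O> T S \<Longrightarrow> g \<in> Hom \<O> S R \<Longrightarrow> is_eta_rel \<O> f g (\<eta>(f / g))"
  unfolding eta_rel_def by (rule theI'[OF unique_eta_rel])

lemma
  assumes "f \<in> Hom \<O> T S" and "g \<in> Hom \<O> S R"
  shows eta_rel_Hom: "\<eta>(f / g) \<in> Hom \<O> (mid (g \<cdot> f)) (mid g)"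
    and eta_rel_pi: "\<eta>(f / g) \<cdot> \<pi> (g \<cdot> f) = \<pi> g \<cdot> f"
    and eta_eta_rel: "\<eta> g \<cdot> \<eta>(f / g) = \<eta> (g \<cdot> f)"
  using is_eta_rel_eta_rel[OF assms] by (auto simp: is_eta_rel_def)

lemma eta_rel_unique:
  assumes "f \<in> Hom \<O> T S" "g \<in> Hom \<O> S R" and "h \<in> Hom \<O> (mid (g \<cdot> f)) (mid g)"
    and "h \<cdot> \<pi> (g \<cdot> f) = \<pi> g \<cdot> f" and "\<eta> g \<cdot> h = \<eta> (g \<cdot> f)"
  shows "\<eta>(f / g) = h"
  unfolding eta_rel_def
  by (rule the1_equality[OF unique_eta_rel[OF assms(1,2)]]) (use assms in \<open>simp add: is_eta_rel_def\<close>)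

lemma eta_rel_Idn:
  assumes g: "g \<in> Hom \<O> S R"
  shows "\<eta>(Idn \<O> S / g) = Idn \<O> (mid g)"
proof (rule eta_rel_unique[OF _ g])
  have obj: "S \<in> Obj \<O>" "mid g \<in> Obj \<O>"
    using Hom_Obj[OF g] Hom_Obj[OF pi_Hom[OF g]] by auto
  show "Idn \<O> S \<in> Hom \<O> S S" by (rule Idn_Hom[OF obj(1)])
  show "Idn \<O> (mid g) \<in> Hom \<O> (mid (g \<cdot> Idn \<O> S)) (mid g)"
    using Idn_Hom[OF obj(2)] by (simp add: Comp_Idn_right[OF g])
  show "Idn \<O> (mid g) \<cdot> \<pi> (g \<cdot> Idn \<O> S) = \<pi> g \<cdot> Idn \<O> S"
    using Comp_Idn_right[OF g] Comp_Idn_left[OF pi_Hom[OF g]] Comp_Idn_right[OF pi_Hom[OF g]] by simp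
  show "\<eta> g \<cdot> Idn \<O> (mid g) = \<eta> (g \<cdot> Idn \<O> S)"
    using Comp_Idn_right[OF g] Comp_Idn_right[OF eta_Hom[OF g]] by simp
qed

text \<open>The triangles and squares that define the two factors paste to those that define \<open>\<eta>(f f'/g)\<close>.\<close>

lemma eta_rel_Comp:
  assumes f': "f' \<in> Hom \<O> Q T" and f: "f \<in> Hom \<O> T S" and g: "g \<in> Hom \<O> S R"
  shows "\<eta>(f \<cdot> f' / g) = \<eta>(f / g) \<cdot> \<eta>(f' / g \<cdot> f)"
proof (rule eta_rel_unique[OF Comp_Hom[OF f' f] g])
  note gf = Comp_Hom[OF f g]
  note h' = eta_rel_Hom[OF f' gf] and h = eta_rel_Hom[OF f g]
  have assoc: "g \<cdot> (f \<cdot> f') = (g \<cdot> f) \<cdot> f'" by (rule Comp_assoc[OF f' f g])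
  note pgff = pi_Hom[OF Comp_Hom[OF f' gf]]
  show "\<eta>(f / g) \<cdot> \<eta>(f' / g \<cdot> f) \<in> Hom \<O> (mid (g \<cdot> (f \<cdot> f'))) (mid g)"
    unfolding assoc by (rule Comp_Hom[OF h' h])
  show "\<eta>(f / g) \<cdot> \<eta>(f' / g \<cdot> f) \<cdot> \<pi> (g \<cdot> (f \<cdot> f')) = \<pi> g \<cdot> (f \<cdot> f')"
    unfolding assoc Comp_assoc[OF pgff h' h, symmetric] eta_rel_pi[OF f' gf]
      Comp_assoc[OF f' pi_Hom[OF gf] h] eta_rel_pi[OF f g] Comp_assoc[OF f' f pi_Hom[OF g]] ..
  show "\<eta> g \<cdot> (\<eta>(f / g) \<cdot> \<eta>(f' / g \<cdot> f)) = \<eta> (g \<cdot> (f \<cdot> f'))"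
    unfolding assoc Comp_assoc[OF h' h eta_Hom[OF g]] eta_eta_rel[OF f g] eta_eta_rel[OF f' gf] ..
qed

lemma eta_rel_order_preserving:
  assumes f: "f \<in> Hom \<O> T S" and g: "g \<in> Hom \<O> S R"
    and og: "order_preserving \<O> g" and ogf: "order_preserving \<O> (g \<cdot> f)"
  shows "\<eta>(f / g) = f"
proof (rule eta_rel_unique[OF f g])
  note gf = Comp_Hom[OF f g]
  note simps = pi_order_preserving[OF g og] eta_order_preserving[OF g og]
    pi_order_preserving[OF gf ogf] eta_order_preserving[OF gf ogf]
  show "f \<in> Hom \<O> (mid (g \<cdot> f)) (mid g)"
    using f by (simp add: simps Hom_Dom[OF gf] Hom_Dom[OF g])
  show "f \<cdot> \<pi> (g \<cdot> f) = \<pi> g \<cdot> f" "\<eta> g \<cdot> f = \<eta> (g \<cdot> f)"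
    by (simp_all add: simps Comp_Idn_left[OF f] Comp_Idn_right[OF f])
qed

lemma eta_rel_over_Idn:
  assumes f: "f \<in> Hom \<O> T R"
  shows "\<eta>(f / Idn \<O> R) = \<eta> f"
proof -
  have R: "R \<in> Obj \<O>" using Hom_Obj[OF f] by simp
  have id: "\<eta> (Idn \<O> R) = Idn \<O> R"
    by (rule eta_order_preserving[OF Idn_Hom[OF R] order_preserving_Idn[OF R]])
  note eta_eta_rel[OF f Idn_Hom[OF R]] eta_rel_Hom[OF f Idn_Hom[OF R]]
  then show ?thesis
    by (simp add: id Comp_Idn_left[OF f] Hom_Dom[OF Idn_Hom[OF R]] Comp_Idn_left)
qed

text \<open>As \<open>\<pi>(e)\<close> is an identity, \<open>u = \<eta>(u/e) \<pi>(e u)\<close> and \<open>v = \<eta>(v/e) \<pi>(e v)\<close>, where \<open>e u = e v\<close>. Both \<open>\<eta>(u/e)\<close> and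
  \<open>\<eta>(v/e)\<close> satisfy the equations that characterise \<open>\<eta>(u p/e)\<close>, because \<open>\<pi>(e u p) = \<pi>(e u) p\<close>. The
  lemma takes the place of right cancellation of quasibijections.\<close>

lemma quasibijection_cancel:
  assumes p: "p \<in> Hom \<O> T T'" and u: "u \<in> Hom \<O> T' S" and v: "v \<in> Hom \<O> T' S" and e: "e \<in> Hom \<O> S R"
    and qp: "quasibijection \<O> p" and oe: "order_preserving \<O> e" and mono: "mono_on_fibres (e \<cdot> u) p"
    and up: "u \<cdot> p = v \<cdot> p" and eu: "e \<cdot> u = e \<cdot> v"
  shows "u = v"
proof -
  note simps = pi_order_preserving[OF e oe] eta_order_preserving[OF e oe]
  have eup: "e \<cdot> (u \<cdot> p) = (e \<cdot> u) \<cdot> p" by (rule Comp_assoc[OF p u e])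
  have "\<eta>(u \<cdot> p / e) = \<eta>(w / e) \<and> w = \<eta>(w / e) \<cdot> \<pi> (e \<cdot> u)"
    if w: "w \<in> Hom \<O> T' S" and wp: "w \<cdot> p = u \<cdot> p" and ew: "e \<cdot> w = e \<cdot> u" for w
  proof
    note eu' = Comp_Hom[OF u e]
    have h: "\<eta>(w / e) \<in> Hom \<O> (mid (e \<cdot> u)) S"
      using eta_rel_Hom[OF w e] by (simp add: simps ew Hom_Dom[OF e])
    have w_eq: "\<eta>(w / e) \<cdot> \<pi> (e \<cdot> u) = w"
      using eta_rel_pi[OF w e] by (simp add: simps ew Comp_Idn_left[OF w])
    then show "w = \<eta>(w / e) \<cdot> \<pi> (e \<cdot> u)" ..
    note absorb = pi_Comp_quasibijection[OF p eu' qp mono] eta_Comp_quasibijection[OF p eu' qp mono]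
    show "\<eta>(u \<cdot> p / e) = \<eta>(w / e)"
    proof (rule eta_rel_unique[OF Comp_Hom[OF p u] e])
      show "\<eta>(w / e) \<in> Hom \<O> (mid (e \<cdot> (u \<cdot> p))) (mid e)"
        unfolding eup absorb simps Hom_Dom[OF e] by (rule h)
      show "\<eta>(w / e) \<cdot> \<pi> (e \<cdot> (u \<cdot> p)) = \<pi> e \<cdot> (u \<cdot> p)"
        unfolding eup absorb simps Comp_assoc[OF p pi_Hom[OF eu'] h] w_eq wp
        by (rule Comp_Idn_left[OF Comp_Hom[OF p u], symmetric])
      show "\<eta> e \<cdot> \<eta>(w / e) = \<eta> (e \<cdot> (u \<cdot> p))"
        unfolding eup absorb eta_eta_rel[OF w e] ew ..
    qed
  qed
  from this[OF u refl refl] this[OF v up[symmetric] eu[symmetric]] show ?thesis by metis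
qed

end

section \<open>Reindexing of chains\<close>

definition ordinal_map :: "nat \<Rightarrow> nat \<Rightarrow> (nat \<Rightarrow> nat) \<Rightarrow> bool" where
  "ordinal_map m n \<theta> \<longleftrightarrow> (\<forall>k\<le>m. \<theta> k \<le> n) \<and> (\<forall>j k. j \<le> k \<longrightarrow> k \<le> m \<longrightarrow> \<theta> j \<le> \<theta> k)"

lemma ordinal_map_le: "ordinal_map m n \<theta> \<Longrightarrow> k \<le> m \<Longrightarrow> \<theta> k \<le> n"
  and ordinal_map_mono: "ordinal_map m n \<theta> \<Longrightarrow> j \<le> k \<Longrightarrow> k \<le> m \<Longrightarrow> \<theta> j \<le> \<theta> k"
  by (simp_all add: ordinal_map_def)

lemma ordinal_map_comp: "ordinal_map l m \<phi> \<Longrightarrow> ordinal_map m n \<theta> \<Longrightarrow> ordinal_map l n (\<theta> \<circ> \<phi>)"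
  by (simp add: ordinal_map_def)

lemma vertex_0 [simp]: "vertex C x 0 = base x"
  and vertex_Suc: "vertex C x (Suc k) = Dom C (links x ! k)"
  by (simp_all add: vertex_def)

context category
begin

text \<open>For \<open>i \<le> j\<close> this is the composite \<open>f\<^bsub>i+1\<^esub> \<cdots> f\<^sub>j : T\<^sub>j \<rightarrow> T\<^sub>i\<close>. The value for \<open>j < i\<close> is a dummy.\<close>

primrec seg :: "('o, 'a) chain \<Rightarrow> nat \<Rightarrow> nat \<Rightarrow> 'a" where
  "seg x i 0 = Idn C (vertex C x i)"
| "seg x i (Suc j) = (if i \<le> j then seg x i j \<cdot> (links x ! j) else Idn C (vertex C x i))"

lemma total_eq_seg: "total C x k = seg x 0 k"
  by (induction k) simp_all

lemma seg_self: "seg x i i = Idn C (vertex C x i)"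
  by (cases i) simp_all

lemma link_Hom: "x \<in> chains C n \<Longrightarrow> k < n \<Longrightarrow> links x ! k \<in> Hom C (vertex C x (Suc k)) (vertex C x k)"
  by (simp add: chains_def Hom_def vertex_Suc)

lemma vertex_Obj: "x \<in> chains C n \<Longrightarrow> k \<le> n \<Longrightarrow> vertex C x k \<in> Obj C"
  using Hom_Obj(1)[OF link_Hom, of x n "k - 1"] by (cases k) (simp_all add: chains_def)

lemma length_links: "x \<in> chains C n \<Longrightarrow> length (links x) = n"
  by (simp add: chains_def)

lemma chainsI:
  assumes "base x \<in> Obj C" "length (links x) = n"
    and "\<And>k. k < n \<Longrightarrow> links x ! k \<in> Hom C (vertex C x (Suc k)) (vertex C x k)"
  shows "x \<in> chains C n"
  using assms by (simp add: chains_def Hom_def)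

lemma chain_eqI:
  assumes "length (links x) = n" "length (links y) = n" "base x = base y"
    and "\<And>k. k < n \<Longrightarrow> links x ! k = links y ! k"
  shows "x = y"
  by (rule chain.expand, rule conjI[OF assms(3) nth_equalityI]) (simp_all add: assms)

lemma seg_Hom:
  assumes x: "x \<in> chains C n"
  shows "i \<le> j \<Longrightarrow> j \<le> n \<Longrightarrow> seg x i j \<in> Hom C (vertex C x j) (vertex C x i)"
proof (induction j)
  case 0
  then show ?case using Idn_Hom[OF vertex_Obj[OF x, of 0]] by simp
next
  case (Suc j)
  show ?case
  proof (cases "i \<le> j")
    case True
    with Suc have "seg x i j \<in> Hom C (vertex C x j) (vertex C x i)" by simp
    from Comp_Hom[OF link_Hom[OF x] this] show ?thesis using True Suc.prems by simp
  next
    case False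
    with Suc.prems have "i = Suc j" by simp
    then show ?thesis using Idn_Hom[OF vertex_Obj[OF x Suc.prems(2)]] by (simp add: seg_self)
  qed
qed

lemma seg_Comp:
  assumes x: "x \<in> chains C n" and "i \<le> j"
  shows "j \<le> k \<Longrightarrow> k \<le> n \<Longrightarrow> seg x i j \<cdot> seg x j k = seg x i k"
proof (induction k)
  case 0
  then show ?case using \<open>i \<le> j\<close> Comp_Idn_right[OF seg_Hom[OF x, of i j]] by simp
next
  case (Suc k)
  show ?case
  proof (cases "j \<le> k")
    case True
    with Suc have "seg x i j \<cdot> seg x j k = seg x i k" by simp
    moreover have "seg x i j \<cdot> (seg x j k \<cdot> (links x ! k)) = (seg x i j \<cdot> seg x j k) \<cdot> (links x ! k)"
      using True Suc.prems \<open>i \<le> j\<close>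
      by (intro Comp_assoc[OF link_Hom[OF x] seg_Hom[OF x] seg_Hom[OF x]]) auto
    ultimately show ?thesis using True \<open>i \<le> j\<close> by simp
  next
    case False
    with Suc.prems have "j = Suc k" by simp
    then show ?thesis
      using \<open>i \<le> j\<close> Suc.prems Comp_Idn_right[OF seg_Hom[OF x, of i j]] by (simp only: seg_self)
  qed
qed

lemma seg_link: "x \<in> chains C n \<Longrightarrow> k < n \<Longrightarrow> seg x k (Suc k) = links x ! k"
  by (simp add: seg_self Comp_Idn_left[OF link_Hom])

text \<open>A chain of length \<open>n\<close> is a contravariant functor on the ordinal \<open>{0..n}\<close>, and \<open>reindex m \<theta>\<close>
  restricts it along a monotone \<open>\<theta> : {0..m} \<rightarrow> {0..n}\<close>. As restriction is functorial in \<open>\<theta>\<close>,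
  simplicial identities become equations between maps of natural numbers.\<close>

definition reindex :: "nat \<Rightarrow> (nat \<Rightarrow> nat) \<Rightarrow> ('o, 'a) chain \<Rightarrow> ('o, 'a) chain" where
  "reindex m \<theta> x = Chain (vertex C x (\<theta> 0)) (map (\<lambda>k. seg x (\<theta> k) (\<theta> (Suc k))) [0..<m])"

lemma reindex_simps [simp]:
  "base (reindex m \<theta> x) = vertex C x (\<theta> 0)"
  "length (links (reindex m \<theta> x)) = m"
  "k < m \<Longrightarrow> links (reindex m \<theta> x) ! k = seg x (\<theta> k) (\<theta> (Suc k))"
  by (simp_all add: reindex_def)

lemma reindex_cong: "(\<And>k. k \<le> m \<Longrightarrow> \<theta> k = \<theta>' k) \<Longrightarrow> reindex m \<theta> x = reindex m \<theta>' x"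
  by (simp add: reindex_def)

context
  fixes x m n \<theta>
  assumes x: "x \<in> chains C n" and \<theta>: "ordinal_map m n \<theta>"
begin

lemma vertex_reindex: "k \<le> m \<Longrightarrow> vertex C (reindex m \<theta> x) k = vertex C x (\<theta> k)"
  using Hom_Dom[OF seg_Hom[OF x ordinal_map_mono[OF \<theta>] ordinal_map_le[OF \<theta>]]]
  by (cases k) (simp_all add: vertex_Suc)

lemma reindex_chains: "reindex m \<theta> x \<in> chains C m"
proof (rule chainsI)
  show "base (reindex m \<theta> x) \<in> Obj C"
    using vertex_Obj[OF x ordinal_map_le[OF \<theta>]] by simp
  show "links (reindex m \<theta> x) ! k \<in> Hom C (vertex C (reindex m \<theta> x) (Suc k)) (vertex C (reindex m \<theta> x) k)"
    if "k < m" for k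
    using that seg_Hom[OF x ordinal_map_mono[OF \<theta>] ordinal_map_le[OF \<theta>]]
    by (simp add: vertex_reindex)
qed simp

lemma seg_reindex: "i \<le> j \<Longrightarrow> j \<le> m \<Longrightarrow> seg (reindex m \<theta> x) i j = seg x (\<theta> i) (\<theta> j)"
proof (induction j)
  case 0
  then show ?case by (simp add: seg_self)
next
  case (Suc j)
  show ?case
  proof (cases "i \<le> j")
    case True
    with Suc have "seg (reindex m \<theta> x) i j = seg x (\<theta> i) (\<theta> j)" by simp
    moreover have "seg x (\<theta> i) (\<theta> j) \<cdot> seg x (\<theta> j) (\<theta> (Suc j)) = seg x (\<theta> i) (\<theta> (Suc j))"
      using True Suc.prems by (intro seg_Comp[OF x]) (auto intro: ordinal_map_mono[OF \<theta>] ordinal_map_le[OF \<theta>])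
    ultimately show ?thesis using True Suc.prems by simp
  next
    case False
    with Suc.prems have "i = Suc j" by simp
    then show ?thesis using Suc.prems by (simp only: seg_self vertex_reindex)
  qed
qed

lemma reindex_reindex:
  assumes "ordinal_map l m \<phi>"
  shows "reindex l \<phi> (reindex m \<theta> x) = reindex l (\<theta> \<circ> \<phi>) x"
  by (rule chain_eqI[where n = l])
    (use ordinal_map_le[OF assms] ordinal_map_mono[OF assms] in
      \<open>simp_all add: vertex_reindex seg_reindex\<close>)

end

lemma reindex_id: "x \<in> chains C n \<Longrightarrow> reindex n (\<lambda>k. k) x = x"
  by (rule chain_eqI[where n = n]) (simp_all add: length_links seg_link del: seg.simps)

end

section \<open>The categories of chains\<close>

context operadic_category
begin

text \<open>The fop conditions include the commutativity of the squares with base \<open>\<sigma>\<^sub>0\<close>, which is kept here as a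
  separate conjunct; it will follow from the commutativity of the small squares.\<close>

lemma chain_maps_iff:
  "ChainMap x y \<sigma> \<in> chain_maps \<O> n \<longleftrightarrow>
     x \<in> chains \<O> n \<and> y \<in> chains \<O> n \<and> length \<sigma> = n + 1
     \<and> (\<forall>k\<le>n. quasibijection \<O> (\<sigma> ! k) \<and> \<sigma> ! k \<in> Hom \<O> (vertex \<O> x k) (vertex \<O> y k))
     \<and> (\<forall>k<n. \<sigma> ! k \<cdot> (links x ! k) = (links y ! k) \<cdot> (\<sigma> ! Suc k))
     \<and> (\<forall>k\<le>n. \<sigma> ! 0 \<cdot> seg x 0 k = seg y 0 k \<cdot> (\<sigma> ! k) \<and> mono_on_fibres (seg y 0 k) (\<sigma> ! k))"
proof -
  have "fop \<O> (total \<O> x k) (total \<O> y k) (\<sigma> ! k) (\<sigma> ! 0) \<longleftrightarrow>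
      \<sigma> ! 0 \<cdot> seg x 0 k = seg y 0 k \<cdot> (\<sigma> ! k) \<and> mono_on_fibres (seg y 0 k) (\<sigma> ! k)"
    if "x \<in> chains \<O> n" "y \<in> chains \<O> n" "k \<le> n"
      "\<forall>k\<le>n. \<sigma> ! k \<in> Hom \<O> (vertex \<O> x k) (vertex \<O> y k)" for k
    unfolding total_eq_seg
    using that by (intro fop_iff[OF _ _ seg_Hom[of x n] seg_Hom[of y n]]) auto
  then show ?thesis
    unfolding chain_maps_def by auto
qed

lemma chain_mapsD:
  assumes "\<sigma> \<in> chain_maps \<O> n"
  shows "source \<sigma> \<in> chains \<O> n" "target \<sigma> \<in> chains \<O> n" "length (comps \<sigma>) = n + 1"
    and "k \<le> n \<Longrightarrow> quasibijection \<O> (comps \<sigma> ! k)"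
    and "k \<le> n \<Longrightarrow> comps \<sigma> ! k \<in> Hom \<O> (vertex \<O> (source \<sigma>) k) (vertex \<O> (target \<sigma>) k)"
    and "k < n \<Longrightarrow> comps \<sigma> ! k \<cdot> (links (source \<sigma>) ! k) = (links (target \<sigma>) ! k) \<cdot> (comps \<sigma> ! Suc k)"
    and "k \<le> n \<Longrightarrow> mono_on_fibres (seg (target \<sigma>) 0 k) (comps \<sigma> ! k)"
  using assms chain_maps_iff[of "source \<sigma>" "target \<sigma>" "comps \<sigma>" n] by auto

lemma chain_map_eqI:
  assumes "source \<sigma> = source \<tau>" "target \<sigma> = target \<tau>" "length (comps \<sigma>) = n + 1"
    "length (comps \<tau>) = n + 1" and "\<And>k. k \<le> n \<Longrightarrow> comps \<sigma> ! k = comps \<tau> ! k"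
  shows "\<sigma> = \<tau>"
  by (rule chain_map.expand, intro conjI assms(1,2), rule nth_equalityI) (simp_all add: assms)

lemma squares_seg:
  assumes x: "x \<in> chains \<O> n" and y: "y \<in> chains \<O> n"
    and \<sigma>: "\<And>k. k \<le> n \<Longrightarrow> \<sigma> k \<in> Hom \<O> (vertex \<O> x k) (vertex \<O> y k)"
    and eq: "\<And>k. k < n \<Longrightarrow> \<sigma> k \<cdot> (links x ! k) = (links y ! k) \<cdot> \<sigma> (Suc k)"
  shows "i \<le> j \<Longrightarrow> j \<le> n \<Longrightarrow> \<sigma> i \<cdot> seg x i j = seg y i j \<cdot> \<sigma> j"
proof (induction j)
  case 0
  then show ?case
    using Comp_Idn_left[OF \<sigma>[of 0]] Comp_Idn_right[OF \<sigma>[of 0]] by (simp add: seg_self)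
next
  case (Suc j)
  show ?case
  proof (cases "i \<le> j")
    case True
    have "\<sigma> i \<cdot> (seg x i j \<cdot> (links x ! j)) = (\<sigma> i \<cdot> seg x i j) \<cdot> (links x ! j)"
      using True Suc.prems by (intro Comp_assoc[OF link_Hom[OF x] seg_Hom[OF x] \<sigma>]) auto
    also have "\<dots> = (seg y i j \<cdot> \<sigma> j) \<cdot> (links x ! j)"
      using Suc True by simp
    also have "\<dots> = seg y i j \<cdot> (\<sigma> j \<cdot> (links x ! j))"
      using True Suc.prems by (intro Comp_assoc[OF link_Hom[OF x] \<sigma> seg_Hom[OF y], symmetric]) auto
    also have "\<dots> = seg y i j \<cdot> ((links y ! j) \<cdot> \<sigma> (Suc j))"
      using eq Suc.prems by simp
    also have "\<dots> = (seg y i j \<cdot> (links y ! j)) \<cdot> \<sigma> (Suc j)"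
      using True Suc.prems by (intro Comp_assoc[OF \<sigma> link_Hom[OF y] seg_Hom[OF y]]) auto
    finally show ?thesis using True by simp
  next
    case False
    with Suc.prems have "i = Suc j" by simp
    then show ?thesis
      using Suc.prems Comp_Idn_left[OF \<sigma>[of i]] Comp_Idn_right[OF \<sigma>[of i]] by (simp only: seg_self)
  qed
qed

lemma chain_mapsI:
  assumes x: "x \<in> chains \<O> n" and y: "y \<in> chains \<O> n"
    and q: "\<And>k. k \<le> n \<Longrightarrow> quasibijection \<O> (\<sigma> k)"
    and \<sigma>: "\<And>k. k \<le> n \<Longrightarrow> \<sigma> k \<in> Hom \<O> (vertex \<O> x k) (vertex \<O> y k)"
    and eq: "\<And>k. k < n \<Longrightarrow> \<sigma> k \<cdot> (links x ! k) = (links y ! k) \<cdot> \<sigma> (Suc k)"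
    and mono: "\<And>k. k \<le> n \<Longrightarrow> mono_on_fibres (seg y 0 k) (\<sigma> k)"
  shows "ChainMap x y (map \<sigma> [0..<n + 1]) \<in> chain_maps \<O> n"
proof -
  have nth: "map \<sigma> [0..<n + 1] ! k = \<sigma> k" if "k \<le> n" for k
    using that by (simp del: upt_Suc)
  show ?thesis
    unfolding chain_maps_iff using assms squares_seg[OF x y \<sigma> eq, of 0] by (auto simp: nth simp del: upt_Suc)
qed

lemma chain_map_seg:
  assumes "\<sigma> \<in> chain_maps \<O> n" "i \<le> j" "j \<le> n"
  shows "comps \<sigma> ! i \<cdot> seg (source \<sigma>) i j = seg (target \<sigma>) i j \<cdot> (comps \<sigma> ! j)"
  by (rule squares_seg[OF chain_mapsD(1,2)[OF assms(1)] _ _ assms(2,3)]) (rule chain_mapsD[OF assms(1)], simp)+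

lemma W_simps [simp]:
  "Obj (W \<O> n) = chains \<O> n" "Arr (W \<O> n) = chain_maps \<O> n" "Dom (W \<O> n) = source" "Cod (W \<O> n) = target"
  by (simp_all add: W_def)

lemma W_Idn: "Idn (W \<O> n) x = ChainMap x x (map (\<lambda>k. Idn \<O> (vertex \<O> x k)) [0..<n + 1])"
  and W_Comp: "\<tau> \<cdot>\<^bsub>W \<O> n\<^esub> \<sigma> = ChainMap (source \<sigma>) (target \<tau>)
    (map (\<lambda>k. (comps \<tau> ! k) \<cdot> (comps \<sigma> ! k)) [0..<n + 1])"
  by (simp_all add: W_def)

lemma nth_map_upt_Suc [simp]: "k \<le> n \<Longrightarrow> map h [0..<Suc n] ! k = h k"
  by (simp del: upt_Suc)

lemma Idn_chain_maps:
  assumes x: "x \<in> chains \<O> n"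
  shows "Idn (W \<O> n) x \<in> chain_maps \<O> n"
  unfolding W_Idn
proof (rule chain_mapsI[OF x x])
  show "Idn \<O> (vertex \<O> x k) \<cdot> (links x ! k) = (links x ! k) \<cdot> Idn \<O> (vertex \<O> x (Suc k))" if "k < n" for k
    using Comp_Idn_left[OF link_Hom[OF x that]] Comp_Idn_right[OF link_Hom[OF x that]] by simp
qed (auto intro: quasibijection_Idn Idn_Hom vertex_Obj[OF x]
    mono_on_fibres_order_preserving order_preserving_Idn)

lemma Comp_chain_maps:
  assumes \<sigma>: "\<sigma> \<in> chain_maps \<O> n" and \<tau>: "\<tau> \<in> chain_maps \<O> n" and st: "target \<sigma> = source \<tau>"
  shows "\<tau> \<cdot>\<^bsub>W \<O> n\<^esub> \<sigma> \<in> chain_maps \<O> n"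
  unfolding W_Comp
proof (rule chain_mapsI[OF chain_mapsD(1)[OF \<sigma>] chain_mapsD(2)[OF \<tau>]])
  let ?x = "source \<sigma>" and ?y = "source \<tau>" and ?z = "target \<tau>"
  note x = chain_mapsD(1)[OF \<sigma>] and y = chain_mapsD(1)[OF \<tau>] and z = chain_mapsD(2)[OF \<tau>]
  note \<tau>D = chain_mapsD[OF \<tau>] and \<sigma>D = chain_mapsD[OF \<sigma>, unfolded st]
  fix k
  {
    assume k: "k \<le> n"
    show "comps \<tau> ! k \<cdot> (comps \<sigma> ! k) \<in> Hom \<O> (vertex \<O> ?x k) (vertex \<O> ?z k)"
      by (rule Comp_Hom[OF \<sigma>D(5)[OF k] \<tau>D(5)[OF k]])
    show "quasibijection \<O> (comps \<tau> ! k \<cdot> (comps \<sigma> ! k))"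
      by (rule quasibijection_Comp[OF \<sigma>D(4)[OF k] \<tau>D(4)[OF k] \<sigma>D(5)[OF k] \<tau>D(5)[OF k]])
    have "mono_on_fibres (comps \<tau> ! 0 \<cdot> seg ?y 0 k) (comps \<sigma> ! k)"
      using mono_on_fibres_quasibijection_left[OF \<sigma>D(7)[OF k] \<tau>D(4) \<sigma>D(5)[OF k] seg_Hom[OF y] \<tau>D(5)] k
      by simp
    then have "mono_on_fibres (seg ?z 0 k \<cdot> (comps \<tau> ! k)) (comps \<sigma> ! k)"
      using chain_map_seg[OF \<tau>, of 0 k] k by simp
    then show "mono_on_fibres (seg ?z 0 k) (comps \<tau> ! k \<cdot> (comps \<sigma> ! k))"
      using k by (intro mono_on_fibres_Comp[OF _ \<tau>D(7)[OF k] \<sigma>D(5)[OF k] \<tau>D(5)[OF k] seg_Hom[OF z]]) auto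
  }
  assume k: "k < n"
  then have k': "k \<le> n" "Suc k \<le> n" by auto
  have "comps \<tau> ! k \<cdot> (comps \<sigma> ! k) \<cdot> (links ?x ! k) = comps \<tau> ! k \<cdot> (comps \<sigma> ! k \<cdot> (links ?x ! k))"
    by (rule Comp_assoc[OF link_Hom[OF x k] \<sigma>D(5)[OF k'(1)] \<tau>D(5)[OF k'(1)], symmetric])
  also have "\<dots> = comps \<tau> ! k \<cdot> ((links ?y ! k) \<cdot> (comps \<sigma> ! Suc k))"
    by (simp only: \<sigma>D(6)[OF k])
  also have "\<dots> = (comps \<tau> ! k \<cdot> (links ?y ! k)) \<cdot> (comps \<sigma> ! Suc k)"
    by (rule Comp_assoc[OF \<sigma>D(5)[OF k'(2)] link_Hom[OF y k] \<tau>D(5)[OF k'(1)]])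
  also have "\<dots> = ((links ?z ! k) \<cdot> (comps \<tau> ! Suc k)) \<cdot> (comps \<sigma> ! Suc k)"
    by (simp only: \<tau>D(6)[OF k])
  also have "\<dots> = (links ?z ! k) \<cdot> (comps \<tau> ! Suc k \<cdot> (comps \<sigma> ! Suc k))"
    by (rule Comp_assoc[OF \<sigma>D(5)[OF k'(2)] \<tau>D(5)[OF k'(2)] link_Hom[OF z k], symmetric])
  finally show "comps \<tau> ! k \<cdot> (comps \<sigma> ! k) \<cdot> (links ?x ! k) =
      (links ?z ! k) \<cdot> (comps \<tau> ! Suc k \<cdot> (comps \<sigma> ! Suc k))" .
qed

lemma category_W: "category (W \<O> n)"
proof
  show "Dom (W \<O> n) \<sigma> \<in> Obj (W \<O> n)" "Cod (W \<O> n) \<sigma> \<in> Obj (W \<O> n)" if "\<sigma> \<in> Arr (W \<O> n)" for \<sigma>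
    using chain_mapsD(1,2) that by auto
  show "Idn (W \<O> n) x \<in> Hom (W \<O> n) x x" if "x \<in> Obj (W \<O> n)" for x
    using Idn_chain_maps that by (simp add: Hom_def W_Idn)
  show "\<tau> \<cdot>\<^bsub>W \<O> n\<^esub> \<sigma> \<in> Hom (W \<O> n) x z" if "\<sigma> \<in> Hom (W \<O> n) x y" "\<tau> \<in> Hom (W \<O> n) y z" for \<sigma> \<tau> x y z
    using Comp_chain_maps[of \<sigma> n \<tau>] that by (simp add: Hom_def W_Comp)
  show "Idn (W \<O> n) y \<cdot>\<^bsub>W \<O> n\<^esub> \<sigma> = \<sigma>" "\<sigma> \<cdot>\<^bsub>W \<O> n\<^esub> Idn (W \<O> n) x = \<sigma>" if "\<sigma> \<in> Hom (W \<O> n) x y" for \<sigma> x y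
  proof -
    have \<sigma>: "\<sigma> \<in> chain_maps \<O> n" and xy: "source \<sigma> = x" "target \<sigma> = y"
      using that by (auto simp: Hom_def)
    note \<sigma>D = chain_mapsD[OF \<sigma>]
    show "Idn (W \<O> n) y \<cdot>\<^bsub>W \<O> n\<^esub> \<sigma> = \<sigma>" "\<sigma> \<cdot>\<^bsub>W \<O> n\<^esub> Idn (W \<O> n) x = \<sigma>"
      by (rule chain_map_eqI[where n = n],
          use Comp_Idn_left[OF \<sigma>D(5)] Comp_Idn_right[OF \<sigma>D(5)] \<sigma>D(3) xy in
            \<open>simp_all add: W_Comp W_Idn del: upt_Suc\<close>)+
  qed
  show "\<rho> \<cdot>\<^bsub>W \<O> n\<^esub> (\<tau> \<cdot>\<^bsub>W \<O> n\<^esub> \<sigma>) = (\<rho> \<cdot>\<^bsub>W \<O> n\<^esub> \<tau>) \<cdot>\<^bsub>W \<O> n\<^esub> \<sigma>"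
    if "\<sigma> \<in> Hom (W \<O> n) w x" "\<tau> \<in> Hom (W \<O> n) x y" "\<rho> \<in> Hom (W \<O> n) y z" for \<sigma> \<tau> \<rho> w x y z
  proof (rule chain_map_eqI[where n = n])
    have arr: "\<sigma> \<in> chain_maps \<O> n" "\<tau> \<in> chain_maps \<O> n" "\<rho> \<in> chain_maps \<O> n"
      and eqs: "target \<sigma> = source \<tau>" "target \<tau> = source \<rho>"
      using that by (auto simp: Hom_def)
    fix k
    assume k: "k \<le> n"
    have "comps \<rho> ! k \<cdot> (comps \<tau> ! k \<cdot> (comps \<sigma> ! k)) = comps \<rho> ! k \<cdot> (comps \<tau> ! k) \<cdot> (comps \<sigma> ! k)"
      using Comp_assoc[OF chain_mapsD(5)[OF arr(1) k, unfolded eqs] chain_mapsD(5)[OF arr(2) k, unfolded eqs]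
          chain_mapsD(5)[OF arr(3) k]] .
    then show "comps (\<rho> \<cdot>\<^bsub>W \<O> n\<^esub> (\<tau> \<cdot>\<^bsub>W \<O> n\<^esub> \<sigma>)) ! k = comps (\<rho> \<cdot>\<^bsub>W \<O> n\<^esub> \<tau> \<cdot>\<^bsub>W \<O> n\<^esub> \<sigma>) ! k"
      using k by (simp add: W_Comp del: upt_Suc)
  qed (simp_all add: W_Comp)
qed

definition reindex_map :: "nat \<Rightarrow> (nat \<Rightarrow> nat) \<Rightarrow> ('o, 'a) chain_map \<Rightarrow> ('o, 'a) chain_map" where
  "reindex_map m \<theta> \<sigma> = ChainMap (reindex m \<theta> (source \<sigma>)) (reindex m \<theta> (target \<sigma>))
     (map (\<lambda>k. comps \<sigma> ! \<theta> k) [0..<m + 1])"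

lemma reindex_map_simps [simp]:
  "source (reindex_map m \<theta> \<sigma>) = reindex m \<theta> (source \<sigma>)"
  "target (reindex_map m \<theta> \<sigma>) = reindex m \<theta> (target \<sigma>)"
  "length (comps (reindex_map m \<theta> \<sigma>)) = m + 1"
  "k \<le> m \<Longrightarrow> comps (reindex_map m \<theta> \<sigma>) ! k = comps \<sigma> ! \<theta> k"
  by (simp_all add: reindex_map_def del: upt_Suc)

lemma reindex_map_cong: "(\<And>k. k \<le> m \<Longrightarrow> \<theta> k = \<theta>' k) \<Longrightarrow> reindex_map m \<theta> \<sigma> = reindex_map m \<theta>' \<sigma>"
  by (rule chain_map_eqI[where n = m]) (simp_all cong: reindex_cong)

text \<open>When \<open>\<theta>\<close> moves the base of the chain from \<open>T\<^sub>0\<close> to \<open>T\<^sub>j\<close>, the components remain fop: the fibres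
  over \<open>T\<^sub>j\<close> are contained in those over \<open>T\<^sub>0\<close>.\<close>

lemma reindex_map_chain_maps:
  assumes \<sigma>: "\<sigma> \<in> chain_maps \<O> n" and \<theta>: "ordinal_map m n \<theta>"
  shows "reindex_map m \<theta> \<sigma> \<in> chain_maps \<O> m"
  unfolding reindex_map_def
proof (rule chain_mapsI)
  note \<sigma>D = chain_mapsD[OF \<sigma>]
  note le = ordinal_map_le[OF \<theta>] and mono = ordinal_map_mono[OF \<theta>]
  let ?x = "source \<sigma>" and ?y = "target \<sigma>"
  show "reindex m \<theta> ?x \<in> chains \<O> m" "reindex m \<theta> ?y \<in> chains \<O> m"
    by (rule reindex_chains[OF _ \<theta>], rule \<sigma>D)+
  fix k
  {
    assume k: "k \<le> m"
    show "quasibijection \<O> (comps \<sigma> ! \<theta> k)" by (rule \<sigma>D(4)[OF le[OF k]])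
    show "comps \<sigma> ! \<theta> k \<in> Hom \<O> (vertex \<O> (reindex m \<theta> ?x) k) (vertex \<O> (reindex m \<theta> ?y) k)"
      unfolding vertex_reindex[OF \<sigma>D(1) \<theta> k] vertex_reindex[OF \<sigma>D(2) \<theta> k] by (rule \<sigma>D(5)[OF le[OF k]])
    have seg: "seg ?y 0 (\<theta> 0) \<in> Hom \<O> (vertex \<O> ?y (\<theta> 0)) (vertex \<O> ?y 0)"
      "seg ?y (\<theta> 0) (\<theta> k) \<in> Hom \<O> (vertex \<O> ?y (\<theta> k)) (vertex \<O> ?y (\<theta> 0))"
      "seg ?y 0 (\<theta> k) = seg ?y 0 (\<theta> 0) \<cdot> seg ?y (\<theta> 0) (\<theta> k)"
      using k mono[of 0 k] le 
      by (auto intro!: seg_Hom[OF \<sigma>D(2)] seg_Comp[OF \<sigma>D(2), symmetric] simp del: vertex_0)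
    have "mono_on_fibres (seg ?y 0 (\<theta> 0) \<cdot> seg ?y (\<theta> 0) (\<theta> k)) (comps \<sigma> ! \<theta> k)"
      using \<sigma>D(7)[OF le[OF k]] by (simp only: seg(3))
    then show "mono_on_fibres (seg (reindex m \<theta> ?y) 0 k) (comps \<sigma> ! \<theta> k)"
      unfolding seg_reindex[OF \<sigma>D(2) \<theta> le0 k]
      by (rule mono_on_fibres_cancel[OF _ \<sigma>D(5)[OF le[OF k]] seg(2,1)])
  }
  assume k: "k < m"
  then show "comps \<sigma> ! \<theta> k \<cdot> (links (reindex m \<theta> ?x) ! k) =
      (links (reindex m \<theta> ?y) ! k) \<cdot> (comps \<sigma> ! \<theta> (Suc k))"
    using mono[of k "Suc k"] le[of "Suc k"] chain_map_seg[OF \<sigma>, of "\<theta> k" "\<theta> (Suc k)"] by simp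
qed

lemma reindex_map_reindex_map:
  assumes \<sigma>: "\<sigma> \<in> chain_maps \<O> n" and \<theta>: "ordinal_map m n \<theta>" and \<phi>: "ordinal_map l m \<phi>"
  shows "reindex_map l \<phi> (reindex_map m \<theta> \<sigma>) = reindex_map l (\<theta> \<circ> \<phi>) \<sigma>"
  by (rule chain_map_eqI[where n = l])
    (use ordinal_map_le[OF \<phi>] in \<open>simp_all add: reindex_reindex[OF _ \<theta> \<phi>] chain_mapsD(1,2)[OF \<sigma>]\<close>)

lemma reindex_map_id: "\<sigma> \<in> chain_maps \<O> n \<Longrightarrow> reindex_map n (\<lambda>k. k) \<sigma> = \<sigma>"
  by (rule chain_map_eqI[where n = n]) (simp_all add: reindex_id chain_mapsD)

definition reindex_ftr ::
    "nat \<Rightarrow> (nat \<Rightarrow> nat) \<Rightarrow> (('o, 'a) chain, ('o, 'a) chain_map, ('o, 'a) chain, ('o, 'a) chain_map) ftr" where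
  "reindex_ftr m \<theta> = \<lparr>ob_map = reindex m \<theta>, arr_map = reindex_map m \<theta>\<rparr>"

lemma reindex_functor:
  assumes \<theta>: "ordinal_map m n \<theta>"
  shows "cat_functor (W \<O> n) (W \<O> m) (reindex_ftr m \<theta>)"
proof (intro cat_functor.intro cat_functor_axioms.intro category_W)
  note le = ordinal_map_le[OF \<theta>]
  show "ob_map (reindex_ftr m \<theta>) x \<in> Obj (W \<O> m)" if "x \<in> Obj (W \<O> n)" for x
    using reindex_chains[OF _ \<theta>] that by (simp add: reindex_ftr_def)
  show "arr_map (reindex_ftr m \<theta>) \<sigma> \<in> Hom (W \<O> m) (ob_map (reindex_ftr m \<theta>) x) (ob_map (reindex_ftr m \<theta>) y)"
    if "\<sigma> \<in> Hom (W \<O> n) x y" for \<sigma> x y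
    using reindex_map_chain_maps[OF _ \<theta>] that by (auto simp: reindex_ftr_def Hom_def)
  show "arr_map (reindex_ftr m \<theta>) (Idn (W \<O> n) x) = Idn (W \<O> m) (ob_map (reindex_ftr m \<theta>) x)"
    if "x \<in> Obj (W \<O> n)" for x
    by (rule chain_map_eqI[where n = m])
      (use that le vertex_reindex[OF _ \<theta>] in \<open>simp_all add: reindex_ftr_def W_Idn del: upt_Suc\<close>)
  show "arr_map (reindex_ftr m \<theta>) (\<tau> \<cdot>\<^bsub>W \<O> n\<^esub> \<sigma>) =
      arr_map (reindex_ftr m \<theta>) \<tau> \<cdot>\<^bsub>W \<O> m\<^esub> arr_map (reindex_ftr m \<theta>) \<sigma>"
    if "\<sigma> \<in> Hom (W \<O> n) x y" "\<tau> \<in> Hom (W \<O> n) y z" for \<sigma> \<tau> x y z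
    by (rule chain_map_eqI[where n = m])
      (use that le in \<open>simp_all add: reindex_ftr_def W_Comp del: upt_Suc\<close>)
qed

end

section \<open>Functors and natural transformations up to equality on carriers\<close>

lemma ftr_comp_simps [simp]:
  "ob_map (G \<circ>\<^sub>F F) x = ob_map G (ob_map F x)"
  "arr_map (G \<circ>\<^sub>F F) f = arr_map G (arr_map F f)"
  by (simp_all add: ftr_comp_def)

lemma ftr_comp_assoc: "(H \<circ>\<^sub>F G) \<circ>\<^sub>F F = H \<circ>\<^sub>F (G \<circ>\<^sub>F F)"
  by (simp add: ftr_comp_def comp_assoc)

lemma ftr_comp_id [simp]: "F \<circ>\<^sub>F ftr_id = F" "ftr_id \<circ>\<^sub>F F = F"
  by (simp_all add: ftr_comp_def ftr_id_def comp_def)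

lemma ftr_eqI:
  "(\<And>x. x \<in> Obj C \<Longrightarrow> ob_map F x = ob_map G x) \<Longrightarrow>
   (\<And>f. f \<in> Arr C \<Longrightarrow> arr_map F f = arr_map G f) \<Longrightarrow> ftr_eq C F G"
  by (simp add: ftr_eq_def)

lemma ftr_eq_ob: "ftr_eq C F G \<Longrightarrow> x \<in> Obj C \<Longrightarrow> ob_map F x = ob_map G x"
  and ftr_eq_arr: "ftr_eq C F G \<Longrightarrow> f \<in> Arr C \<Longrightarrow> arr_map F f = arr_map G f"
  by (simp_all add: ftr_eq_def)

lemma ftr_eq_sym: "ftr_eq C F G \<Longrightarrow> ftr_eq C G F"
  by (simp add: ftr_eq_def)

lemma ftr_eq_trans [trans]: "ftr_eq C F G \<Longrightarrow> ftr_eq C G H \<Longrightarrow> ftr_eq C F H"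
  by (simp add: ftr_eq_def)

lemma ftr_eq_post: "ftr_eq C F G \<Longrightarrow> ftr_eq C (H \<circ>\<^sub>F F) (H \<circ>\<^sub>F G)"
  by (simp add: ftr_eq_def)

lemma cat_functor_Arr: "cat_functor C D F \<Longrightarrow> f \<in> Arr C \<Longrightarrow> arr_map F f \<in> Arr D"
  using cat_functor.arr_map_Hom[of C D F f "Dom C f" "Cod C f"] by (simp add: Hom_def)

lemma ftr_eq_pre: "ftr_eq D G H \<Longrightarrow> cat_functor C D F \<Longrightarrow> ftr_eq C (G \<circ>\<^sub>F F) (H \<circ>\<^sub>F F)"
  by (simp add: ftr_eq_def cat_functor.ob_map_Obj cat_functor_Arr)

lemma cat_functor_comp:
  assumes F: "cat_functor C D F" and G: "cat_functor D E G"
  shows "cat_functor C E (G \<circ>\<^sub>F F)"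
proof -
  interpret F: cat_functor C D F by (rule F)
  interpret G: cat_functor D E G by (rule G)
  show ?thesis
    by unfold_locales
      (auto simp: F.arr_map_Idn G.arr_map_Idn[OF F.ob_map_Obj] F.arr_map_Comp G.arr_map_Comp[OF F.arr_map_Hom F.arr_map_Hom]
        intro!: G.ob_map_Obj F.ob_map_Obj G.arr_map_Hom F.arr_map_Hom)
qed

lemma cat_functor_cong:
  assumes F: "cat_functor C D F" and eq: "ftr_eq C F G"
  shows "cat_functor C D G"
proof -
  interpret F: cat_functor C D F by (rule F)
  note ob = ftr_eq_ob[OF eq, symmetric] and arr = ftr_eq_arr[OF eq, symmetric]
  show ?thesis
  proof
    show "ob_map G x \<in> Obj D" if "x \<in> Obj C" for x
      using F.ob_map_Obj[OF that] by (simp add: ob[OF that])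
    show "arr_map G f \<in> Hom D (ob_map G x) (ob_map G y)" if "f \<in> Hom C x y" for f x y
      using F.arr_map_Hom[OF that] F.C.Hom_Obj[OF that] Hom_Arr[OF that] by (simp add: ob arr)
    show "arr_map G (Idn C x) = Idn D (ob_map G x)" if "x \<in> Obj C" for x
      using F.arr_map_Idn[OF that] Hom_Arr[OF F.C.Idn_Hom[OF that]] that by (simp add: ob arr)
    show "arr_map G (g \<cdot>\<^bsub>C\<^esub> f) = arr_map G g \<cdot>\<^bsub>D\<^esub> arr_map G f"
      if "f \<in> Hom C x y" "g \<in> Hom C y z" for f g x y z
      using F.arr_map_Comp[OF that] Hom_Arr[OF that(1)] Hom_Arr[OF that(2)]
        Hom_Arr[OF F.C.Comp_Hom[OF that]] by (simp add: arr)
  qed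
qed

lemma Hom_full_subcat: "f \<in> Hom (full_subcat C A) x y \<longleftrightarrow> f \<in> Hom C x y \<and> x \<in> A \<and> y \<in> A"
  by (auto simp: Hom_def full_subcat_def)

lemma full_subcat_simps [simp]:
  "Obj (full_subcat C A) = Obj C \<inter> A" "Idn (full_subcat C A) = Idn C" "Comp (full_subcat C A) = Comp C"
  by (simp_all add: full_subcat_def)

lemma category_full_subcat:
  assumes "category C"
  shows "category (full_subcat C A)"
proof -
  interpret category C by (rule assms)
  show ?thesis
    by unfold_locales
      (auto simp: Hom_full_subcat Comp_Idn_left Comp_Idn_right Comp_assoc
        intro: Idn_Hom Comp_Hom, auto simp: full_subcat_def Dom_Obj Cod_Obj)
qed

lemma cat_functor_full_subcat:
  assumes F: "cat_functor C D F" and A: "\<And>x. x \<in> Obj C \<Longrightarrow> x \<in> A \<Longrightarrow> ob_map F x \<in> B"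
  shows "cat_functor (full_subcat C A) (full_subcat D B) F"
proof -
  interpret F: cat_functor C D F by (rule F)
  show ?thesis
    by (intro cat_functor.intro cat_functor_axioms.intro category_full_subcat F.C.category_axioms
        F.D.category_axioms)
      (auto simp: Hom_full_subcat F.arr_map_Idn F.arr_map_Comp
        intro: F.ob_map_Obj F.arr_map_Hom A F.C.Hom_Obj)
qed

lemma ftr_eq_full_subcat: "ftr_eq C F G \<Longrightarrow> ftr_eq (full_subcat C A) F G"
  by (simp add: ftr_eq_def full_subcat_def)

lemma nat_trans_pre:
  assumes K: "cat_functor B C K" and t: "nat_trans C D F G t"
  shows "nat_trans B D (F \<circ>\<^sub>F K) (G \<circ>\<^sub>F K) (t \<rhd>\<^sub>F K)"
proof -
  interpret K: cat_functor B C K by (rule K)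
  interpret t: nat_trans C D F G t by (rule t)
  show ?thesis
    by (intro nat_trans.intro nat_trans_axioms.intro cat_functor_comp[OF K] t.F.cat_functor_axioms
        t.G.cat_functor_axioms)
      (simp_all add: pre_whisker_def t.component_Hom K.ob_map_Obj t.naturality[OF K.arr_map_Hom])
qed

lemma nat_trans_post:
  assumes H: "cat_functor D E H" and t: "nat_trans C D F G t"
  shows "nat_trans C E (H \<circ>\<^sub>F F) (H \<circ>\<^sub>F G) (H \<lhd>\<^sub>F t)"
proof -
  interpret H: cat_functor D E H by (rule H)
  interpret t: nat_trans C D F G t by (rule t)
  have "arr_map H (t y) \<cdot>\<^bsub>E\<^esub> arr_map H (arr_map F f) = arr_map H (arr_map G f) \<cdot>\<^bsub>E\<^esub> arr_map H (t x)"
    if f: "f \<in> Hom C x y" for f x y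
    using t.naturality[OF f] H.arr_map_Comp[OF t.F.arr_map_Hom[OF f] t.component_Hom]
      H.arr_map_Comp[OF t.component_Hom t.G.arr_map_Hom[OF f]] t.F.C.Hom_Obj[OF f] by simp
  then show ?thesis
    by (intro nat_trans.intro nat_trans_axioms.intro cat_functor_comp[OF _ H] t.F.cat_functor_axioms
        t.G.cat_functor_axioms)
      (simp_all add: post_whisker_def H.arr_map_Hom t.component_Hom)
qed

lemma nat_trans_cong_source:
  assumes t: "nat_trans C D F G t" and eq: "ftr_eq C F F'"
  shows "nat_trans C D F' G t"
proof -
  interpret t: nat_trans C D F G t by (rule t)
  show ?thesis
    by (intro nat_trans.intro nat_trans_axioms.intro cat_functor_cong[OF t.F.cat_functor_axioms eq]
        t.G.cat_functor_axioms)
      (simp_all add: t.component_Hom t.naturality ftr_eq_ob[OF eq, symmetric] ftr_eq_arr[OF eq, symmetric] Hom_Arr)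
qed

lemma nat_trans_full_subcat:
  assumes t: "nat_trans C D F G t" and F: "\<And>x. x \<in> Obj C \<Longrightarrow> x \<in> A \<Longrightarrow> ob_map F x \<in> B"
    and G: "\<And>x. x \<in> Obj C \<Longrightarrow> x \<in> A \<Longrightarrow> ob_map G x \<in> B"
  shows "nat_trans (full_subcat C A) (full_subcat D B) F G t"
proof -
  interpret t: nat_trans C D F G t by (rule t)
  show ?thesis
    by (intro nat_trans.intro nat_trans_axioms.intro cat_functor_full_subcat F G t.F.cat_functor_axioms
        t.G.cat_functor_axioms)
      (simp_all add: Hom_full_subcat t.component_Hom t.naturality F G)
qed

section \<open>The simplicial structure on chains\<close>

text \<open>Faces and degeneracies number the objects of a chain from \<open>T\<^sub>n\<close> downwards, whereas \<open>vertex\<close> numbers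
  them from \<open>T\<^sub>0\<close> upwards: \<open>\<delta>\<^sub>i\<close> is restriction along \<open>skip (n - i)\<close> and \<open>\<gamma>\<^sub>i\<close> along
  \<open>duplicate (n - i)\<close>.\<close>

definition skip :: "nat \<Rightarrow> nat \<Rightarrow> nat" where
  "skip k j = (if j < k then j else Suc j)"

definition duplicate :: "nat \<Rightarrow> nat \<Rightarrow> nat" where
  "duplicate k j = (if j \<le> k then j else j - 1)"

context operadic_category
begin

text \<open>A functor that agrees on carriers with the restriction along \<open>\<theta>\<close> is determined there by the values of
  \<open>\<theta>\<close> on \<open>{0..m}\<close>.\<close>

definition reindexes ::
    "nat \<Rightarrow> nat \<Rightarrow> (('o, 'a) chain, ('o, 'a) chain_map, ('o, 'a) chain, ('o, 'a) chain_map) ftr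
     \<Rightarrow> (nat \<Rightarrow> nat) \<Rightarrow> bool" where
  "reindexes m n F \<theta> \<longleftrightarrow> ordinal_map m n \<theta> \<and> ftr_eq (W \<O> n) F (reindex_ftr m \<theta>)"

lemma reindexes_ob: "reindexes m n F \<theta> \<Longrightarrow> x \<in> chains \<O> n \<Longrightarrow> ob_map F x = reindex m \<theta> x"
  and reindexes_arr: "reindexes m n F \<theta> \<Longrightarrow> \<sigma> \<in> chain_maps \<O> n \<Longrightarrow> arr_map F \<sigma> = reindex_map m \<theta> \<sigma>"
  by (simp_all add: reindexes_def ftr_eq_def reindex_ftr_def)

lemma reindexes_functor: "reindexes m n F \<theta> \<Longrightarrow> cat_functor (W \<O> n) (W \<O> m) F"
  unfolding reindexes_def by (blast intro: cat_functor_cong[OF reindex_functor ftr_eq_sym])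

lemma reindexes_comp:
  assumes F: "reindexes l m F \<phi>" and G: "reindexes m n G \<theta>"
  shows "reindexes l n (F \<circ>\<^sub>F G) (\<theta> \<circ> \<phi>)"
proof -
  have ord: "ordinal_map l m \<phi>" "ordinal_map m n \<theta>"
    using F G by (simp_all add: reindexes_def)
  have "ftr_eq (W \<O> n) (F \<circ>\<^sub>F G) (reindex_ftr l (\<theta> \<circ> \<phi>))"
    using ord
    by (intro ftr_eqI)
      (simp_all add: reindexes_ob[OF G] reindexes_ob[OF F] reindexes_arr[OF G] reindexes_arr[OF F]
        reindex_chains reindex_map_chain_maps reindex_ftr_def reindex_reindex reindex_map_reindex_map)
  with ordinal_map_comp[OF ord] show ?thesis by (simp add: reindexes_def)
qed

lemma reindexes_id: "reindexes n n ftr_id (\<lambda>k. k)"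
  by (auto simp: reindexes_def ordinal_map_def ftr_id_def reindex_ftr_def reindex_id reindex_map_id
      intro: ftr_eqI)

lemma reindexes_eq:
  assumes F: "reindexes m n F \<theta>" and G: "reindexes m n G \<theta>'" and "\<And>k. k \<le> m \<Longrightarrow> \<theta> k = \<theta>' k"
  shows "ftr_eq (W \<O> n) F G"
  using reindex_cong[of m \<theta> \<theta>'] reindex_map_cong[of m \<theta> \<theta>'] assms(3)
  by (intro ftr_eqI) (simp_all add: reindexes_ob[OF F] reindexes_ob[OF G] reindexes_arr[OF F] reindexes_arr[OF G])

lemma chain_face_eq_reindex:
  assumes x: "x \<in> chains \<O> (Suc n)" and i: "i \<le> Suc n"
  shows "chain_face \<O> (Suc n) i x = reindex n (skip (Suc n - i)) x"
proof -
  note len = length_links[OF x] and seg1 = seg_link[OF x]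
  consider "i = 0" | "i = Suc n" | "0 < i" "i < Suc n" using i by linarith
  then show ?thesis
  proof cases
    case 1
    then show ?thesis
      by (intro chain_eqI[where n = n])
        (simp_all add: chain_face_def skip_def len nth_butlast seg1 del: seg.simps)
  next
    case 2
    then show ?thesis
      by (intro chain_eqI[where n = n])
        (simp_all add: chain_face_def skip_def len nth_tl seg1 del: seg.simps)
  next
    case 3
    \<comment> \<open>The face removes \<open>T\<^bsub>j+1\<^esub>\<close>, so the arrows with list indices \<open>j\<close> and \<open>j + 1\<close> are composed.\<close>
    define j where "j = n - i"
    have k: "Suc n - i = Suc j" "j < n" using 3 by (auto simp: j_def)
    have two: "seg x j (Suc (Suc j)) = links x ! j \<cdot> (links x ! Suc j)"
      using seg1[of j] k(2) by simp
    show ?thesis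
    proof (rule chain_eqI[where n = n])
      show "links (chain_face \<O> (Suc n) i x) ! l = links (reindex n (skip (Suc n - i)) x) ! l"
        if "l < n" for l
      proof -
        consider "l < j" | "l = j" | "j < l" by linarith
        then show ?thesis
        proof cases
          case 1
          with 3 k that show ?thesis
            by (simp add: chain_face_def k(1) Let_def len nth_append skip_def seg1 del: seg.simps)
        next
          case 2
          with 3 k that show ?thesis
            by (simp add: chain_face_def k(1) Let_def len nth_append skip_def two del: seg.simps)
        next
          case 3
          with k that \<open>0 < i\<close> \<open>i < Suc n\<close> show ?thesis
            by (simp add: chain_face_def k(1) Let_def len nth_append nth_Cons' skip_def seg1 del: seg.simps)
        qed
      qed
    qed (use 3 k in \<open>simp_all add: chain_face_def k(1) Let_def len skip_def\<close>)
  qed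
qed

lemma chain_degeneracy_eq_reindex:
  assumes x: "x \<in> chains \<O> n" and i: "i \<le> n"
  shows "chain_degeneracy \<O> n i x = reindex (n + 1) (duplicate (n - i)) x"
proof (rule chain_eqI[where n = "n + 1"])
  note len = length_links[OF x] and seg1 = seg_link[OF x]
  define k where "k = n - i"
  have "k \<le> n" by (simp add: k_def)
  show "links (chain_degeneracy \<O> n i x) ! l = links (reindex (n + 1) (duplicate (n - i)) x) ! l"
    if "l < n + 1" for l
  proof -
    consider "l < k" | "l = k" | "k < l" by linarith
    then show ?thesis
    proof cases
      case 1
      with that \<open>k \<le> n\<close> show ?thesis
        by (simp add: chain_degeneracy_def k_def[symmetric] Let_def len nth_append duplicate_def seg1 del: seg.simps)
    next
      case 2
      with that \<open>k \<le> n\<close> show ?thesis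
        by (simp add: chain_degeneracy_def k_def[symmetric] Let_def len nth_append duplicate_def seg_self del: seg.simps)
    next
      case 3
      with that \<open>k \<le> n\<close> seg1[of "l - 1"] show ?thesis
        by (simp add: chain_degeneracy_def k_def[symmetric] Let_def len nth_append nth_Cons' duplicate_def
            del: seg.simps)
    qed
  qed
qed (use i in \<open>simp_all add: chain_degeneracy_def Let_def duplicate_def length_links[OF x]\<close>)

lemma reindexes_delta_Suc:
  assumes i: "i \<le> Suc n"
  shows "reindexes n (Suc n) (delta \<O> (Suc n) i) (skip (Suc n - i))"
  unfolding reindexes_def
proof
  show "ordinal_map n (Suc n) (skip (Suc n - i))"
    by (auto simp: ordinal_map_def skip_def)
  show "ftr_eq (W \<O> (Suc n)) (delta \<O> (Suc n) i) (reindex_ftr n (skip (Suc n - i)))"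
  proof (rule ftr_eqI)
    fix \<sigma>
    assume "\<sigma> \<in> Arr (W \<O> (Suc n))"
    then have \<sigma>: "\<sigma> \<in> chain_maps \<O> (Suc n)" by simp
    note \<sigma>D = chain_mapsD[OF \<sigma>]
    show "arr_map (delta \<O> (Suc n) i) \<sigma> = arr_map (reindex_ftr n (skip (Suc n - i))) \<sigma>"
      by (rule chain_map_eqI[where n = n])
        (use i \<sigma>D(3) in \<open>simp_all add: delta_def reindex_ftr_def chain_face_eq_reindex[OF \<sigma>D(1) i]
            chain_face_eq_reindex[OF \<sigma>D(2) i] nth_append skip_def\<close>)
  qed (use chain_face_eq_reindex i in \<open>simp add: delta_def reindex_ftr_def\<close>)
qed

lemma reindexes_delta: "n = Suc m \<Longrightarrow> i \<le> n \<Longrightarrow> reindexes m n (delta \<O> n i) (skip (n - i))"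
  using reindexes_delta_Suc by simp

lemma reindexes_gamma_Suc:
  assumes i: "i \<le> n"
  shows "reindexes (n + 1) n (gamma \<O> n i) (duplicate (n - i))"
  unfolding reindexes_def
proof
  show "ordinal_map (n + 1) n (duplicate (n - i))"
    using i by (auto simp: ordinal_map_def duplicate_def)
  show "ftr_eq (W \<O> n) (gamma \<O> n i) (reindex_ftr (n + 1) (duplicate (n - i)))"
  proof (rule ftr_eqI)
    fix \<sigma>
    assume "\<sigma> \<in> Arr (W \<O> n)"
    then have \<sigma>: "\<sigma> \<in> chain_maps \<O> n" by simp
    note \<sigma>D = chain_mapsD[OF \<sigma>]
    show "arr_map (gamma \<O> n i) \<sigma> = arr_map (reindex_ftr (n + 1) (duplicate (n - i))) \<sigma>"
    proof (rule chain_map_eqI[where n = "n + 1"])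
      show "comps (arr_map (gamma \<O> n i) \<sigma>) ! k = comps (arr_map (reindex_ftr (n + 1) (duplicate (n - i))) \<sigma>) ! k"
        if "k \<le> n + 1" for k
      proof -
        define j where "j = n - i"
        consider "k < j" | "k = j" | "j < k" by linarith
        then show ?thesis
          by cases (use i \<sigma>D(3) that in \<open>simp_all add: gamma_def reindex_ftr_def j_def[symmetric]
            nth_append nth_Cons' duplicate_def\<close>, auto simp: j_def nth_append nth_Cons' Suc_diff_Suc)
      qed
    qed (use i \<sigma>D(3) in \<open>simp_all add: gamma_def reindex_ftr_def chain_degeneracy_eq_reindex[OF \<sigma>D(1) i]
            chain_degeneracy_eq_reindex[OF \<sigma>D(2) i]\<close>)
  qed (use chain_degeneracy_eq_reindex i in \<open>simp add: gamma_def reindex_ftr_def\<close>)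
qed

lemma reindexes_gamma: "m = Suc n \<Longrightarrow> i \<le> n \<Longrightarrow> reindexes m n (gamma \<O> n i) (duplicate (n - i))"
  using reindexes_gamma_Suc by simp

lemmas reindexes_face_face = reindexes_comp[OF reindexes_delta reindexes_delta]
  and reindexes_face_degeneracy = reindexes_comp[OF reindexes_delta reindexes_gamma]
  and reindexes_degeneracy_face = reindexes_comp[OF reindexes_gamma reindexes_delta]
  and reindexes_degeneracy_degeneracy = reindexes_comp[OF reindexes_gamma reindexes_gamma]

lemma delta_delta:
  assumes "i < j" "j \<le> Suc (Suc m)"
  shows "ftr_eq (W \<O> (Suc (Suc m))) (delta \<O> (Suc m) i \<circ>\<^sub>F delta \<O> (Suc (Suc m)) j)
    (delta \<O> (Suc m) (j - 1) \<circ>\<^sub>F delta \<O> (Suc (Suc m)) i)"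
  by (rule reindexes_eq[OF reindexes_face_face reindexes_face_face, where m = m])
    (use assms in \<open>auto simp: skip_def\<close>)

lemma delta_gamma_less:
  assumes "i < j" "j \<le> Suc m"
  shows "ftr_eq (W \<O> (Suc m)) (delta \<O> (Suc (Suc m)) i \<circ>\<^sub>F gamma \<O> (Suc m) j)
    (gamma \<O> m (j - 1) \<circ>\<^sub>F delta \<O> (Suc m) i)"
  by (rule reindexes_eq[OF reindexes_face_degeneracy reindexes_degeneracy_face, where m = "Suc m"])
    (use assms in \<open>auto simp: skip_def duplicate_def\<close>)

lemma delta_gamma_same:
  assumes "j \<le> m" "i = j \<or> i = Suc j"
  shows "ftr_eq (W \<O> m) (delta \<O> (Suc m) i \<circ>\<^sub>F gamma \<O> m j) ftr_id"
  by (rule reindexes_eq[OF reindexes_face_degeneracy reindexes_id])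
    (use assms in \<open>auto simp: skip_def duplicate_def\<close>)

lemma delta_gamma_greater:
  assumes "Suc j < i" "i \<le> Suc (Suc m)"
  shows "ftr_eq (W \<O> (Suc m)) (delta \<O> (Suc (Suc m)) i \<circ>\<^sub>F gamma \<O> (Suc m) j)
    (gamma \<O> m j \<circ>\<^sub>F delta \<O> (Suc m) (i - 1))"
  by (rule reindexes_eq[OF reindexes_face_degeneracy reindexes_degeneracy_face, where m = "Suc m"])
    (use assms in \<open>auto simp: skip_def duplicate_def\<close>)

lemma gamma_gamma:
  assumes "i \<le> j" "j \<le> m"
  shows "ftr_eq (W \<O> m) (gamma \<O> (Suc m) i \<circ>\<^sub>F gamma \<O> m j)
    (gamma \<O> (Suc m) (Suc j) \<circ>\<^sub>F gamma \<O> m i)"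
  by (rule reindexes_eq[OF reindexes_degeneracy_degeneracy reindexes_degeneracy_degeneracy, where m = "Suc (Suc m)"])
    (use assms in \<open>auto simp: duplicate_def\<close>)

lemma delta_functor: "i \<le> Suc n \<Longrightarrow> cat_functor (W \<O> (Suc n)) (W \<O> n) (delta \<O> (Suc n) i)"
  by (rule reindexes_functor[OF reindexes_delta]) simp_all

lemma gamma_functor: "i \<le> n \<Longrightarrow> cat_functor (W \<O> n) (W \<O> (Suc n)) (gamma \<O> n i)"
  by (rule reindexes_functor[OF reindexes_gamma]) simp_all

end

section \<open>The reflection onto locally order-preserving chains\<close>

context strictly_factorisable
begin

lemma eta_Idn: "x \<in> Obj \<O> \<Longrightarrow> \<eta> (Idn \<O> x) = Idn \<O> x"
  by (rule eta_order_preserving[OF Idn_Hom order_preserving_Idn])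

lemma pi_Idn: "x \<in> Obj \<O> \<Longrightarrow> \<pi> (Idn \<O> x) = Idn \<O> x"
  by (rule pi_order_preserving[OF Idn_Hom order_preserving_Idn])

lemma reflect_chain_simps [simp]:
  "base (reflect_chain \<O> n x) = base x" "length (links (reflect_chain \<O> n x)) = n"
  by (simp_all add: reflect_chain_def)

context
  fixes x n
  assumes x: "x \<in> chains \<O> n"
begin

lemma seg_0_Hom: "k \<le> n \<Longrightarrow> seg x 0 k \<in> Hom \<O> (vertex \<O> x k) (base x)"
  using seg_Hom[OF x, of 0 k] by simp

lemma base_Obj: "base x \<in> Obj \<O>"
  using vertex_Obj[OF x, of 0] by simp

text \<open>As \<open>\<eta>(f/id) = \<eta>(f)\<close>, the arrow of the reflected chain next to the base obeys the same
  formula as the others.\<close>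

lemma links_reflect: "k < n \<Longrightarrow> links (reflect_chain \<O> n x) ! k = \<eta>(links x ! k / seg x 0 k)"
  using eta_rel_over_Idn[OF link_Hom[OF x, of 0]] by (auto simp: reflect_chain_def total_eq_seg)

lemma vertex_reflect: "k \<le> n \<Longrightarrow> vertex \<O> (reflect_chain \<O> n x) k = mid (seg x 0 k)"
proof (cases k)
  case 0
  then show ?thesis using Hom_Dom[OF Idn_Hom[OF base_Obj]] by (simp add: eta_Idn base_Obj)
next
  case (Suc j)
  assume "k \<le> n"
  with Suc show ?thesis
    using Hom_Dom[OF eta_rel_Hom[OF link_Hom[OF x] seg_0_Hom], of j] by (simp add: vertex_Suc links_reflect)
qed

lemma reflect_chains: "reflect_chain \<O> n x \<in> chains \<O> n"
proof (rule chainsI)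
  fix k
  assume k: "k < n"
  then show "links (reflect_chain \<O> n x) ! k \<in>
      Hom \<O> (vertex \<O> (reflect_chain \<O> n x) (Suc k)) (vertex \<O> (reflect_chain \<O> n x) k)"
    using eta_rel_Hom[OF link_Hom[OF x k] seg_0_Hom[of k]] by (simp add: links_reflect vertex_reflect)
qed (simp_all add: base_Obj)

lemma seg_reflect: "i \<le> j \<Longrightarrow> j \<le> n \<Longrightarrow> seg (reflect_chain \<O> n x) i j = \<eta>(seg x i j / seg x 0 i)"
proof (induction j)
  case 0
  then show ?case
    using eta_rel_Idn[OF Idn_Hom[OF base_Obj]] Hom_Dom[OF Idn_Hom[OF base_Obj]]
    by (simp add: eta_Idn base_Obj)
next
  case (Suc j)
  show ?case
  proof (cases "i \<le> j")
    case True
    have "seg (reflect_chain \<O> n x) i j = \<eta>(seg x i j / seg x 0 i)"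
      using Suc True by simp
    moreover have "\<eta>(seg x i j \<cdot> (links x ! j) / seg x 0 i) =
        \<eta>(seg x i j / seg x 0 i) \<cdot> \<eta>(links x ! j / seg x 0 i \<cdot> seg x i j)"
      using True Suc.prems by (intro eta_rel_Comp[OF link_Hom[OF x] seg_Hom[OF x] seg_0_Hom]) auto
    moreover have "seg x 0 i \<cdot> seg x i j = seg x 0 j"
      using True Suc.prems by (intro seg_Comp[OF x]) auto
    ultimately show ?thesis using True Suc.prems by (simp add: links_reflect)
  next
    case False
    with Suc.prems have i: "i = Suc j" by simp
    have "seg x 0 i \<in> Hom \<O> (vertex \<O> x i) (base x)"
      using Suc.prems i by (intro seg_0_Hom) simp
    from eta_rel_Idn[OF this] show ?thesis
      using Suc.prems unfolding i seg_self by (simp only: vertex_reflect)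
  qed
qed

lemma seg_0_reflect: "k \<le> n \<Longrightarrow> seg (reflect_chain \<O> n x) 0 k = \<eta> (seg x 0 k)"
  using eta_rel_over_Idn[OF seg_0_Hom, of k] by (simp add: seg_reflect)

lemma reflect_order_preserving: "k \<le> n \<Longrightarrow> order_preserving \<O> (seg (reflect_chain \<O> n x) 0 k)"
  using order_preserving_eta[OF seg_0_Hom] by (simp add: seg_0_reflect)

lemma reflect_id:
  assumes "\<And>k. k \<le> n \<Longrightarrow> order_preserving \<O> (seg x 0 k)"
  shows "reflect_chain \<O> n x = x"
proof (rule chain_eqI[where n = n])
  fix k
  assume k: "k < n"
  have eq: "seg x 0 k \<cdot> (links x ! k) = seg x 0 (Suc k)" by simp
  show "links (reflect_chain \<O> n x) ! k = links x ! k"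
    unfolding links_reflect[OF k]
    by (rule eta_rel_order_preserving[OF link_Hom[OF x k] seg_0_Hom assms, unfolded eq])
      (use k assms[of "Suc k"] in simp_all)
qed (simp_all add: length_links[OF x])

end

lemma reflect_reindex:
  assumes x: "x \<in> chains \<O> n" and \<theta>: "ordinal_map m n \<theta>" and \<theta>0: "\<theta> 0 = 0"
  shows "reflect_chain \<O> m (reindex m \<theta> x) = reindex m \<theta> (reflect_chain \<O> n x)"
proof (rule chain_eqI[where n = m])
  fix k
  assume k: "k < m"
  have "\<theta> k \<le> \<theta> (Suc k)" "\<theta> (Suc k) \<le> n"
    using k ordinal_map_mono[OF \<theta>] ordinal_map_le[OF \<theta>] by auto
  then show "links (reflect_chain \<O> m (reindex m \<theta> x)) ! k = links (reindex m \<theta> (reflect_chain \<O> n x)) ! k"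
    using k \<theta>0 by (simp add: links_reflect[OF reindex_chains[OF x \<theta>]] seg_reindex[OF x \<theta>] seg_reflect[OF x])
qed (simp_all add: \<theta>0)

abbreviation reflect_map :: "nat \<Rightarrow> ('o, 'a) chain_map \<Rightarrow> ('o, 'a) chain_map" where
  "reflect_map n \<equiv> arr_map (reflection \<O> n)"

lemma ob_map_reflection [simp]: "ob_map (reflection \<O> n) x = reflect_chain \<O> n x"
  by (simp add: reflection_def)

lemma reflect_map_simps [simp]:
  "source (reflect_map n \<sigma>) = reflect_chain \<O> n (source \<sigma>)"
  "target (reflect_map n \<sigma>) = reflect_chain \<O> n (target \<sigma>)"
  "length (comps (reflect_map n \<sigma>)) = n + 1"
  by (simp_all add: reflection_def)

lemma comps_reflect_map:
  assumes \<sigma>: "\<sigma> \<in> chain_maps \<O> n" and k: "k \<le> n"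
  shows "comps (reflect_map n \<sigma>) ! k = \<pi> (comps \<sigma> ! 0 \<cdot> \<eta> (seg (source \<sigma>) 0 k))"
proof (cases "k = 0")
  case True
  note \<sigma>0 = chain_mapsD(4,5)[OF \<sigma> le0]
  have "\<pi> (comps \<sigma> ! 0 \<cdot> \<eta> (Idn \<O> (base (source \<sigma>)))) = comps \<sigma> ! 0"
    using Comp_Idn_right[OF \<sigma>0(2)] pi_quasibijection[OF \<sigma>0(2,1)] base_Obj[OF chain_mapsD(1)[OF \<sigma>]]
    by (simp add: eta_Idn)
  with True show ?thesis by (simp add: reflection_def)
next
  case False
  then obtain j where "k = Suc j"
    using not0_implies_Suc by blast
  with k show ?thesis
    by (simp add: reflection_def total_eq_seg del: upt_Suc)
qed

context
  fixes \<sigma> n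
  assumes \<sigma>: "\<sigma> \<in> chain_maps \<O> n"
begin

private lemma x: "source \<sigma> \<in> chains \<O> n" and y: "target \<sigma> \<in> chains \<O> n"
  using chain_mapsD[OF \<sigma>] by auto

private lemma \<sigma>0: "comps \<sigma> ! 0 \<in> Hom \<O> (base (source \<sigma>)) (base (target \<sigma>))" "quasibijection \<O> (comps \<sigma> ! 0)"
  using chain_mapsD(4,5)[OF \<sigma>, of 0] by auto

lemma
  assumes k: "k \<le> n"
  shows eta_reflect_map: "\<eta> (comps \<sigma> ! 0 \<cdot> \<eta> (seg (source \<sigma>) 0 k)) = \<eta> (seg (target \<sigma>) 0 k)"
    and reflect_map_unit_square:
      "comps (reflect_map n \<sigma>) ! k \<cdot> \<pi> (seg (source \<sigma>) 0 k) = \<pi> (seg (target \<sigma>) 0 k) \<cdot> (comps \<sigma> ! k)"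
proof -
  note square = eta_square pi_square
  note * = square[OF seg_0_Hom[OF x k] seg_0_Hom[OF y k] chain_mapsD(5)[OF \<sigma> k] chain_mapsD(4)[OF \<sigma> k] \<sigma>0
      chain_map_seg[OF \<sigma> le0 k] chain_mapsD(7)[OF \<sigma> k]]
  show "\<eta> (comps \<sigma> ! 0 \<cdot> \<eta> (seg (source \<sigma>) 0 k)) = \<eta> (seg (target \<sigma>) 0 k)"
    "comps (reflect_map n \<sigma>) ! k \<cdot> \<pi> (seg (source \<sigma>) 0 k) = \<pi> (seg (target \<sigma>) 0 k) \<cdot> (comps \<sigma> ! k)"
    by (simp_all add: * comps_reflect_map[OF \<sigma> k])
qed

private lemma diagonal_Hom:
  "k \<le> n \<Longrightarrow> comps \<sigma> ! 0 \<cdot> \<eta> (seg (source \<sigma>) 0 k) \<in> Hom \<O> (mid (seg (source \<sigma>) 0 k)) (base (target \<sigma>))"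
  by (rule Comp_Hom[OF eta_Hom[OF seg_0_Hom[OF x]] \<sigma>0(1)])

lemma
  assumes k: "k \<le> n"
  shows reflect_map_Hom:
      "comps (reflect_map n \<sigma>) ! k \<in> Hom \<O> (mid (seg (source \<sigma>) 0 k)) (mid (seg (target \<sigma>) 0 k))"
    and reflect_map_quasibijection: "quasibijection \<O> (comps (reflect_map n \<sigma>) ! k)"
    and reflect_map_mono: "mono_on_fibres (\<eta> (seg (target \<sigma>) 0 k)) (comps (reflect_map n \<sigma>) ! k)"
    and reflect_map_base_square: "comps \<sigma> ! 0 \<cdot> \<eta> (seg (source \<sigma>) 0 k) =
      \<eta> (seg (target \<sigma>) 0 k) \<cdot> (comps (reflect_map n \<sigma>) ! k)"
  using pi_Hom[OF diagonal_Hom[OF k]] quasibijection_pi[OF diagonal_Hom[OF k]] mono_pi[OF diagonal_Hom[OF k]]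
    eta_pi[OF diagonal_Hom[OF k]]
  by (simp_all add: comps_reflect_map[OF \<sigma> k] eta_reflect_map[OF k])

text \<open>The squares between consecutive middle objects commute after composition with the unit and
  after composition with the maps to the base; by cancellation they commute.\<close>

lemma reflect_map_square:
  assumes k: "k < n"
  shows "comps (reflect_map n \<sigma>) ! k \<cdot> \<eta>(links (source \<sigma>) ! k / seg (source \<sigma>) 0 k) =
    \<eta>(links (target \<sigma>) ! k / seg (target \<sigma>) 0 k) \<cdot> (comps (reflect_map n \<sigma>) ! Suc k)"
proof -
  let ?x = "source \<sigma>" and ?y = "target \<sigma>" and ?r = "\<lambda>k. comps (reflect_map n \<sigma>) ! k"
  have k': "k \<le> n" "Suc k \<le> n" using k by auto
  note f = link_Hom[OF x k] and g = link_Hom[OF y k]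
  note F = seg_0_Hom[OF x k'(1)] and G = seg_0_Hom[OF y k'(1)]
  note FF = seg_0_Hom[OF x k'(2)] and GG = seg_0_Hom[OF y k'(2)]
  have F_eq: "seg ?x 0 k \<cdot> (links ?x ! k) = seg ?x 0 (Suc k)"
    and G_eq: "seg ?y 0 k \<cdot> (links ?y ! k) = seg ?y 0 (Suc k)" by simp_all
  note hf = eta_rel_Hom[OF f F, unfolded F_eq] eta_rel_pi[OF f F, unfolded F_eq] eta_eta_rel[OF f F, unfolded F_eq]
  note hg = eta_rel_Hom[OF g G, unfolded G_eq] eta_rel_pi[OF g G, unfolded G_eq] eta_eta_rel[OF g G, unfolded G_eq]
  note r = reflect_map_Hom[OF k'(1)] and r' = reflect_map_Hom[OF k'(2)]
  note p = pi_Hom[OF FF]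
  let ?u = "?r k \<cdot> \<eta>(links ?x ! k / seg ?x 0 k)"
  let ?v = "\<eta>(links ?y ! k / seg ?y 0 k) \<cdot> ?r (Suc k)"
  have "\<eta> (seg ?y 0 k) \<cdot> ?u = (comps \<sigma> ! 0 \<cdot> \<eta> (seg ?x 0 k)) \<cdot> \<eta>(links ?x ! k / seg ?x 0 k)"
    by (simp add: Comp_assoc[OF hf(1) r eta_Hom[OF G]] reflect_map_base_square[OF k'(1)])
  also have eu: "\<dots> = comps \<sigma> ! 0 \<cdot> \<eta> (seg ?x 0 (Suc k))"
    by (simp only: Comp_assoc[OF hf(1) eta_Hom[OF F] \<sigma>0(1), symmetric] hf(3))
  finally have eu: "\<eta> (seg ?y 0 k) \<cdot> ?u = comps \<sigma> ! 0 \<cdot> \<eta> (seg ?x 0 (Suc k))" .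
  have ev: "\<eta> (seg ?y 0 k) \<cdot> ?v = comps \<sigma> ! 0 \<cdot> \<eta> (seg ?x 0 (Suc k))"
    by (simp only: Comp_assoc[OF r' hg(1) eta_Hom[OF G]] hg(3) reflect_map_base_square[OF k'(2)])
  have "?u \<cdot> \<pi> (seg ?x 0 (Suc k)) = ?r k \<cdot> (\<pi> (seg ?x 0 k) \<cdot> (links ?x ! k))"
    by (simp only: Comp_assoc[OF p hf(1) r, symmetric] hf(2))
  also have "\<dots> = (\<pi> (seg ?y 0 k) \<cdot> (comps \<sigma> ! k)) \<cdot> (links ?x ! k)"
    by (simp only: Comp_assoc[OF f pi_Hom[OF F] r] reflect_map_unit_square[OF k'(1)])
  also have "\<dots> = \<pi> (seg ?y 0 k) \<cdot> ((links ?y ! k) \<cdot> (comps \<sigma> ! Suc k))"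
    by (simp only: Comp_assoc[OF f chain_mapsD(5)[OF \<sigma> k'(1)] pi_Hom[OF G], symmetric] chain_mapsD(6)[OF \<sigma> k])
  also have "\<dots> = (\<eta>(links ?y ! k / seg ?y 0 k) \<cdot> \<pi> (seg ?y 0 (Suc k))) \<cdot> (comps \<sigma> ! Suc k)"
    by (simp only: Comp_assoc[OF chain_mapsD(5)[OF \<sigma> k'(2)] g pi_Hom[OF G]] hg(2))
  also have "\<dots> = \<eta>(links ?y ! k / seg ?y 0 k) \<cdot> (?r (Suc k) \<cdot> \<pi> (seg ?x 0 (Suc k)))"
    by (simp only: Comp_assoc[OF chain_mapsD(5)[OF \<sigma> k'(2)] pi_Hom[OF GG] hg(1), symmetric]
        reflect_map_unit_square[OF k'(2)])
  also have "\<dots> = ?v \<cdot> \<pi> (seg ?x 0 (Suc k))"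
    by (rule Comp_assoc[OF p r' hg(1)])
  finally have up: "?u \<cdot> \<pi> (seg ?x 0 (Suc k)) = ?v \<cdot> \<pi> (seg ?x 0 (Suc k))" .
  have mono: "mono_on_fibres (\<eta> (seg ?y 0 k) \<cdot> ?u) (\<pi> (seg ?x 0 (Suc k)))"
    unfolding eu
    by (rule mono_on_fibres_quasibijection_left[OF mono_pi[OF FF] \<sigma>0(2) p eta_Hom[OF FF] \<sigma>0(1)])
  show "?u = ?v"
    by (rule quasibijection_cancel[OF p Comp_Hom[OF hf(1) r] Comp_Hom[OF r' hg(1)] eta_Hom[OF G]
          quasibijection_pi[OF FF] order_preserving_eta[OF G] mono up]) (simp only: eu ev)
qed

lemma reflect_map_chain_maps: "reflect_map n \<sigma> \<in> chain_maps \<O> n"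
proof -
  have "ChainMap (reflect_chain \<O> n (source \<sigma>)) (reflect_chain \<O> n (target \<sigma>))
      (map (\<lambda>k. comps (reflect_map n \<sigma>) ! k) [0..<n + 1]) \<in> chain_maps \<O> n"
    by (rule chain_mapsI[OF reflect_chains[OF x] reflect_chains[OF y]])
      (simp_all add: reflect_map_quasibijection reflect_map_Hom reflect_map_mono reflect_map_square
        vertex_reflect[OF x] vertex_reflect[OF y] links_reflect[OF x] links_reflect[OF y] seg_0_reflect[OF y])
  also have "ChainMap (reflect_chain \<O> n (source \<sigma>)) (reflect_chain \<O> n (target \<sigma>))
      (map (\<lambda>k. comps (reflect_map n \<sigma>) ! k) [0..<n + 1]) = reflect_map n \<sigma>"
    by (rule chain_map_eqI[where n = n]) (simp_all del: upt_Suc)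
  finally show ?thesis .
qed

lemma reflect_map_reindex:
  assumes \<theta>: "ordinal_map m n \<theta>" and \<theta>0: "\<theta> 0 = 0"
  shows "reflect_map m (reindex_map m \<theta> \<sigma>) = reindex_map m \<theta> (reflect_map n \<sigma>)"
proof (rule chain_map_eqI[where n = m])
  fix k
  assume k: "k \<le> m"
  then show "comps (reflect_map m (reindex_map m \<theta> \<sigma>)) ! k = comps (reindex_map m \<theta> (reflect_map n \<sigma>)) ! k"
    using \<theta>0 ordinal_map_le[OF \<theta> k]
    by (simp add: comps_reflect_map[OF reindex_map_chain_maps[OF \<sigma> \<theta>]] comps_reflect_map[OF \<sigma>] seg_reindex[OF x \<theta>])
qed (simp_all add: reflect_reindex[OF _ \<theta> \<theta>0] x y)

lemma reflect_map_id:
  assumes px: "\<And>k. k \<le> n \<Longrightarrow> order_preserving \<O> (seg (source \<sigma>) 0 k)"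
    and py: "\<And>k. k \<le> n \<Longrightarrow> order_preserving \<O> (seg (target \<sigma>) 0 k)"
  shows "reflect_map n \<sigma> = \<sigma>"
proof (rule chain_map_eqI[where n = n])
  fix k
  assume k: "k \<le> n"
  have "Idn \<O> (vertex \<O> (target \<sigma>) k) \<cdot> (comps \<sigma> ! k) = comps \<sigma> ! k"
    by (rule Comp_Idn_left[OF chain_mapsD(5)[OF \<sigma> k]])
  moreover have "comps (reflect_map n \<sigma>) ! k \<cdot> Idn \<O> (vertex \<O> (source \<sigma>) k) = comps (reflect_map n \<sigma>) ! k"
    using Comp_Idn_right[OF reflect_map_Hom[OF k]] Hom_Dom[OF seg_0_Hom[OF x k]]
    by (simp add: eta_order_preserving[OF seg_0_Hom[OF x k] px[OF k]])
  ultimately show "comps (reflect_map n \<sigma>) ! k = comps \<sigma> ! k"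
    using reflect_map_unit_square[OF k]
    by (simp add: pi_order_preserving[OF seg_0_Hom[OF x k] px[OF k]] pi_order_preserving[OF seg_0_Hom[OF y k] py[OF k]])
qed (simp_all add: chain_mapsD(3)[OF \<sigma>] reflect_id x y px py)

end

text \<open>For a composite \<open>\<tau> \<sigma>\<close>, the square of \<open>r(\<sigma>)\<close> rewrites \<open>\<tau>\<^sub>0 \<sigma>\<^sub>0 \<eta>(f)\<close> as \<open>\<tau>\<^sub>0 \<eta>(g)\<close> precomposed with the
  component of \<open>r(\<sigma>)\<close>, a quasibijection that \<open>\<pi>\<close> absorbs.\<close>

lemma reflection_functor: "cat_functor (W \<O> n) (W \<O> n) (reflection \<O> n)"
proof (intro cat_functor.intro cat_functor_axioms.intro category_W)
  show "ob_map (reflection \<O> n) x \<in> Obj (W \<O> n)" if "x \<in> Obj (W \<O> n)" for x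
    using that by (simp add: reflect_chains)
  show "arr_map (reflection \<O> n) \<sigma> \<in> Hom (W \<O> n) (ob_map (reflection \<O> n) x) (ob_map (reflection \<O> n) y)"
    if "\<sigma> \<in> Hom (W \<O> n) x y" for \<sigma> x y
    using that by (auto simp: Hom_def reflect_map_chain_maps)
  show "arr_map (reflection \<O> n) (Idn (W \<O> n) x) = Idn (W \<O> n) (ob_map (reflection \<O> n) x)"
    if "x \<in> Obj (W \<O> n)" for x
  proof (rule chain_map_eqI[where n = n])
    have x: "x \<in> chains \<O> n" using that by simp
    fix k
    assume k: "k \<le> n"
    note F = seg_0_Hom[OF x k]
    have "comps (reflect_map n (Idn (W \<O> n) x)) ! k = \<pi> (Idn \<O> (base x) \<cdot> \<eta> (seg x 0 k))"
      using comps_reflect_map[OF Idn_chain_maps[OF x] k] by (simp add: W_Idn del: upt_Suc)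
    also have "\<dots> = Idn \<O> (mid (seg x 0 k))"
      by (simp add: Comp_Idn_left[OF eta_Hom[OF F]] pi_order_preserving[OF eta_Hom[OF F] order_preserving_eta[OF F]])
    finally show "comps (arr_map (reflection \<O> n) (Idn (W \<O> n) x)) ! k =
        comps (Idn (W \<O> n) (ob_map (reflection \<O> n) x)) ! k"
      using k by (simp add: W_Idn vertex_reflect[OF x] del: upt_Suc)
  qed (simp_all add: W_Idn)
  show "arr_map (reflection \<O> n) (\<tau> \<cdot>\<^bsub>W \<O> n\<^esub> \<sigma>) =
      arr_map (reflection \<O> n) \<tau> \<cdot>\<^bsub>W \<O> n\<^esub> arr_map (reflection \<O> n) \<sigma>"
    if "\<sigma> \<in> Hom (W \<O> n) x y" "\<tau> \<in> Hom (W \<O> n) y z" for \<sigma> \<tau> x y z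
  proof (rule chain_map_eqI[where n = n])
    have \<sigma>: "\<sigma> \<in> chain_maps \<O> n" and \<tau>: "\<tau> \<in> chain_maps \<O> n" and st: "target \<sigma> = source \<tau>"
      using that by (auto simp: Hom_def)
    note \<tau>\<sigma> = Comp_chain_maps[OF \<sigma> \<tau> st]
    fix k
    assume k: "k \<le> n"
    let ?s0 = "comps \<sigma> ! 0" and ?t0 = "comps \<tau> ! 0"
    note s0 = chain_mapsD(4,5)[OF \<sigma> le0] and t0 = chain_mapsD(4,5)[OF \<tau> le0]
    note F = seg_0_Hom[OF chain_mapsD(1)[OF \<sigma>] k] and G = seg_0_Hom[OF chain_mapsD(1)[OF \<tau>] k]
    note r = reflect_map_Hom[OF \<sigma> k, unfolded st]
    have mono: "mono_on_fibres (?t0 \<cdot> \<eta> (seg (source \<tau>) 0 k)) (comps (reflect_map n \<sigma>) ! k)"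
      using reflect_map_mono[OF \<sigma> k] t0 r eta_Hom[OF G] unfolding st
      by (intro mono_on_fibres_quasibijection_left) auto
    have t0': "?t0 \<in> Hom \<O> (base (source \<tau>)) (base (target \<tau>))"
      and s0': "?s0 \<in> Hom \<O> (base (source \<sigma>)) (base (source \<tau>))"
      using s0(2) t0(2) st by simp_all
    have "comps (reflect_map n (\<tau> \<cdot>\<^bsub>W \<O> n\<^esub> \<sigma>)) ! k = \<pi> ((?t0 \<cdot> ?s0) \<cdot> \<eta> (seg (source \<sigma>) 0 k))"
      using comps_reflect_map[OF \<tau>\<sigma> k] by (simp add: W_Comp del: upt_Suc)
    also have "(?t0 \<cdot> ?s0) \<cdot> \<eta> (seg (source \<sigma>) 0 k) = ?t0 \<cdot> (?s0 \<cdot> \<eta> (seg (source \<sigma>) 0 k))"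
      by (rule Comp_assoc[OF eta_Hom[OF F] s0' t0', symmetric])
    also have "\<dots> = (?t0 \<cdot> \<eta> (seg (source \<tau>) 0 k)) \<cdot> (comps (reflect_map n \<sigma>) ! k)"
      unfolding reflect_map_base_square[OF \<sigma> k] st by (rule Comp_assoc[OF r eta_Hom[OF G] t0'])
    also have "\<pi> \<dots> = \<pi> (?t0 \<cdot> \<eta> (seg (source \<tau>) 0 k)) \<cdot> (comps (reflect_map n \<sigma>) ! k)"
      by (rule pi_Comp_quasibijection[OF r Comp_Hom[OF eta_Hom[OF G] t0'] reflect_map_quasibijection[OF \<sigma> k] mono])
    finally show "comps (arr_map (reflection \<O> n) (\<tau> \<cdot>\<^bsub>W \<O> n\<^esub> \<sigma>)) ! k =
        comps (arr_map (reflection \<O> n) \<tau> \<cdot>\<^bsub>W \<O> n\<^esub> arr_map (reflection \<O> n) \<sigma>) ! k"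
      using k comps_reflect_map[OF \<tau> k] by (simp add: W_Comp del: upt_Suc)
  qed (simp_all add: W_Comp)
qed

lemma source_reflection_unit [simp]: "source (reflection_unit \<O> n x) = x"
  and target_reflection_unit [simp]: "target (reflection_unit \<O> n x) = reflect_chain \<O> n x"
  and length_reflection_unit [simp]: "length (comps (reflection_unit \<O> n x)) = n + 1"
  by (simp_all add: reflection_unit_def)

lemma comps_reflection_unit:
  assumes x: "x \<in> chains \<O> n" and k: "k \<le> n"
  shows "comps (reflection_unit \<O> n x) ! k = \<pi> (seg x 0 k)"
  using k by (cases k)
    (simp_all add: reflection_unit_def total_eq_seg pi_Idn base_Obj[OF x] del: upt_Suc)

lemma reflection_unit_chain_maps:
  assumes x: "x \<in> chains \<O> n"
  shows "reflection_unit \<O> n x \<in> chain_maps \<O> n"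
proof -
  have "ChainMap x (reflect_chain \<O> n x) (map (\<lambda>k. \<pi> (seg x 0 k)) [0..<n + 1]) \<in> chain_maps \<O> n"
  proof (rule chain_mapsI[OF x reflect_chains[OF x]])
    fix k
    show "quasibijection \<O> (\<pi> (seg x 0 k))" if "k \<le> n"
      by (rule quasibijection_pi[OF seg_0_Hom[OF x that]])
    show "\<pi> (seg x 0 k) \<in> Hom \<O> (vertex \<O> x k) (vertex \<O> (reflect_chain \<O> n x) k)" if "k \<le> n"
      unfolding vertex_reflect[OF x that] by (rule pi_Hom[OF seg_0_Hom[OF x that]])
    show "mono_on_fibres (seg (reflect_chain \<O> n x) 0 k) (\<pi> (seg x 0 k))" if "k \<le> n"
      unfolding seg_0_reflect[OF x that] by (rule mono_pi[OF seg_0_Hom[OF x that]])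
    show "\<pi> (seg x 0 k) \<cdot> (links x ! k) = (links (reflect_chain \<O> n x) ! k) \<cdot> \<pi> (seg x 0 (Suc k))"
      if "k < n"
      using eta_rel_pi[OF link_Hom[OF x that] seg_0_Hom[OF x]] that by (simp add: links_reflect[OF x])
  qed
  also have "ChainMap x (reflect_chain \<O> n x) (map (\<lambda>k. \<pi> (seg x 0 k)) [0..<n + 1]) = reflection_unit \<O> n x"
    by (rule chain_map_eqI[where n = n]) (simp_all add: comps_reflection_unit[OF x] del: upt_Suc)
  finally show ?thesis .
qed

lemma reflection_unit_nat_trans: "nat_trans (W \<O> n) (W \<O> n) ftr_id (reflection \<O> n) (reflection_unit \<O> n)"
proof (intro nat_trans.intro nat_trans_axioms.intro reflection_functor)
  show "cat_functor (W \<O> n) (W \<O> n) ftr_id"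
    by (rule reindexes_functor[OF reindexes_id])
  show "reflection_unit \<O> n x \<in> Hom (W \<O> n) (ob_map ftr_id x) (ob_map (reflection \<O> n) x)"
    if "x \<in> Obj (W \<O> n)" for x
    using reflection_unit_chain_maps that by (simp add: Hom_def ftr_id_def)
  show "reflection_unit \<O> n y \<cdot>\<^bsub>W \<O> n\<^esub> arr_map ftr_id \<sigma> = arr_map (reflection \<O> n) \<sigma> \<cdot>\<^bsub>W \<O> n\<^esub> reflection_unit \<O> n x"
    if "\<sigma> \<in> Hom (W \<O> n) x y" for \<sigma> x y
  proof (rule chain_map_eqI[where n = n])
    have \<sigma>: "\<sigma> \<in> chain_maps \<O> n" and xy: "x = source \<sigma>" "y = target \<sigma>"
      using that by (auto simp: Hom_def)
    fix k
    assume "k \<le> n"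
    then show "comps (reflection_unit \<O> n y \<cdot>\<^bsub>W \<O> n\<^esub> arr_map ftr_id \<sigma>) ! k =
        comps (arr_map (reflection \<O> n) \<sigma> \<cdot>\<^bsub>W \<O> n\<^esub> reflection_unit \<O> n x) ! k"
      using reflect_map_unit_square[OF \<sigma>] chain_mapsD(1,2)[OF \<sigma>]
      by (simp add: W_Comp ftr_id_def xy comps_reflection_unit del: upt_Suc)
  qed (use that in \<open>simp_all add: W_Comp ftr_id_def Hom_def\<close>)
qed

lemma reflection_unit_reindex:
  assumes x: "x \<in> chains \<O> n" and \<theta>: "ordinal_map m n \<theta>" and \<theta>0: "\<theta> 0 = 0"
  shows "reflection_unit \<O> m (reindex m \<theta> x) = reindex_map m \<theta> (reflection_unit \<O> n x)"
  by (rule chain_map_eqI[where n = m])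
    (use ordinal_map_le[OF \<theta>] \<theta>0 in \<open>simp_all add: reflect_reindex[OF x \<theta> \<theta>0]
      comps_reflection_unit[OF reindex_chains[OF x \<theta>]] comps_reflection_unit[OF x] seg_reindex[OF x \<theta>]\<close>)

lemma reflection_unit_id:
  assumes x: "x \<in> chains \<O> n" and "\<And>k. k \<le> n \<Longrightarrow> order_preserving \<O> (seg x 0 k)"
  shows "reflection_unit \<O> n x = Idn (W \<O> n) x"
  by (rule chain_map_eqI[where n = n])
    (use assms in \<open>simp_all add: W_Idn reflect_id comps_reflection_unit
      pi_order_preserving[OF seg_0_Hom[OF x]] del: upt_Suc\<close>)

text \<open>The reflected object, the unit and the reflected component at \<open>T\<^sub>k\<close> are read off from \<open>\<sigma>\<^sub>0\<close> and the
  composite \<open>T\<^sub>k \<rightarrow> T\<^sub>0\<close>, which survive every reindexing that preserves the base. Among faces and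
  degeneracies, just the top face moves the base.\<close>

lemma reflection_reindexes:
  assumes F: "reindexes m n F \<theta>" and \<theta>0: "\<theta> 0 = 0"
  shows "ftr_eq (W \<O> n) (reflection \<O> m \<circ>\<^sub>F F) (F \<circ>\<^sub>F reflection \<O> n)"
    and "x \<in> chains \<O> n \<Longrightarrow> reflection_unit \<O> m (ob_map F x) = arr_map F (reflection_unit \<O> n x)"
proof -
  have \<theta>: "ordinal_map m n \<theta>" using F by (simp add: reindexes_def)
  show "ftr_eq (W \<O> n) (reflection \<O> m \<circ>\<^sub>F F) (F \<circ>\<^sub>F reflection \<O> n)"
    by (rule ftr_eqI) (simp_all add: reindexes_ob[OF F] reindexes_arr[OF F] reflect_chains reflect_map_chain_maps
        reflect_reindex[OF _ \<theta> \<theta>0] reflect_map_reindex[OF _ \<theta> \<theta>0])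
  show "reflection_unit \<O> m (ob_map F x) = arr_map F (reflection_unit \<O> n x)" if "x \<in> chains \<O> n"
    using that by (simp add: reindexes_ob[OF F] reindexes_arr[OF F] reflection_unit_chain_maps
        reflection_unit_reindex[OF _ \<theta> \<theta>0])
qed

end

section \<open>The pita nerve\<close>

context strictly_factorisable
begin

lemma P_Obj: "x \<in> Obj (P \<O> n) \<longleftrightarrow> x \<in> chains \<O> n \<and> (\<forall>k\<le>n. order_preserving \<O> (seg x 0 k))"
  by (simp add: P_def total_eq_seg)

lemma P_Obj_chains: "x \<in> Obj (P \<O> n) \<Longrightarrow> x \<in> chains \<O> n"
  by (simp add: P_Obj)

lemma P_Idn [simp]: "Idn (P \<O> n) = Idn (W \<O> n)" and P_Comp [simp]: "Comp (P \<O> n) = Comp (W \<O> n)"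
  by (simp_all add: P_def)

lemma P_functor:
  assumes "cat_functor (W \<O> n) (W \<O> m) F" and "\<And>x. x \<in> Obj (P \<O> n) \<Longrightarrow> ob_map F x \<in> Obj (P \<O> m)"
  shows "cat_functor (P \<O> n) (P \<O> m) F"
  unfolding P_def by (rule cat_functor_full_subcat[OF assms(1)]) (use assms(2) in \<open>simp add: P_def\<close>)

lemma P_nat_trans:
  assumes "nat_trans (W \<O> n) (W \<O> m) F G t"
    and "\<And>x. x \<in> Obj (P \<O> n) \<Longrightarrow> ob_map F x \<in> Obj (P \<O> m)"
    and "\<And>x. x \<in> Obj (P \<O> n) \<Longrightarrow> ob_map G x \<in> Obj (P \<O> m)"
  shows "nat_trans (P \<O> n) (P \<O> m) F G t"
  unfolding P_def by (rule nat_trans_full_subcat[OF assms(1)]) (use assms(2,3) in \<open>simp_all add: P_def\<close>)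

lemma P_ftr_eq: "ftr_eq (W \<O> n) F G \<Longrightarrow> ftr_eq (P \<O> n) F G"
  unfolding P_def by (rule ftr_eq_full_subcat)

lemma P_reindexes:
  assumes F: "reindexes m n F \<theta>" and \<theta>0: "\<theta> 0 = 0" and x: "x \<in> Obj (P \<O> n)"
  shows "ob_map F x \<in> Obj (P \<O> m)"
proof -
  have \<theta>: "ordinal_map m n \<theta>" using F by (simp add: reindexes_def)
  have xc: "x \<in> chains \<O> n" by (rule P_Obj_chains[OF x])
  show ?thesis
    using x ordinal_map_le[OF \<theta>] \<theta>0
    by (simp add: P_Obj reindexes_ob[OF F xc] reindex_chains[OF xc \<theta>] seg_reindex[OF xc \<theta>])
qed

lemma P_reflect: "x \<in> chains \<O> n \<Longrightarrow> reflect_chain \<O> n x \<in> Obj (P \<O> n)"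
  by (simp add: P_Obj reflect_chains reflect_order_preserving)

text \<open>The composites to the base are order-preserving, so their factorisations are trivial.\<close>

lemma reflection_id_P: "ftr_eq (P \<O> n) (reflection \<O> n) ftr_id"
proof (rule ftr_eqI)
  show "arr_map (reflection \<O> n) \<sigma> = arr_map ftr_id \<sigma>" if "\<sigma> \<in> Arr (P \<O> n)" for \<sigma>
    using that reflect_map_id[of \<sigma> n] by (simp add: P_def full_subcat_def total_eq_seg ftr_id_def)
qed (simp add: P_Obj reflect_id ftr_id_def)

lemma skip_0: "i \<le> n \<Longrightarrow> skip (Suc n - i) 0 = 0"
  by (simp add: skip_def)

lemma duplicate_0: "duplicate k 0 = 0"
  by (simp add: duplicate_def)

lemma P_delta: "i \<le> n \<Longrightarrow> x \<in> Obj (P \<O> (Suc n)) \<Longrightarrow> ob_map (delta \<O> (Suc n) i) x \<in> Obj (P \<O> n)"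
  by (rule P_reindexes[OF reindexes_delta skip_0]) simp_all

lemma P_gamma: "i \<le> n \<Longrightarrow> x \<in> Obj (P \<O> n) \<Longrightarrow> ob_map (gamma \<O> n i) x \<in> Obj (P \<O> (Suc n))"
  by (rule P_reindexes[OF reindexes_gamma duplicate_0]) simp_all

lemma delta_chains: "i \<le> Suc n \<Longrightarrow> x \<in> chains \<O> (Suc n) \<Longrightarrow> ob_map (delta \<O> (Suc n) i) x \<in> chains \<O> n"
  using cat_functor.ob_map_Obj[OF delta_functor, of i n x] by simp

lemma delta_chain_maps:
  "i \<le> Suc n \<Longrightarrow> \<sigma> \<in> chain_maps \<O> (Suc n) \<Longrightarrow> arr_map (delta \<O> (Suc n) i) \<sigma> \<in> chain_maps \<O> n"
  using cat_functor_Arr[OF delta_functor, of i n \<sigma>] by simp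

lemma
  assumes "i \<le> n"
  shows reflection_delta:
      "ftr_eq (W \<O> (Suc n)) (reflection \<O> n \<circ>\<^sub>F delta \<O> (Suc n) i) (delta \<O> (Suc n) i \<circ>\<^sub>F reflection \<O> (Suc n))"
    and unit_delta: "x \<in> chains \<O> (Suc n) \<Longrightarrow>
      reflection_unit \<O> n (ob_map (delta \<O> (Suc n) i) x) = arr_map (delta \<O> (Suc n) i) (reflection_unit \<O> (Suc n) x)"
  using assms by (auto intro!: reflection_reindexes[OF reindexes_delta skip_0])

lemma
  assumes "i \<le> n"
  shows reflection_gamma:
      "ftr_eq (W \<O> n) (reflection \<O> (Suc n) \<circ>\<^sub>F gamma \<O> n i) (gamma \<O> n i \<circ>\<^sub>F reflection \<O> n)"
    and unit_gamma: "x \<in> chains \<O> n \<Longrightarrow>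
      reflection_unit \<O> (Suc n) (ob_map (gamma \<O> n i) x) = arr_map (gamma \<O> n i) (reflection_unit \<O> n x)"
  using assms by (auto intro!: reflection_reindexes[OF reindexes_gamma duplicate_0])

lemma pita_face_simps:
  "i \<le> n \<Longrightarrow> pita_face \<O> (Suc n) i = delta \<O> (Suc n) i"
  "pita_face \<O> (Suc n) (Suc n) = reflection \<O> n \<circ>\<^sub>F delta \<O> (Suc n) (Suc n)"
  by (simp_all add: pita_face_def)

lemma top_functor: "cat_functor (W \<O> (Suc n)) (W \<O> n) (reflection \<O> n \<circ>\<^sub>F delta \<O> (Suc n) (Suc n))"
  by (rule cat_functor_comp[OF delta_functor reflection_functor]) simp

lemma P_face:
  assumes "i \<le> Suc n" "x \<in> Obj (P \<O> (Suc n))"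
  shows "ob_map (pita_face \<O> (Suc n) i) x \<in> Obj (P \<O> n)"
proof (cases "i \<le> n")
  case True
  then show ?thesis using P_delta assms by (simp add: pita_face_simps)
next
  case False
  with assms have "i = Suc n" by simp
  then show ?thesis
    using P_reflect[OF delta_chains[OF _ P_Obj_chains[OF assms(2)]]] by (simp add: pita_face_simps)
qed

lemma W_face_functor: "i \<le> Suc n \<Longrightarrow> cat_functor (W \<O> (Suc n)) (W \<O> n) (pita_face \<O> (Suc n) i)"
  by (cases "i \<le> n") (simp_all add: pita_face_simps delta_functor top_functor le_Suc_eq)

lemma face_functor: "i \<le> Suc n \<Longrightarrow> cat_functor (P \<O> (Suc n)) (P \<O> n) (pita_face \<O> (Suc n) i)"
  by (rule P_functor[OF W_face_functor P_face])

lemma degeneracy_functor: "i \<le> n \<Longrightarrow> cat_functor (P \<O> n) (P \<O> (Suc n)) (pita_degeneracy \<O> n i)"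
  unfolding pita_degeneracy_def by (rule P_functor[OF gamma_functor P_gamma])

text \<open>If \<open>d\<^sub>j\<close> is the top face then \<open>d\<^sub>i\<close> is a lower one, and \<open>\<delta>\<^sub>i\<close> moves past the reflection in \<open>d\<^sub>j\<close>.\<close>

lemma face_face:
  assumes "i < j" "j \<le> Suc (Suc m)" "i \<noteq> Suc m \<or> j \<noteq> Suc (Suc m)"
  shows "ftr_eq (P \<O> (Suc (Suc m))) (pita_face \<O> (Suc m) i \<circ>\<^sub>F pita_face \<O> (Suc (Suc m)) j)
    (pita_face \<O> (Suc m) (j - 1) \<circ>\<^sub>F pita_face \<O> (Suc (Suc m)) i)"
proof (rule P_ftr_eq, cases "j = Suc (Suc m)")
  case True
  with assms have i: "i \<le> m" by simp
  have dd: "ftr_eq (W \<O> (Suc (Suc m))) (delta \<O> (Suc m) i \<circ>\<^sub>F delta \<O> (Suc (Suc m)) (Suc (Suc m)))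
      (delta \<O> (Suc m) (Suc m) \<circ>\<^sub>F delta \<O> (Suc (Suc m)) i)"
    using delta_delta[of i "Suc (Suc m)" m] i by simp
  have "ftr_eq (W \<O> (Suc (Suc m)))
      ((delta \<O> (Suc m) i \<circ>\<^sub>F reflection \<O> (Suc m)) \<circ>\<^sub>F delta \<O> (Suc (Suc m)) (Suc (Suc m)))
      ((reflection \<O> m \<circ>\<^sub>F delta \<O> (Suc m) i) \<circ>\<^sub>F delta \<O> (Suc (Suc m)) (Suc (Suc m)))"
    by (rule ftr_eq_pre[OF ftr_eq_sym[OF reflection_delta[OF i]] delta_functor]) simp
  also have "ftr_eq (W \<O> (Suc (Suc m)))
      ((reflection \<O> m \<circ>\<^sub>F delta \<O> (Suc m) i) \<circ>\<^sub>F delta \<O> (Suc (Suc m)) (Suc (Suc m)))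
      (reflection \<O> m \<circ>\<^sub>F (delta \<O> (Suc m) (Suc m) \<circ>\<^sub>F delta \<O> (Suc (Suc m)) i))"
    unfolding ftr_comp_assoc by (rule ftr_eq_post[OF dd])
  finally show "ftr_eq (W \<O> (Suc (Suc m))) (pita_face \<O> (Suc m) i \<circ>\<^sub>F pita_face \<O> (Suc (Suc m)) j)
    (pita_face \<O> (Suc m) (j - 1) \<circ>\<^sub>F pita_face \<O> (Suc (Suc m)) i)"
    using i True by (simp add: pita_face_simps ftr_comp_assoc)
next
  case False
  with assms delta_delta[of i j m]
  show "ftr_eq (W \<O> (Suc (Suc m))) (pita_face \<O> (Suc m) i \<circ>\<^sub>F pita_face \<O> (Suc (Suc m)) j)
    (pita_face \<O> (Suc m) (j - 1) \<circ>\<^sub>F pita_face \<O> (Suc (Suc m)) i)"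
    by (simp add: pita_face_simps)
qed

lemma face_degeneracy_less:
  assumes "i < j" "j \<le> Suc m"
  shows "ftr_eq (P \<O> (Suc m)) (pita_face \<O> (Suc (Suc m)) i \<circ>\<^sub>F pita_degeneracy \<O> (Suc m) j)
    (pita_degeneracy \<O> m (j - 1) \<circ>\<^sub>F pita_face \<O> (Suc m) i)"
  using P_ftr_eq[OF delta_gamma_less[OF assms]] assms by (simp add: pita_face_simps pita_degeneracy_def)

lemma face_degeneracy_same:
  assumes "j \<le> m" "i = j \<or> i = Suc j"
  shows "ftr_eq (P \<O> m) (pita_face \<O> (Suc m) i \<circ>\<^sub>F pita_degeneracy \<O> m j) ftr_id"
proof (cases "i \<le> m")
  case True
  with P_ftr_eq[OF delta_gamma_same[OF assms]] show ?thesis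
    by (simp add: pita_face_simps pita_degeneracy_def)
next
  case False
  with assms have i: "i = Suc m" by simp
  \<comment> \<open>The top face leaves a reflection behind, which is trivial on locally order-preserving chains.\<close>
  have "ftr_eq (P \<O> m) (reflection \<O> m \<circ>\<^sub>F (delta \<O> (Suc m) i \<circ>\<^sub>F gamma \<O> m j)) (reflection \<O> m \<circ>\<^sub>F ftr_id)"
    by (rule ftr_eq_post[OF P_ftr_eq[OF delta_gamma_same[OF assms]]])
  also have "ftr_eq (P \<O> m) (reflection \<O> m \<circ>\<^sub>F ftr_id) ftr_id"
    using reflection_id_P by simp
  finally show ?thesis by (simp add: i pita_face_simps pita_degeneracy_def ftr_comp_assoc)
qed

lemma face_degeneracy_greater:
  assumes "Suc j < i" "i \<le> Suc (Suc m)"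
  shows "ftr_eq (P \<O> (Suc m)) (pita_face \<O> (Suc (Suc m)) i \<circ>\<^sub>F pita_degeneracy \<O> (Suc m) j)
    (pita_degeneracy \<O> m j \<circ>\<^sub>F pita_face \<O> (Suc m) (i - 1))"
proof (rule P_ftr_eq, cases "i = Suc (Suc m)")
  case True
  have j: "j \<le> m" using assms by simp
  have "ftr_eq (W \<O> (Suc m)) (reflection \<O> (Suc m) \<circ>\<^sub>F (delta \<O> (Suc (Suc m)) i \<circ>\<^sub>F gamma \<O> (Suc m) j))
      (reflection \<O> (Suc m) \<circ>\<^sub>F (gamma \<O> m j \<circ>\<^sub>F delta \<O> (Suc m) (i - 1)))"
    by (rule ftr_eq_post[OF delta_gamma_greater[OF assms]])
  also have "ftr_eq (W \<O> (Suc m)) (reflection \<O> (Suc m) \<circ>\<^sub>F (gamma \<O> m j \<circ>\<^sub>F delta \<O> (Suc m) (i - 1)))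
      ((gamma \<O> m j \<circ>\<^sub>F reflection \<O> m) \<circ>\<^sub>F delta \<O> (Suc m) (i - 1))"
    unfolding ftr_comp_assoc[symmetric]
    by (rule ftr_eq_pre[OF reflection_gamma[OF j] delta_functor]) (use True in simp)
  finally show "ftr_eq (W \<O> (Suc m)) (pita_face \<O> (Suc (Suc m)) i \<circ>\<^sub>F pita_degeneracy \<O> (Suc m) j)
    (pita_degeneracy \<O> m j \<circ>\<^sub>F pita_face \<O> (Suc m) (i - 1))"
    by (simp add: True pita_face_simps pita_degeneracy_def ftr_comp_assoc)
next
  case False
  with assms delta_gamma_greater[OF assms]
  show "ftr_eq (W \<O> (Suc m)) (pita_face \<O> (Suc (Suc m)) i \<circ>\<^sub>F pita_degeneracy \<O> (Suc m) j)
    (pita_degeneracy \<O> m j \<circ>\<^sub>F pita_face \<O> (Suc m) (i - 1))"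
    by (simp add: pita_face_simps pita_degeneracy_def)
qed

lemma degeneracy_degeneracy:
  assumes "i \<le> j" "j \<le> m"
  shows "ftr_eq (P \<O> m) (pita_degeneracy \<O> (Suc m) i \<circ>\<^sub>F pita_degeneracy \<O> m j)
    (pita_degeneracy \<O> (Suc m) (Suc j) \<circ>\<^sub>F pita_degeneracy \<O> m i)"
  using P_ftr_eq[OF gamma_gamma[OF assms]] by (simp add: pita_degeneracy_def)

section \<open>Coherence of the lax top faces\<close>

lemma pita_beta_eq:
  "pita_beta \<O> n x = arr_map (reflection \<O> n) (arr_map (delta \<O> (Suc n) (Suc n))
     (reflection_unit \<O> (Suc n) (ob_map (delta \<O> (Suc (Suc n)) (Suc (Suc n))) x)))"
  by (simp add: pita_beta_def post_whisker_def pre_whisker_def)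

lemma beta_nat_trans:
  "nat_trans (P \<O> (Suc (Suc n))) (P \<O> n)
     (pita_face \<O> (Suc n) (Suc n) \<circ>\<^sub>F pita_face \<O> (Suc (Suc n)) (Suc n))
     (pita_face \<O> (Suc n) (Suc n) \<circ>\<^sub>F pita_face \<O> (Suc (Suc n)) (Suc (Suc n))) (pita_beta \<O> n)"
proof (rule P_nat_trans)
  let ?R = "reflection \<O> n \<circ>\<^sub>F delta \<O> (Suc n) (Suc n)"
  let ?d = "delta \<O> (Suc (Suc n)) (Suc (Suc n))"
  have "cat_functor (W \<O> (Suc (Suc n))) (W \<O> (Suc n)) ?d"
    by (rule delta_functor) simp
  from nat_trans_post[OF top_functor nat_trans_pre[OF this reflection_unit_nat_trans]]
  have *: "nat_trans (W \<O> (Suc (Suc n))) (W \<O> n) (?R \<circ>\<^sub>F ?d) (?R \<circ>\<^sub>F (reflection \<O> (Suc n) \<circ>\<^sub>F ?d)) (pita_beta \<O> n)"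
    by (simp add: pita_beta_def)
  have "ftr_eq (W \<O> (Suc (Suc n))) (delta \<O> (Suc n) (Suc n) \<circ>\<^sub>F ?d)
      (delta \<O> (Suc n) (Suc n) \<circ>\<^sub>F delta \<O> (Suc (Suc n)) (Suc n))"
    using delta_delta[of "Suc n" "Suc (Suc n)" n] by simp
  from nat_trans_cong_source[OF *, unfolded ftr_comp_assoc, OF ftr_eq_post[OF this]]
  show "nat_trans (W \<O> (Suc (Suc n))) (W \<O> n)
     (pita_face \<O> (Suc n) (Suc n) \<circ>\<^sub>F pita_face \<O> (Suc (Suc n)) (Suc n))
     (pita_face \<O> (Suc n) (Suc n) \<circ>\<^sub>F pita_face \<O> (Suc (Suc n)) (Suc (Suc n))) (pita_beta \<O> n)"
    by (simp add: pita_face_simps ftr_comp_assoc)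
qed (simp_all add: P_face)

text \<open>Put \<open>y = \<delta>\<^bsub>n+3\<^esub> x\<close>, \<open>s = \<delta>\<^bsub>n+2\<^esub>(\<pi>\<^sub>y) : z \<rightarrow> z'\<close> and \<open>R = r\<^sub>n \<delta>\<^bsub>n+1\<^esub>\<close>. The left-hand side is the image under
  \<open>R\<close> of \<open>r(s) \<pi>\<^sub>z\<close> and the right-hand side is the image of \<open>\<pi>\<^bsub>z'\<^esub> s\<close>. For the last factor this uses
  that \<open>R\<close> does not distinguish between \<open>\<delta>\<^bsub>n+1\<^esub>(\<pi>\<^sub>y)\<close>, which is a component of the unit, and \<open>s\<close>.\<close>

lemma beta_coherence:
  "nat_eq (P \<O> (Suc (Suc (Suc n))))
     (vcomp (P \<O> n) (pita_face \<O> (Suc n) (Suc n) \<lhd>\<^sub>F pita_beta \<O> (Suc n))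
       (pita_beta \<O> n \<rhd>\<^sub>F pita_face \<O> (Suc (Suc (Suc n))) (Suc (Suc n))))
     (vcomp (P \<O> n) (pita_beta \<O> n \<rhd>\<^sub>F pita_face \<O> (Suc (Suc (Suc n))) (Suc (Suc (Suc n))))
       (pita_beta \<O> n \<rhd>\<^sub>F pita_face \<O> (Suc (Suc (Suc n))) (Suc n)))"
  unfolding nat_eq_def
proof
  let ?a = "Suc n" and ?b = "Suc (Suc n)" and ?c = "Suc (Suc (Suc n))"
  let ?R = "reflection \<O> n \<circ>\<^sub>F delta \<O> ?a ?a"
  let ?u = "reflection_unit \<O> ?a"
  fix x
  assume "x \<in> Obj (P \<O> ?c)"
  then have x: "x \<in> chains \<O> ?c" by (rule P_Obj_chains)
  define y where "y = ob_map (delta \<O> ?c ?c) x"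
  have y: "y \<in> chains \<O> ?b" using delta_chains[OF _ x] by (simp add: y_def)
  note unit = reflection_unit_chain_maps[OF y]
  define z where "z = ob_map (delta \<O> ?b ?b) y"
  define z' where "z' = ob_map (delta \<O> ?b ?b) (reflect_chain \<O> ?b y)"
  define s where "s = arr_map (delta \<O> ?b ?b) (reflection_unit \<O> ?b y)"
  have z: "z \<in> chains \<O> ?a" "z' \<in> chains \<O> ?a"
    using delta_chains[OF _ y] delta_chains[OF _ reflect_chains[OF y]] by (simp_all add: z_def z'_def)
  have s: "s \<in> Hom (W \<O> ?a) z z'"
    using cat_functor.arr_map_Hom[OF delta_functor[of ?b ?a], of "reflection_unit \<O> ?b y" y "reflect_chain \<O> ?b y"] unit
    by (simp add: s_def z_def z'_def Hom_def)
  have u: "?u z \<in> Hom (W \<O> ?a) z (reflect_chain \<O> ?a z)" "?u z' \<in> Hom (W \<O> ?a) z' (reflect_chain \<O> ?a z')"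
    using reflection_unit_chain_maps z by (simp_all add: Hom_def)
  have rs: "arr_map (reflection \<O> ?a) s \<in> Hom (W \<O> ?a) (reflect_chain \<O> ?a z) (reflect_chain \<O> ?a z')"
    using cat_functor.arr_map_Hom[OF reflection_functor s] by simp
  have z_eq: "ob_map (delta \<O> ?b ?b) (ob_map (delta \<O> ?c ?b) x) = z"
    using ftr_eq_ob[OF delta_delta[of ?b ?c ?a], of x] x by (simp add: z_def y_def)
  have "?u (ob_map (delta \<O> ?b ?b) (ob_map (delta \<O> ?c ?a) x)) = ?u (ob_map (delta \<O> ?b ?a) y)"
    using ftr_eq_ob[OF delta_delta[of ?a ?c ?a], of x] x by (simp add: y_def)
  also have "\<dots> = arr_map (delta \<O> ?b ?a) (reflection_unit \<O> ?b y)"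
    by (rule unit_delta[OF _ y]) simp
  finally have "arr_map ?R (?u (ob_map (delta \<O> ?b ?b) (ob_map (delta \<O> ?c ?a) x))) = arr_map ?R s"
    using ftr_eq_arr[OF delta_delta[of ?a ?b n], of "reflection_unit \<O> ?b y"] unit by (simp add: s_def)
  moreover have "arr_map ?R (arr_map (reflection \<O> ?a) s) \<cdot>\<^bsub>W \<O> n\<^esub> arr_map ?R (?u z) =
      arr_map ?R (?u z') \<cdot>\<^bsub>W \<O> n\<^esub> arr_map ?R s"
    using nat_trans.naturality[OF reflection_unit_nat_trans s]
      cat_functor.arr_map_Comp[OF top_functor u(1) rs] cat_functor.arr_map_Comp[OF top_functor s u(2)]
    by (simp add: ftr_id_def)
  ultimately show "vcomp (P \<O> n) (pita_face \<O> ?a ?a \<lhd>\<^sub>F pita_beta \<O> ?a) (pita_beta \<O> n \<rhd>\<^sub>F pita_face \<O> ?c ?b) x =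
      vcomp (P \<O> n) (pita_beta \<O> n \<rhd>\<^sub>F pita_face \<O> ?c ?c) (pita_beta \<O> n \<rhd>\<^sub>F pita_face \<O> ?c ?a) x"
    by (simp add: vcomp_def post_whisker_def pre_whisker_def pita_beta_eq pita_face_simps z_eq
        y_def[symmetric] s_def[symmetric] z'_def[symmetric])
qed

text \<open>The degeneracy \<open>s\<^bsub>n+1\<^esub>\<close> is cancelled by the face inside \<open>\<beta>\<^sub>n\<close>, which leaves a component of the unit at a
  locally order-preserving chain.\<close>

lemma beta_top_degeneracy:
  "nat_eq (P \<O> (Suc n)) (pita_beta \<O> n \<rhd>\<^sub>F pita_degeneracy \<O> (Suc n) (Suc n))
     (nat_id (P \<O> n) (pita_face \<O> (Suc n) (Suc n)))"
  unfolding nat_eq_def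
proof
  fix x
  assume x: "x \<in> Obj (P \<O> (Suc n))"
  then have xc: "x \<in> Obj (W \<O> (Suc n))" using P_Obj_chains by simp
  have "ob_map (delta \<O> (Suc (Suc n)) (Suc (Suc n))) (ob_map (gamma \<O> (Suc n) (Suc n)) x) = x"
    using ftr_eq_ob[OF delta_gamma_same[of "Suc n" "Suc n" "Suc (Suc n)"] xc] by (simp add: ftr_id_def)
  moreover have "reflection_unit \<O> (Suc n) x = Idn (W \<O> (Suc n)) x"
    using x by (intro reflection_unit_id) (simp_all add: P_Obj)
  ultimately show "(pita_beta \<O> n \<rhd>\<^sub>F pita_degeneracy \<O> (Suc n) (Suc n)) x =
      nat_id (P \<O> n) (pita_face \<O> (Suc n) (Suc n)) x"
    using cat_functor.arr_map_Idn[OF top_functor xc]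
    by (simp add: pre_whisker_def nat_id_def pita_beta_eq pita_face_simps pita_degeneracy_def)
qed

text \<open>The lower face \<open>\<delta>\<^sub>i\<close> passes the reflection, then \<open>\<delta>\<^bsub>n+2\<^esub>\<close>, the unit, and \<open>\<delta>\<^bsub>n+3\<^esub>\<close>.\<close>

lemma beta_face:
  assumes i: "i \<le> n"
  shows "nat_eq (P \<O> (Suc (Suc (Suc n)))) (pita_face \<O> (Suc n) i \<lhd>\<^sub>F pita_beta \<O> (Suc n))
     (pita_beta \<O> n \<rhd>\<^sub>F pita_face \<O> (Suc (Suc (Suc n))) i)"
  unfolding nat_eq_def
proof
  let ?a = "Suc n" and ?b = "Suc (Suc n)" and ?c = "Suc (Suc (Suc n))"
  fix x
  assume "x \<in> Obj (P \<O> ?c)"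
  then have x: "x \<in> chains \<O> ?c" by (rule P_Obj_chains)
  define y where "y = ob_map (delta \<O> ?c ?c) x"
  have y: "y \<in> chains \<O> ?b" using delta_chains[OF _ x] by (simp add: y_def)
  note unit = reflection_unit_chain_maps[OF y]
  have "arr_map (delta \<O> ?a i) (arr_map (reflection \<O> ?a) (arr_map (delta \<O> ?b ?b) (reflection_unit \<O> ?b y))) =
      arr_map (reflection \<O> n) (arr_map (delta \<O> ?a i) (arr_map (delta \<O> ?b ?b) (reflection_unit \<O> ?b y)))"
    using ftr_eq_arr[OF reflection_delta[OF i]] delta_chain_maps[OF _ unit] by simp
  also have "\<dots> = arr_map (reflection \<O> n) (arr_map (delta \<O> ?a ?a) (arr_map (delta \<O> ?b i) (reflection_unit \<O> ?b y)))"
    using ftr_eq_arr[OF delta_delta[of i ?b n], of "reflection_unit \<O> ?b y"] i unit by simp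
  also have "arr_map (delta \<O> ?b i) (reflection_unit \<O> ?b y) = reflection_unit \<O> ?a (ob_map (delta \<O> ?b i) y)"
    using unit_delta[OF _ y, of i] i by simp
  also have "ob_map (delta \<O> ?b i) y = ob_map (delta \<O> ?b ?b) (ob_map (delta \<O> ?c i) x)"
    using ftr_eq_ob[OF delta_delta[of i ?c ?a], of x] i x by (simp add: y_def)
  finally show "(pita_face \<O> ?a i \<lhd>\<^sub>F pita_beta \<O> ?a) x = (pita_beta \<O> n \<rhd>\<^sub>F pita_face \<O> ?c i) x"
    using i by (simp add: post_whisker_def pre_whisker_def pita_beta_eq pita_face_simps y_def)
qed

text \<open>In the same way \<open>\<gamma>\<^sub>i\<close> passes all four constituents of \<open>\<beta>\<^bsub>n+1\<^esub>\<close>.\<close>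

lemma beta_degeneracy:
  assumes i: "i \<le> n"
  shows "nat_eq (P \<O> (Suc (Suc n))) (pita_beta \<O> (Suc n) \<rhd>\<^sub>F pita_degeneracy \<O> (Suc (Suc n)) i)
     (pita_degeneracy \<O> n i \<lhd>\<^sub>F pita_beta \<O> n)"
  unfolding nat_eq_def
proof
  let ?a = "Suc n" and ?b = "Suc (Suc n)" and ?c = "Suc (Suc (Suc n))"
  fix x
  assume "x \<in> Obj (P \<O> ?b)"
  then have x: "x \<in> chains \<O> ?b" by (rule P_Obj_chains)
  define y where "y = ob_map (delta \<O> ?b ?b) x"
  have y: "y \<in> chains \<O> ?a" using delta_chains[OF _ x] by (simp add: y_def)
  note unit = reflection_unit_chain_maps[OF y]
  have "ob_map (delta \<O> ?c ?c) (ob_map (gamma \<O> ?b i) x) = ob_map (gamma \<O> ?a i) y"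
    using ftr_eq_ob[OF delta_gamma_greater[of i ?c ?a], of x] i x by (simp add: y_def)
  then have "reflection_unit \<O> ?b (ob_map (delta \<O> ?c ?c) (ob_map (gamma \<O> ?b i) x)) =
      arr_map (gamma \<O> ?a i) (reflection_unit \<O> ?a y)"
    using unit_gamma[OF _ y, of i] i by simp
  moreover have "arr_map (delta \<O> ?b ?b) (arr_map (gamma \<O> ?a i) (reflection_unit \<O> ?a y)) =
      arr_map (gamma \<O> n i) (arr_map (delta \<O> ?a ?a) (reflection_unit \<O> ?a y))"
    using ftr_eq_arr[OF delta_gamma_greater[of i ?b n], of "reflection_unit \<O> ?a y"] i unit by simp
  moreover have "arr_map (reflection \<O> ?a) (arr_map (gamma \<O> n i) (arr_map (delta \<O> ?a ?a) (reflection_unit \<O> ?a y))) =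
      arr_map (gamma \<O> n i) (arr_map (reflection \<O> n) (arr_map (delta \<O> ?a ?a) (reflection_unit \<O> ?a y)))"
    using ftr_eq_arr[OF reflection_gamma[OF i]] delta_chain_maps[OF _ unit] by simp
  ultimately show "(pita_beta \<O> ?a \<rhd>\<^sub>F pita_degeneracy \<O> ?b i) x = (pita_degeneracy \<O> n i \<lhd>\<^sub>F pita_beta \<O> n) x"
    by (simp add: post_whisker_def pre_whisker_def pita_beta_eq pita_degeneracy_def y_def)
qed

lemma category_P: "category (P \<O> n)"
  unfolding P_def by (rule category_full_subcat[OF category_W])

lemma toplax_simplicial_pita_nerve:
  "toplax_simplicial_category (P \<O>) (pita_face \<O>) (pita_degeneracy \<O>) (pita_beta \<O>)"
  by (rule toplax_simplicial_category.intro)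
    (simp_all add: category_P face_functor degeneracy_functor beta_nat_trans
      face_face[unfolded One_nat_def] face_degeneracy_less[unfolded One_nat_def] face_degeneracy_same
      face_degeneracy_greater[unfolded One_nat_def] degeneracy_degeneracy
      beta_coherence beta_top_degeneracy beta_face beta_degeneracy numeral_3_eq_3)

end

theorem theoremA:
  fixes \<O> :: "('o, 'a) opcat"
  assumes "strictly_factorisable \<O>"
  shows "toplax_simplicial_category (P \<O>) (pita_face \<O>) (pita_degeneracy \<O>) (pita_beta \<O>)"
  by (rule strictly_factorisable.toplax_simplicial_pita_nerve[OF assms])

end
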